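(* Let $0<\alpha<1$, let $U$ be a random variable uniformly distributed on $(0,\pi)$, and let $a_\alpha(U)$ be Kanter's random variable, which takes values in $(a_\alpha(0),\infty)$ with $a_\alpha(0)=(1-\alpha)\alpha^{\alpha/(1-\alpha)}$. Then the density $h_\alpha$ of $a_\alpha(U)$ is given, for $y>a_\alpha(0)$, by $$h_{\alpha}(y) = \frac{1}{y}\,H^{1,0}_{2,1}\left[\frac{1}{y}\,\Big|_{(1,1/(1-\alpha))}^{(1,\alpha/(1-\alpha)),(1,1)}\right] = \frac{2(1-\alpha)}{y}\, H^{1,0}_{2,1}\left[\frac{1}{y^{2(1-\alpha)}}\,\Big|_{(1,2)}^{(1,2\alpha),(1,2(1-\alpha))}\right].$$
   Context: For $0<\alpha<1$ and $u\in(0,\pi)$ put $c_\alpha(u)=\frac{\sin(\alpha u)}{\sin u}$, $b_\alpha(u)=[c_\alpha(u)]^{\alpha}[c_{1-\alpha}(u)]^{1-\alpha}$ and $a_\alpha(u)=[b_\alpha(u)]^{1/(1-\alpha)}$. The function $a_\alpha$ is strictly increasing on $(0,\pi)$, and $a_\alpha(0):=\lim_{u\to0^+}a_\alpha(u)=(1-\alpha)\alpha^{\alpha/(1-\alpha)}$. Fox H-function (the case needed): let $a_1,a_2,b\in\mathbb{R}$ and $A_1,A_2,B>0$ with $B=A_1+A_2$, and put $\beta=B^{B}A_1^{-A_1}A_2^{-A_2}$. For $0<z<\beta$, $$H^{1,0}_{2,1}\left[z\,\Big|_{(b,B)}^{(a_1,A_1),(a_2,A_2)}\right]=\frac{1}{2i\pi}\int_{L_{-\infty}}\frac{\Gamma(b+Bs)}{\Gamma(a_1+A_1s)\,\Gamma(a_2+A_2s)}\,z^{-s}\,ds,$$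 where $z^{-s}=e^{-s\log z}$ with the real logarithm and $L_{-\infty}$ is a loop which starts at $-\infty+i\eta_1$, ends at $-\infty+i\eta_2$ (with $\eta_1<0<\eta_2$), and encircles once, counterclockwise, all the poles of $s\mapsto\Gamma(b+Bs)$. *)

theory Defs
  imports "HOL-Probability.Probability" "HOL-Complex_Analysis.Complex_Analysis"
begin

definition kanter_c :: "real \<Rightarrow> real \<Rightarrow> real" where
  "kanter_c \<alpha> u = sin (\<alpha> * u) / sin u"

definition kanter_b :: "real \<Rightarrow> real \<Rightarrow> real" where
  "kanter_b \<alpha> u = kanter_c \<alpha> u powr \<alpha> * kanter_c (1 - \<alpha>) u powr (1 - \<alpha>)"

definition kanter_a :: "real \<Rightarrow> real \<Rightarrow> real" where
  "kanter_a \<alpha> u = kanter_b \<alpha> u powr (1 / (1 - \<alpha>))"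

(* An infinite loop is parametrised by the whole real line.  It comes from -\<infinity> + i \<eta>1 and
   returns to -\<infinity> + i \<eta>2.  That it encircles p once counterclockwise is expressed by closing up
   its restriction to [-T, T] with a segment: for large T this segment lies to the left of p,
   and the winding number of the resulting closed path around p is 1. *)
definition left_loop :: "complex set \<Rightarrow> (real \<Rightarrow> complex) \<Rightarrow> bool" where
  "left_loop P L \<longleftrightarrow>
     (\<forall>u v. L piecewise_C1_differentiable_on {u..v}) \<and>
     (\<exists>\<eta>1 \<eta>2. \<eta>1 < 0 \<and> 0 < \<eta>2 \<and>
        filterlim (\<lambda>t. Re (L t)) at_bot at_bot \<and> ((\<lambda>t. Im (L t)) \<longlongrightarrow> \<eta>1) at_bot \<and>
        filterlim (\<lambda>t. Re (L t)) at_bot at_top \<and> ((\<lambda>t. Im (L t)) \<longlongrightarrow> \<eta>2) at_top) \<and>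
     (\<forall>p\<in>P. p \<notin> range L \<and>
        (\<forall>\<^sub>F T in at_top.
           winding_number (subpath (-T) T L +++ linepath (L T) (L (-T))) p = 1))"

(* The integral along an infinite loop is improper, with the two ends going to infinity
   independently. *)
definition has_loop_integral ::
    "(complex \<Rightarrow> complex) \<Rightarrow> complex \<Rightarrow> (real \<Rightarrow> complex) \<Rightarrow> bool" where
  "has_loop_integral f I L \<longleftrightarrow>
     ((\<lambda>(S, T). contour_integral (subpath (-S) T L) f) \<longlongrightarrow> I) (at_top \<times>\<^sub>F at_top)"

(* Gamma is 0 at its poles, and x / 0 = 0, so the quotient is also correct at the
   points where the denominator has a pole. *)
definition fox_integrand ::
    "real \<Rightarrow> real \<Rightarrow> real \<Rightarrow> real \<Rightarrow> real \<Rightarrow> real \<Rightarrow> real \<Rightarrow> complex \<Rightarrow> complex" where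
  "fox_integrand a1 A1 a2 A2 b B z s =
     Gamma (of_real b + of_real B * s)
       / (Gamma (of_real a1 + of_real A1 * s) * Gamma (of_real a2 + of_real A2 * s))
       * exp (- s * of_real (ln z))"

(* The Fox function of type H^{1,0}_{2,1} at z, with upper parameters (a1,A1), (a2,A2) and lower
   parameter (b,B), is meant for A1, A2, B > 0, B = A1 + A2 and
   0 < z < B^B A1^{-A1} A2^{-A2}.  It is the common value of the integrals along all
   loops around the poles of the numerator. *)
definition fox_H ::
    "real \<Rightarrow> real \<Rightarrow> real \<Rightarrow> real \<Rightarrow> real \<Rightarrow> real \<Rightarrow> real \<Rightarrow> complex" where
  "fox_H a1 A1 a2 A2 b B z =
     (THE w. \<forall>L. left_loop {p. is_pole (\<lambda>s. Gamma (of_real b + of_real B * s)) p} L \<longrightarrow>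
        has_loop_integral (fox_integrand a1 A1 a2 A2 b B z) (2 * of_real pi * \<i> * w) L)"

end

theory Submission imports Defs begin

text \<open>
  Write \<open>b\<close> for \<open>kanter_b \<alpha>\<close>, so that \<open>kanter_a \<alpha>\<close> is \<open>b powr (1 / (1 - \<alpha>))\<close>, and put
  \<open>f(s) = \<Gamma>(1 + s) / (\<Gamma>(1 + \<alpha> s) \<Gamma>(1 + (1 - \<alpha>) s))\<close>.  Up to a linear substitution in \<open>s\<close>, both
  Fox integrands are \<open>f(s) e\<^sup>x\<^sup>s\<close> with \<open>x = (1 - \<alpha>) ln y\<close>.

  Kanter's curve \<open>X(u) = sin (\<alpha> u) e\<^bsup>i (1 - \<alpha>) u\<^esup> / sin u\<close> satisfies
  \<open>X(u)\<^sup>\<alpha> (1 - X(u))\<^bsup>1 - \<alpha>\<^esup> = b(u)\<close>.  For \<open>0 < Re t < 1\<close>, deforming it onto the two sides of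
  the negative half-line turns \<open>\<integral> b(u)\<^sup>t du\<close> over \<open>(0, \<pi>)\<close> into a Beta integral equal to
  \<open>\<pi> f(-t)\<close>; letting \<open>Re t\<close> tend to 0 gives the characteristic function of \<open>ln b(U)\<close>.

  The reflection formula and the Beta integral give \<open>|f(s)| \<le> C b(0+)\<^bsup>- Re s\<^esup>\<close> in the left
  half-plane away from the real axis.  Hence, for \<open>x > ln b(0+)\<close>, the primitive of
  \<open>f(s) e\<^sup>x\<^sup>s\<close> on the slit plane converges as \<open>Re s \<rightarrow> - \<infinity>\<close> above and below the slit,
  and every admissible loop integral is the difference of the two limits.  The same bound
  shifts the contour in Levy's inversion formula from the imaginary axis to such a loop, so that
  the loop integral divided by \<open>2 \<pi> i\<close> is the density of \<open>ln b(U)\<close>.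
\<close>

subsection \<open>Integrals along loops around a left half-line\<close>

text \<open>Kanter's curve is the curve of argument zero of X^\<alpha> (1 - X)^(1 - \<alpha>) that
  leaves the saddle point X = \<alpha>, where the derivative of \<alpha> ln X + (1 - \<alpha>) ln (1
  - X) vanishes. On (0, 1) this function is maximal there, with maximum
  \<open>ln_b0 \<alpha>\<close> = ln b(0+). One number therefore governs the left end of the law of
  ln b(U), the exponential rate of f in the left half-plane and the range of convergence of the Fox
  integrals. Two obstacles shape the argument. A loop in the sense of \<open>left_loop\<close> may
  cross the negative half-line between poles, so a primitive on the slit plane cannot be followed
  along it; only winding numbers about the poles are known, and they have to be turned into
  increments of logarithms. And the bound on f does not decay in Im s, so the inversion is not done
  pointwise in x: contours are shifted after integrating x over an interval [a, b], and the result
  is an identity for interval probabilities.\<close>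

lemma subpath_subpath:
  "subpath a b (subpath u v g) = subpath (u + (v - u) * a) (u + (v - u) * b) g"
  by (auto simp: subpath_def fun_eq_iff algebra_simps)

text \<open>A piece of an infinite loop becomes a subpath of one path on the unit interval; the new
  parameters lie in [0, 1] as soon as \<open>u\<close> and \<open>v\<close> lie in [-T, T].\<close>

lemma subpath_eq_subpath_symmetric:
  fixes T :: real
  assumes "T > 0"
  shows "subpath u v g = subpath ((u + T) / (2 * T)) ((v + T) / (2 * T)) (subpath (-T) T g)"
  using assms by (simp add: subpath_subpath field_simps)

lemma valid_path_subpath_real_line:
  fixes L :: "real \<Rightarrow> complex"
  assumes "\<And>u v. L piecewise_C1_differentiable_on {u..v}"
  shows "valid_path (subpath u v L)"
proof -
  define T where "T = max \<bar>u\<bar> \<bar>v\<bar> + 1"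
  have T: "T > 0" "\<bar>u\<bar> \<le> T" "\<bar>v\<bar> \<le> T" by (auto simp: T_def)
  have "(L \<circ> (\<lambda>x. (T - (-T)) * x + (-T))) piecewise_C1_differentiable_on {0..1}"
  proof (rule piecewise_C1_differentiable_compose)
    show "(\<lambda>x. (T - (-T)) * x + (-T)) piecewise_C1_differentiable_on {0..1}"
      by (simp add: C1_differentiable_imp_piecewise)
    show "L piecewise_C1_differentiable_on (\<lambda>x. (T - (-T)) * x + (-T)) ` {0..1}"
      using T assms by (subst image_affinity_atLeastAtMost) auto
    show "\<And>x. finite ({0..1} \<inter> (\<lambda>x. (T - (-T)) * x + (-T)) -` {x})"
      using T by (simp add: Int_commute [of "{0..1}"] inj_on_def crossproduct_eq finite_vimage_IntI)
  qed
  then have "valid_path (subpath (-T) T L)"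
    by (simp add: valid_path_def subpath_def o_def)
  then show ?thesis
    unfolding subpath_eq_subpath_symmetric[OF T(1), of u v]
    by (rule valid_path_subpath) (use T in \<open>auto simp: field_simps\<close>)
qed

lemma contour_integral_subpath_combine_real_line:
  fixes L :: "real \<Rightarrow> complex"
  assumes L: "\<And>u v. L piecewise_C1_differentiable_on {u..v}"
    and "u \<le> v" "v \<le> w" and f: "f contour_integrable_on (subpath u w L)"
  shows "contour_integral (subpath u v L) f + contour_integral (subpath v w L) f
    = contour_integral (subpath u w L) f"
proof (cases "u = w")
  case True
  then show ?thesis using assms by simp
next
  case False
  let ?g = "subpath u w L" and ?m = "(v - u) / (w - u)"
  have "subpath u v L = subpath 0 ?m ?g" "subpath v w L = subpath ?m 1 ?g" "?g = subpath 0 1 ?g"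
    using False by (simp_all add: subpath_subpath)
  moreover have "contour_integral (subpath 0 ?m ?g) f + contour_integral (subpath ?m 1 ?g) f
      = contour_integral (subpath 0 1 ?g) f"
    by (rule contour_integral_subpath_combine)
       (use f False assms valid_path_subpath_real_line[OF L] in \<open>auto simp: field_simps\<close>)
  ultimately show ?thesis by metis
qed

section \<open>Branches of the logarithm and winding numbers\<close>

lemma Ln_minus_if_Im:
  "Im z > 0 \<Longrightarrow> Ln (- z) = Ln z - \<i> * pi"
  "Im z < 0 \<Longrightarrow> Ln (- z) = Ln z + \<i> * pi"
  by (auto simp: Ln_minus complex_eq_iff[of z])

lemma contour_integral_inverse_diff_Ln:
  assumes "valid_path g" "\<And>z. z \<in> path_image g \<Longrightarrow> z - p \<notin> \<real>\<^sub>\<le>\<^sub>0"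
  shows "((\<lambda>w. 1 / (w - p)) has_contour_integral
    (Ln (pathfinish g - p) - Ln (pathstart g - p))) g"
proof -
  have "((\<lambda>w. 1 / (w - p)) has_contour_integral
    ((\<lambda>z. Ln (z - p)) (pathfinish g) - (\<lambda>z. Ln (z - p)) (pathstart g))) g"
    by (rule contour_integral_primitive[where S = "{z. z - p \<notin> \<real>\<^sub>\<le>\<^sub>0}"])
       (use assms in \<open>auto intro!: derivative_eq_intros simp: inverse_eq_divide\<close>)
  then show ?thesis by simp
qed

text \<open>The branch \<open>Ln (p - z)\<close> is cut along the half-line to the right of
  \<open>p\<close>. It is the one that applies to the segment closing up a loop on the left of
  \<open>p\<close>.\<close>

lemma contour_integral_inverse_diff_Ln_minus:
  assumes "valid_path g" "\<And>z. z \<in> path_image g \<Longrightarrow> p - z \<notin> \<real>\<^sub>\<le>\<^sub>0"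
  shows "((\<lambda>w. 1 / (w - p)) has_contour_integral
    (Ln (p - pathfinish g) - Ln (p - pathstart g))) g"
proof -
  have "((\<lambda>w. 1 / (w - p)) has_contour_integral
    ((\<lambda>z. Ln (p - z)) (pathfinish g) - (\<lambda>z. Ln (p - z)) (pathstart g))) g"
  proof (rule contour_integral_primitive[where S = "{z. p - z \<notin> \<real>\<^sub>\<le>\<^sub>0}"])
    fix x assume "x \<in> {z. p - z \<notin> \<real>\<^sub>\<le>\<^sub>0}"
    then show "((\<lambda>z. Ln (p - z)) has_field_derivative 1 / (x - p)) (at x within {z. p - z \<notin> \<real>\<^sub>\<le>\<^sub>0})"
      by (cases "p = x") (auto intro!: derivative_eq_intros simp: field_simps)
  qed (use assms in auto)
  then show ?thesis by simp
qed

lemma left_loop_ends: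
  assumes "left_loop P L"
  obtains \<eta> T0 where "\<eta> > 0" "T0 > 0" "\<And>t. t \<ge> T0 \<Longrightarrow> Im (L t) > \<eta>"
    "\<And>t. t \<le> -T0 \<Longrightarrow> Im (L t) < -\<eta>"
proof -
  obtain e1 e2 where e: "e1 < 0" "0 < e2" "((\<lambda>t. Im (L t)) \<longlongrightarrow> e1) at_bot"
      "((\<lambda>t. Im (L t)) \<longlongrightarrow> e2) at_top"
    using assms by (auto simp: left_loop_def)
  define \<eta> where "\<eta> = min (-e1) e2 / 2"
  have \<eta>: "\<eta> > 0" "e1 < -\<eta>" "\<eta> < e2" using e by (auto simp: \<eta>_def)
  obtain N1 where N1: "\<And>t. t \<ge> N1 \<Longrightarrow> Im (L t) > \<eta>"
    using order_tendstoD(1)[OF e(4) \<eta>(3)] by (auto simp: eventually_at_top_linorder)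
  obtain N2 where N2: "\<And>t. t \<le> N2 \<Longrightarrow> Im (L t) < -\<eta>"
    using order_tendstoD(2)[OF e(3) \<eta>(2)] by (auto simp: eventually_at_bot_linorder)
  show ?thesis
    by (rule that[of \<eta> "max 1 (max N1 (-N2))"]) (use \<eta> N1 N2 in auto)
qed

text \<open>This is where winding number 1 enters: the loop passes \<open>p\<close> like a path that crosses the real
  axis to the right of \<open>p\<close>, where the principal logarithm is a primitive.\<close>

lemma left_loop_integral_inverse_diff:
  assumes L: "left_loop P L" and p: "p \<in> P" "Im p = 0"
    and T0: "T0 > 0" "\<And>t. t \<ge> T0 \<Longrightarrow> Im (L t) > 0" "\<And>t. t \<le> -T0 \<Longrightarrow> Im (L t) < 0"
    and ST: "S \<ge> T0" "T \<ge> T0"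
  shows "((\<lambda>w. 1 / (w - p)) has_contour_integral (Ln (L T - p) - Ln (L (-S) - p))) (subpath (-S) T L)"
proof -
  have C1: "\<And>u v. L piecewise_C1_differentiable_on {u..v}" and pL: "p \<notin> range L"
    using L p by (auto simp: left_loop_def)
  note vp = valid_path_subpath_real_line[OF C1]
  have int: "(\<lambda>w. 1 / (w - p)) contour_integrable_on (subpath u v L)" for u v
    by (rule contour_integrable_inversediff[OF vp]) (use pL in \<open>auto simp: path_image_subpath_gen\<close>)
  have "\<forall>\<^sub>F T in at_top. winding_number (subpath (-T) T L +++ linepath (L T) (L (-T))) p = 1"
    using L p by (auto simp: left_loop_def)
  moreover have "\<forall>\<^sub>F T in at_top. Re (L T) < Re p"
    using L by (auto simp: left_loop_def filterlim_at_bot_dense)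
  moreover have "\<forall>\<^sub>F T in at_bot. Re (L T) < Re p"
    using L by (auto simp: left_loop_def filterlim_at_bot_dense)
  then have "\<forall>\<^sub>F T in at_top. Re (L (-T)) < Re p"
    by (simp add: at_bot_mirror eventually_filtermap)
  moreover have "\<forall>\<^sub>F R in at_top. R \<ge> max S T" by (rule eventually_ge_at_top)
  ultimately have "\<forall>\<^sub>F T' in at_top. winding_number (subpath (-T') T' L +++ linepath (L T') (L (-T'))) p = 1
      \<and> Re (L T') < Re p \<and> Re (L (-T')) < Re p \<and> T' \<ge> max S T"
    by eventually_elim auto
  \<comment> \<open>Winding number 1 holds only for large parameters, so the closed path is taken
    beyond both \<open>S\<close> and \<open>T\<close>.\<close>
  then obtain R where R: "winding_number (subpath (-R) R L +++ linepath (L R) (L (-R))) p = 1"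
      "Re (L R) < Re p" "Re (L (-R)) < Re p" "R \<ge> S" "R \<ge> T"
    by (auto simp: eventually_at_top_linorder)
  have seg: "Re z < Re p" if "z \<in> closed_segment (L R) (L (-R))" for z
  proof -
    have "closed_segment (L R) (L (-R)) \<subseteq> {z. Re z < Re p}"
      by (rule closed_segment_subset) (use R in \<open>auto intro: convex_halfspace_Re_lt\<close>)
    then show ?thesis using that by auto
  qed
  have 1: "((\<lambda>w. 1 / (w - p)) has_contour_integral (Ln (p - L (-R)) - Ln (p - L R)))
      (linepath (L R) (L (-R)))"
    using contour_integral_inverse_diff_Ln_minus[of "linepath (L R) (L (-R))" p] seg
    by (fastforce simp: complex_nonpos_Reals_iff)
  have pI: "p \<notin> path_image (subpath (-R) R L +++ linepath (L R) (L (-R)))"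
    using pL seg[of p] by (subst path_image_join) (auto simp: path_image_subpath_gen)
  have vj: "valid_path (subpath (-R) R L +++ linepath (L R) (L (-R)))"
    by (intro valid_path_join vp) auto
  have "contour_integral (subpath (-R) R L +++ linepath (L R) (L (-R))) (\<lambda>w. 1 / (w - p)) = 2 * pi * \<i>"
    using winding_number_valid_path[OF vj pI] R(1) by (simp add: field_simps)
  then have "contour_integral (subpath (-R) R L) (\<lambda>w. 1 / (w - p)) + (Ln (p - L (-R)) - Ln (p - L R)) = 2 * pi * \<i>"
    using 1 int vp by (subst (asm) contour_integral_join)
      (auto simp: contour_integral_unique[OF 1] dest: has_contour_integral_integrable)
  \<comment> \<open>The ends lie above and below the axis. Exchanging the two branches costs \<i> pi
    at each end, and these shifts absorb exactly the 2 pi \<i> of the winding number.\<close>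
  moreover have "Ln (p - L R) = Ln (L R - p) - \<i> * pi" "Ln (p - L (-R)) = Ln (L (-R) - p) + \<i> * pi"
    using Ln_minus_if_Im[of "L R - p"] Ln_minus_if_Im[of "L (-R) - p"] T0(2)[of R] T0(3)[of "-R"] R ST p
    by auto
  ultimately have full: "contour_integral (subpath (-R) R L) (\<lambda>w. 1 / (w - p)) = Ln (L R - p) - Ln (L (-R) - p)"
    by (simp add: algebra_simps)
  have up: "((\<lambda>w. 1 / (w - p)) has_contour_integral (Ln (L R - p) - Ln (L T - p))) (subpath T R L)"
  proof -
    have "z - p \<notin> \<real>\<^sub>\<le>\<^sub>0" if zI: "z \<in> path_image (subpath T R L)" for z
    proof -
      obtain t where "T \<le> t" "z = L t"
        using zI R by (auto simp: path_image_subpath_gen closed_segment_eq_real_ivl)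
      then show ?thesis using T0(2)[of t] ST p by (auto simp: complex_nonpos_Reals_iff)
    qed
    from contour_integral_inverse_diff_Ln[OF vp this] show ?thesis by simp
  qed
  have dn: "((\<lambda>w. 1 / (w - p)) has_contour_integral (Ln (L (-S) - p) - Ln (L (-R) - p))) (subpath (-R) (-S) L)"
  proof -
    have "z - p \<notin> \<real>\<^sub>\<le>\<^sub>0" if zI: "z \<in> path_image (subpath (-R) (-S) L)" for z
    proof -
      obtain t where "t \<le> -S" "z = L t"
        using zI R by (auto simp: path_image_subpath_gen closed_segment_eq_real_ivl)
      then show ?thesis using T0(3)[of t] ST p by (auto simp: complex_nonpos_Reals_iff)
    qed
    from contour_integral_inverse_diff_Ln[OF vp this] show ?thesis by simp
  qed
  have "contour_integral (subpath (-R) (-S) L) (\<lambda>w. 1 / (w - p)) + contour_integral (subpath (-S) R L) (\<lambda>w. 1 / (w - p))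
      = contour_integral (subpath (-R) R L) (\<lambda>w. 1 / (w - p))"
    by (rule contour_integral_subpath_combine_real_line[OF C1]) (use R ST T0 int in auto)
  moreover have "contour_integral (subpath (-S) T L) (\<lambda>w. 1 / (w - p)) + contour_integral (subpath T R L) (\<lambda>w. 1 / (w - p))
      = contour_integral (subpath (-S) R L) (\<lambda>w. 1 / (w - p))"
    by (rule contour_integral_subpath_combine_real_line[OF C1]) (use R ST T0 int in auto)
  ultimately have "contour_integral (subpath (-S) T L) (\<lambda>w. 1 / (w - p)) = Ln (L T - p) - Ln (L (-S) - p)"
    using full contour_integral_unique[OF up] contour_integral_unique[OF dn] by algebra
  then show ?thesis using int[of "-S" T] by (metis has_contour_integral_integral)
qed

section \<open>The slit plane and the value of a loop integral\<close>

definition left_slit :: "real \<Rightarrow> complex set" where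
  "left_slit d = {z. Im z \<noteq> 0 \<or> Re z > - d}"

text \<open>Starlikeness about 0 is used twice: to close loops by two segments through 0, and to
  define primitives by integration along segments from 0.\<close>

lemma closed_segment_0_left_slit:
  assumes "d > 0" "z \<in> left_slit d"
  shows "closed_segment 0 z \<subseteq> left_slit d"
proof
  fix w assume "w \<in> closed_segment 0 z"
  then obtain r where r: "0 \<le> r" "r \<le> 1" "w = r *\<^sub>R z" by (auto simp: closed_segment_def)
  show "w \<in> left_slit d"
  proof (cases "Im z = 0 \<or> r = 0")
    case True
    have "r * Re z > - d" if "Re z > - d"
    proof (cases "Re z \<ge> 0")
      case True
      then have "r * Re z \<ge> 0" using r by simp
      then show ?thesis using assms by linarith
    next
      case False
      then have "r * Re z \<ge> 1 * Re z" using r by (intro mult_right_mono_neg) auto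
      then show ?thesis using that by simp
    qed
    then show ?thesis using True assms r by (auto simp: left_slit_def)
  next
    case False
    then show ?thesis using r by (auto simp: left_slit_def)
  qed
qed

lemma open_left_slit: "open (left_slit d)"
proof -
  have "left_slit d = - ({z. Im z = 0} \<inter> {z. Re z \<le> - d})"
    by (auto simp: left_slit_def)
  then show ?thesis
    by (auto simp: open_Compl closed_Int closed_halfspace_Re_le closed_halfspace_Im_eq intro!: open_Compl closed_Int)
qed

lemma left_loop_contour_integral:
  assumes L: "left_loop P L" and P: "closed P" "\<And>p. p \<in> P \<Longrightarrow> Im p = 0 \<and> Re p \<le> - d" and d: "d > 0"
    and f: "f holomorphic_on - P"
    and F: "\<And>s. s \<in> left_slit d \<Longrightarrow> (F has_field_derivative f s) (at s)"
    and T0: "T0 > 0" "\<And>t. t \<ge> T0 \<Longrightarrow> Im (L t) > 0" "\<And>t. t \<le> -T0 \<Longrightarrow> Im (L t) < 0"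
    and ST: "S \<ge> T0" "T \<ge> T0"
  shows "contour_integral (subpath (-S) T L) f = F (L T) - F (L (-S))"
proof -
  have C1: "\<And>u v. L piecewise_C1_differentiable_on {u..v}" and PL: "P \<inter> range L = {}"
    using L by (auto simp: left_loop_def)
  note vp = valid_path_subpath_real_line[OF C1]
  define a b where "a = L (-S)" and "b = L T"
  have ab: "Im a < 0" "Im b > 0" using T0 ST by (auto simp: a_def b_def)
  define l where "l = linepath b 0 +++ linepath 0 a"
  have l: "valid_path l" "path_image l = closed_segment b 0 \<union> closed_segment 0 a"
      "pathstart l = b" "pathfinish l = a"
    by (auto simp: l_def path_image_join)
  have lS: "path_image l \<subseteq> left_slit d"
    using closed_segment_0_left_slit[OF d, of a] closed_segment_0_left_slit[OF d, of b] ab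
    by (auto simp: l closed_segment_commute left_slit_def)
  have lP: "z \<notin> path_image l" if "z \<in> P" for z
    using lS P(2)[OF that] d by (auto simp: left_slit_def)
  have intl: "(f has_contour_integral (F a - F b)) l"
    using contour_integral_primitive[of "left_slit d" F f l] l lS F
    by (auto intro: has_field_derivative_at_within)
  define \<gamma> where "\<gamma> = subpath (-S) T L +++ l"
  have \<gamma>: "valid_path \<gamma>" "pathfinish \<gamma> = pathstart \<gamma>" "path_image \<gamma> \<subseteq> - P"
  proof -
    have "path_image (subpath (-S) T L) \<subseteq> - P"
      using PL by (auto simp: path_image_subpath_gen)
    moreover have "path_image l \<subseteq> - P" using lP by auto
    ultimately show "path_image \<gamma> \<subseteq> - P"
      unfolding \<gamma>_def by (meson path_image_join_subset Un_least subset_trans)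
  qed (use l vp in \<open>auto simp: \<gamma>_def a_def b_def intro!: valid_path_join\<close>)
  have wn: "winding_number \<gamma> p = 0" if "p \<notin> - P" for p
  proof -
    have p: "p \<in> P" "Im p = 0" "Re p \<le> -d" using that P(2) by auto
    have z: "z - p \<notin> \<real>\<^sub>\<le>\<^sub>0" if "z \<in> path_image l" for z
      using that lS p by (auto simp: left_slit_def complex_nonpos_Reals_iff)
    have "((\<lambda>w. 1 / (w - p)) has_contour_integral (Ln (a - p) - Ln (b - p))) l"
      using contour_integral_inverse_diff_Ln[OF l(1), of p] z l by auto
    \<comment> \<open>The loop has the same logarithmic increment as a path in the slit plane, so it
      cancels against that of \<open>l\<close>.\<close>
    moreover have "((\<lambda>w. 1 / (w - p)) has_contour_integral (Ln (b - p) - Ln (a - p))) (subpath (-S) T L)"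
      unfolding a_def b_def by (rule left_loop_integral_inverse_diff[OF L p(1,2) T0 ST])
    ultimately have "((\<lambda>w. 1 / (w - p)) has_contour_integral 0) \<gamma>"
      using has_contour_integral_join[OF _ _ vp l(1)] unfolding \<gamma>_def by fastforce
    then show ?thesis
      using winding_number_valid_path[OF \<gamma>(1), of p] \<gamma>(3) p
      by (auto simp: contour_integral_unique)
  qed
  have "(f has_contour_integral 0) \<gamma>"
    by (rule Cauchy_theorem_global[OF _ f \<gamma>(1,2,3) wn]) (use P in auto)
  moreover have "f contour_integrable_on subpath (-S) T L"
    by (rule contour_integrable_holomorphic_simple[OF f _ vp]) (use P PL in \<open>auto simp: path_image_subpath_gen\<close>)
  ultimately have "contour_integral (subpath (-S) T L) f + contour_integral l f = 0"
    unfolding \<gamma>_def using intl vp l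
    by (metis contour_integral_join contour_integral_unique has_contour_integral_integrable)
  then show ?thesis using contour_integral_unique[OF intl]
    by (simp add: a_def b_def algebra_simps)
qed

text \<open>The asymptotic heights of a loop are not prescribed, so the limits of \<open>F\<close>
  are required along every curve whose imaginary part tends to some nonzero value; only the sign of
  that value decides between \<open>I1\<close> and \<open>I2\<close>. This makes the integral the
  same for all loops.\<close>

lemma left_loop_has_loop_integral:
  assumes L: "left_loop P L" and P: "closed P" "\<And>p. p \<in> P \<Longrightarrow> Im p = 0 \<and> Re p \<le> - d" and d: "d > 0"
    and f: "f holomorphic_on - P"
    and F: "\<And>s. s \<in> left_slit d \<Longrightarrow> (F has_field_derivative f s) (at s)"
    and up: "\<And>s \<eta>. 0 < \<eta> \<Longrightarrow> filterlim (\<lambda>t. Re (s t)) at_bot at_top \<Longrightarrow> ((\<lambda>t. Im (s t)) \<longlongrightarrow> \<eta>) at_top \<Longrightarrow>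
       ((\<lambda>t::real. F (s t)) \<longlongrightarrow> I1) at_top"
    and dn: "\<And>s \<eta>. \<eta> < 0 \<Longrightarrow> filterlim (\<lambda>t. Re (s t)) at_bot at_top \<Longrightarrow> ((\<lambda>t. Im (s t)) \<longlongrightarrow> \<eta>) at_top \<Longrightarrow>
       ((\<lambda>t::real. F (s t)) \<longlongrightarrow> I2) at_top"
  shows "has_loop_integral f (I1 - I2) L"
proof -
  obtain \<eta> T0 where T0: "\<eta> > 0" "T0 > 0" "\<And>t. t \<ge> T0 \<Longrightarrow> Im (L t) > \<eta>" "\<And>t. t \<le> -T0 \<Longrightarrow> Im (L t) < -\<eta>"
    using left_loop_ends[OF L] by metis
  have 1: "((\<lambda>t. F (L t)) \<longlongrightarrow> I1) at_top"
    using L by (auto simp: left_loop_def intro: up)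
  have "((\<lambda>t. F (L (- t))) \<longlongrightarrow> I2) at_top"
    using L by (auto simp: left_loop_def at_bot_mirror filterlim_filtermap intro: dn)
  then have "((\<lambda>(S, T). F (L T) - F (L (- S))) \<longlongrightarrow> I1 - I2) (at_top \<times>\<^sub>F at_top)"
    unfolding case_prod_beta
    by (intro tendsto_diff filterlim_compose[OF 1 filterlim_snd] filterlim_compose[OF _ filterlim_fst])
  moreover have "\<forall>\<^sub>F (S, T) in at_top \<times>\<^sub>F at_top. S \<ge> T0 \<and> T \<ge> T0"
    unfolding eventually_prod_filter
    by (intro exI[of _ "\<lambda>t. t \<ge> T0"]) (auto intro: eventually_ge_at_top)
  then have "\<forall>\<^sub>F x in at_top \<times>\<^sub>F at_top. (case x of (S, T) \<Rightarrow> F (L T) - F (L (- S)))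
      = (case x of (S, T) \<Rightarrow> contour_integral (subpath (-S) T L) f)"
  proof (eventually_elim, clarsimp)
    fix S T assume "T0 \<le> S" "T0 \<le> T"
    then show "F (L T) - F (L (- S)) = contour_integral (subpath (-S) T L) f"
      by (intro left_loop_contour_integral[OF L P d f F T0(2), symmetric])
         (use T0 in \<open>force intro: less_trans dest: T0(3,4)\<close>)+
  qed
  ultimately show ?thesis
    unfolding has_loop_integral_def by (rule Lim_transform_eventually)
qed

text \<open>Without a loop the condition in \<open>fox_H\<close> would hold vacuously for every
  \<open>w\<close>, and the description would not be unique.\<close>

lemma left_loop_exists:
  assumes P: "\<And>p. p \<in> P \<Longrightarrow> Im p = 0 \<and> Re p \<le> - d" and d: "d > 0"
  shows "\<exists>L. left_loop P L"
proof -
  \<comment> \<open>This curve meets the real axis only at 0, to the right of \<open>P\<close>, and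
    its heights tend to -pi/2 and pi/2.\<close>
  define L where "L = (\<lambda>t::real. Complex (- (t ^ 2)) (arctan t))"
  have Leq: "L = (\<lambda>t. of_real (- (t ^ 2)) + \<i> * of_real (arctan t))"
    by (auto simp: L_def complex_eq_iff)
  have L0: "L t \<in> left_slit d" for t
    using d by (auto simp: L_def left_slit_def)
  have "(L has_vector_derivative (Complex (- (2 * t)) (1 / (1 + t^2)))) (at t)" for t
    unfolding Leq
    by (auto simp: has_vector_derivative_complex_iff inverse_eq_divide intro!: derivative_eq_intros)
  moreover have "1 + (complex_of_real x)\<^sup>2 \<noteq> 0" for x
  proof -
    have "1 + x\<^sup>2 \<noteq> 0" by (smt (verit) zero_le_power2)
    then have "complex_of_real (1 + x\<^sup>2) \<noteq> 0" by (subst of_real_eq_0_iff)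
    then show ?thesis by simp
  qed
  ultimately have "L C1_differentiable_on {u..v}" for u v
    unfolding C1_differentiable_on_def
    by (intro exI[of _ "\<lambda>t. Complex (- (2 * t)) (1 / (1 + t^2))"])
       (auto simp: Complex_eq intro!: continuous_intros)
  then have C1: "L piecewise_C1_differentiable_on {u..v}" for u v
    by (rule C1_differentiable_imp_piecewise)
  note vp = valid_path_subpath_real_line[OF C1]
  have wn: "winding_number (subpath (-T) T L +++ linepath (L T) (L (-T))) p = 1"
    if p: "p \<in> P" and T: "T > 0" "Re p > - (T ^ 2)" for p T
  proof -
    have p': "Im p = 0" "Re p \<le> -d" using P p by auto
    have 1: "((\<lambda>w. 1 / (w - p)) has_contour_integral (Ln (L T - p) - Ln (L (-T) - p))) (subpath (-T) T L)"
      using contour_integral_inverse_diff_Ln[OF vp, of "-T" T p] L0 p'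
      by (fastforce simp: complex_nonpos_Reals_iff path_image_subpath_gen left_slit_def)
    have seg: "Re z = - (T^2)" if zI: "z \<in> closed_segment (L T) (L (-T))" for z
    proof -
      obtain u where "z = (1 - u) *\<^sub>R L T + u *\<^sub>R L (-T)" using zI by (auto simp: closed_segment_def)
      then have "Re z = (1 - u) * - (T\<^sup>2) + u * - (T\<^sup>2)" by (simp add: L_def)
      then show ?thesis by (simp add: algebra_simps)
    qed
    have 2: "((\<lambda>w. 1 / (w - p)) has_contour_integral (Ln (p - L (-T)) - Ln (p - L T)))
      (linepath (L T) (L (-T)))"
      using contour_integral_inverse_diff_Ln_minus[of "linepath (L T) (L (-T))" p] seg T
      by (fastforce simp: complex_nonpos_Reals_iff)
    have "Ln (p - L T) = Ln (L T - p) - \<i> * pi" "Ln (p - L (-T)) = Ln (L (-T) - p) + \<i> * pi"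
      using Ln_minus_if_Im[of "L T - p"] Ln_minus_if_Im[of "L (-T) - p"] T p'
      by (auto simp: L_def)
    then have "(Ln (L T - p) - Ln (L (-T) - p)) + (Ln (p - L (-T)) - Ln (p - L T)) = 2 * pi * \<i>"
      by simp
    then have I: "((\<lambda>w. 1 / (w - p)) has_contour_integral (2 * pi * \<i>)) (subpath (-T) T L +++ linepath (L T) (L (-T)))"
      using has_contour_integral_join[OF 1 2 vp] by auto
    have "p \<notin> path_image (subpath (-T) T L +++ linepath (L T) (L (-T)))"
    proof -
      have "p \<notin> left_slit d" using p' by (simp add: left_slit_def)
      then have "p \<notin> range L" using L0 by blast
      then show ?thesis
        using seg[of p] T by (subst path_image_join) (auto simp: path_image_subpath_gen)
    qed
    then show ?thesis
      using winding_number_valid_path[of "subpath (-T) T L +++ linepath (L T) (L (-T))" p] vp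
      by (auto simp: contour_integral_unique[OF I])
  qed
  have sq: "filterlim (\<lambda>t::real. - (t^2)) at_bot at_top" by real_asymp
  have "filterlim (\<lambda>t. Re (L t)) at_bot at_bot" "filterlim (\<lambda>t. Re (L t)) at_bot at_top"
    using sq by (auto simp: L_def at_bot_mirror filterlim_filtermap)
  moreover have "((\<lambda>t. Im (L t)) \<longlongrightarrow> -(pi/2)) at_bot" "((\<lambda>t. Im (L t)) \<longlongrightarrow> pi/2) at_top"
    by (auto simp: L_def intro: tendsto_arctan_at_top tendsto_arctan_at_bot)
  moreover have "p \<notin> range L" if "p \<in> P" for p
  proof -
    have "p \<notin> left_slit d" using P[OF that] by (simp add: left_slit_def)
    then show ?thesis using L0 by blast
  qed
  moreover have "\<forall>\<^sub>F T in at_top. winding_number (subpath (-T) T L +++ linepath (L T) (L (-T))) p = 1"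
    if "p \<in> P" for p
  proof -
    have "\<forall>\<^sub>F T in at_top. - (T ^ 2) < Re p" using sq by (auto simp: filterlim_at_bot_dense)
    then show ?thesis using eventually_gt_at_top[of 0] by eventually_elim (use wn that in auto)
  qed
  ultimately show ?thesis
    unfolding left_loop_def using C1
    by (intro exI[of _ L] conjI allI ballI exI[of _ "-(pi/2)"] exI[of _ "pi/2"]) auto
qed

subsection \<open>The complex Beta integral\<close>

text \<open>Euler's integral after the substitution t = e^x. On the whole line a scaling of t is a
  translation of x, and the Beta integral becomes a matter of Fubini's theorem.\<close>

lemma has_bochner_integral_Gamma_exp:
  assumes "Re z > 0"
  shows "has_bochner_integral lborel (\<lambda>x. exp (z * of_real x - of_real (exp x))) (Gamma z)"
proof -
  let ?f = "\<lambda>t. complex_of_real t powr (z - 1) / of_real (exp t)"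
  have img: "exp ` UNIV = {0::real<..}"
    by (auto simp: image_iff) (metis exp_ln)
  have eq: "\<bar>exp x\<bar> *\<^sub>R ?f (exp x) = exp (z * of_real x - of_real (exp x))" for x :: real
  proof -
    have "complex_of_real (exp x) powr (z - 1) = exp ((z - 1) * of_real x)"
      by (simp add: powr_def flip: Ln_of_real exp_of_real)
    then show ?thesis
      by (simp add: scaleR_conv_of_real exp_of_real[symmetric] algebra_simps exp_diff exp_add)
  qed
  have "?f absolutely_integrable_on (exp ` UNIV) \<and> integral (exp ` UNIV) ?f = Gamma z"
    unfolding img using absolutely_integrable_Gamma_integral'[OF assms] Gamma_integral_complex'[OF assms]
    by (auto simp: integral_unique)
  then have "(\<lambda>x. \<bar>exp x\<bar> *\<^sub>R ?f (exp x)) absolutely_integrable_on UNIV \<and>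
      integral UNIV (\<lambda>x. \<bar>exp x\<bar> *\<^sub>R ?f (exp x)) = Gamma z"
    by (subst has_absolute_integral_change_of_variables_real) (auto intro!: derivative_eq_intros inj_onI)
  then have 1: "integrable lebesgue (\<lambda>x. exp (z * of_real x - of_real (exp x)))"
    and 2: "integral UNIV (\<lambda>x. exp (z * of_real x - of_real (exp x))) = Gamma z"
    unfolding eq by (auto simp: set_integrable_def)
  from 1 have 3: "integrable lborel (\<lambda>x. exp (z * of_real x - of_real (exp x)))"
    by (subst (asm) integrable_completion) auto
  with 2 show ?thesis by (simp add: has_bochner_integral_iff integral_lborel)
qed

lemma has_bochner_integral_Gamma_exp_scaled:
  assumes "Re z > 0" "c > 0"
  shows "has_bochner_integral lborel (\<lambda>x. exp (z * of_real x - of_real (c * exp x)))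
    (Gamma z * exp (- z * of_real (ln c)))"
proof -
  have "has_bochner_integral lborel (\<lambda>x. exp (z * of_real (ln c + 1 * x) - of_real (exp (ln c + 1 * x)))) (Gamma z /\<^sub>R \<bar>1\<bar>)"
    by (subst lborel_has_bochner_integral_real_affine_iff[symmetric])
       (use has_bochner_integral_Gamma_exp[OF assms(1)] in auto)
  then have "has_bochner_integral lborel (\<lambda>x. exp (- z * of_real (ln c)) * exp (z * of_real (ln c + x) - of_real (exp (ln c + x))))
      (exp (- z * of_real (ln c)) * Gamma z)"
    by (intro has_bochner_integral_mult_right) auto
  moreover have "exp (- z * of_real (ln c)) * exp (z * of_real (ln c + x) - of_real (exp (ln c + x)))
      = exp (z * of_real x - of_real (c * exp x))" for x
  proof -
    have "exp (ln c + x) = c * exp x" using assms by (simp add: exp_add)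
    then show ?thesis by (simp add: exp_add[symmetric] algebra_simps)
  qed
  ultimately show ?thesis by (simp add: mult.commute)
qed

text \<open>The real form evaluates integrals of norms, which is what Fubini's theorem asks
  for.\<close>

lemma has_bochner_integral_Gamma_exp_scaled_real:
  assumes "a > 0" "c > (0::real)"
  shows "has_bochner_integral lborel (\<lambda>x. exp (a * x - c * exp x)) (Gamma a * exp (- a * ln c))"
proof -
  have "has_bochner_integral lborel (\<lambda>x. complex_of_real (exp (a * x - c * exp x)))
      (complex_of_real (Gamma a * exp (- a * ln c)))"
    using has_bochner_integral_Gamma_exp_scaled[of "of_real a" c] assms
    by (simp add: exp_of_real[symmetric] Gamma_complex_of_real)
  from has_bochner_integral_Re[OF this] show ?thesis by simp
qed

text \<open>Both sides are evaluations, in the two orders, of the integral of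
  \<open>exp (p x + (p + q) y - e\<^sup>y (1 + e\<^sup>x))\<close> over the plane.\<close>

lemma has_bochner_integral_Beta_exp:
  assumes p: "Re p > 0" and q: "Re q > 0"
  shows "has_bochner_integral lborel (\<lambda>x. exp (p * of_real x - (p + q) * of_real (ln (1 + exp x))))
    (Gamma p * Gamma q / Gamma (p + q))"
proof -
  define h where "h = (\<lambda>y x. exp (p * of_real x + (p + q) * of_real y - of_real (exp y * (1 + exp x))))"
  have [measurable]: "case_prod h \<in> borel_measurable (lborel \<Otimes>\<^sub>M lborel)"
  proof -
    have "continuous_on UNIV (case_prod h)"
      by (auto simp: h_def case_prod_beta intro!: continuous_intros)
    then have "case_prod h \<in> borel_measurable borel" by (rule borel_measurable_continuous_onI)
    then show ?thesis by (simp add: lborel_prod)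
  qed
  have hx: "h y x = exp ((p + q) * of_real y - of_real (exp y)) * exp (p * of_real x - of_real (exp y * exp x))" for x y
    by (simp add: h_def exp_add[symmetric] algebra_simps)
  have hy: "h y x = exp (p * of_real x) * exp ((p + q) * of_real y - of_real ((1 + exp x) * exp y))" for x y
    by (simp add: h_def exp_add[symmetric] algebra_simps)
  have intx: "has_bochner_integral lborel (h y) (Gamma p * exp (q * of_real y - of_real (exp y)))" for y
  proof -
    have "has_bochner_integral lborel (h y) (exp ((p + q) * of_real y - of_real (exp y)) * (Gamma p * exp (- p * of_real (ln (exp y)))))"
      unfolding hx by (intro has_bochner_integral_mult_right has_bochner_integral_Gamma_exp_scaled) (use p in auto)
    moreover have "exp ((p + q) * of_real y - of_real (exp y)) * (Gamma p * exp (- p * of_real (ln (exp y))))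
        = Gamma p * exp (q * of_real y - of_real (exp y))"
    proof -
      have "exp ((p + q) * of_real y - of_real (exp y)) * exp (- p * of_real y) = exp (q * of_real y - of_real (exp y))"
        by (simp add: exp_add[symmetric] algebra_simps)
      then show ?thesis by simp
    qed
    ultimately show ?thesis by (simp only:)
  qed
  have inty: "has_bochner_integral lborel (\<lambda>y. h y x)
      (Gamma (p + q) * exp (p * of_real x - (p + q) * of_real (ln (1 + exp x))))" for x
  proof -
    have "has_bochner_integral lborel (\<lambda>y. h y x)
       (exp (p * of_real x) * (Gamma (p + q) * exp (- (p + q) * of_real (ln (1 + exp x)))))"
      unfolding hy by (intro has_bochner_integral_mult_right has_bochner_integral_Gamma_exp_scaled)
         (use p q in \<open>auto intro: add_pos_pos\<close>)
    then show ?thesis by (simp add: exp_diff exp_minus exp_add field_simps)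
  qed
  have nrm: "has_bochner_integral lborel (\<lambda>x. norm (h y x)) (Gamma (Re p) * exp (Re q * y - exp y))" for y
  proof -
    have "norm (h y x) = exp ((Re p + Re q) * y - exp y) * exp (Re p * x - exp y * exp x)" for x
      unfolding hx by (simp add: norm_mult)
    moreover have "has_bochner_integral lborel (\<lambda>x. exp ((Re p + Re q) * y - exp y) * exp (Re p * x - exp y * exp x))
       (exp ((Re p + Re q) * y - exp y) * (Gamma (Re p) * exp (- Re p * ln (exp y))))"
      by (intro has_bochner_integral_mult_right has_bochner_integral_Gamma_exp_scaled_real) (use p in auto)
    moreover have "exp ((Re p + Re q) * y - exp y) * (Gamma (Re p) * exp (- Re p * ln (exp y)))
      = Gamma (Re p) * exp (Re q * y - exp y)"
      by (simp add: exp_diff exp_minus exp_add algebra_simps)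
    ultimately show ?thesis by (simp only:)
  qed
  have int: "integrable (lborel \<Otimes>\<^sub>M lborel) (case_prod h)"
  proof (rule lborel_pair.Fubini_integrable)
    have "integrable lborel (\<lambda>y. Gamma (Re p) * exp (Re q * y - 1 * exp y))"
      using has_bochner_integral_Gamma_exp_scaled_real[of "Re q" 1] q
      by (intro integrable_mult_right) (auto simp: has_bochner_integral_iff)
    then show "integrable lborel (\<lambda>y. \<integral>x. norm (case_prod h (y, x)) \<partial>lborel)"
      using nrm by (simp add: has_bochner_integral_iff)
    show "AE y in lborel. integrable lborel (\<lambda>x. case_prod h (y, x))"
      using intx by (simp add: has_bochner_integral_iff)
  qed simp
  have "(\<integral>x. (\<integral>y. h y x \<partial>lborel) \<partial>lborel) = (\<integral>y. (\<integral>x. h y x \<partial>lborel) \<partial>lborel)"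
    by (rule lborel_pair.Fubini_integral[OF int])
  also have "\<dots> = Gamma p * Gamma q"
    using intx has_bochner_integral_Gamma_exp[OF q] by (simp add: has_bochner_integral_iff)
  finally have "(\<integral>x. Gamma (p + q) * exp (p * of_real x - (p + q) * of_real (ln (1 + exp x))) \<partial>lborel) = Gamma p * Gamma q"
    using inty by (simp add: has_bochner_integral_iff)
  moreover have "integrable lborel (\<lambda>x. Gamma (p + q) * exp (p * of_real x - (p + q) * of_real (ln (1 + exp x))))"
    using lborel_pair.integrable_snd[OF int] inty by (simp add: has_bochner_integral_iff)
  ultimately have "has_bochner_integral lborel (\<lambda>x. inverse (Gamma (p + q)) *
      (Gamma (p + q) * exp (p * of_real x - (p + q) * of_real (ln (1 + exp x)))))
      (inverse (Gamma (p + q)) * (Gamma p * Gamma q))"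
    by (intro has_bochner_integral_mult_right) (simp add: has_bochner_integral_iff)
  moreover have "Gamma (p + q) \<noteq> 0"
  proof -
    have "p + q \<notin> \<int>\<^sub>\<le>\<^sub>0"
    proof
      assume "p + q \<in> \<int>\<^sub>\<le>\<^sub>0"
      then obtain n where "p + q = - of_nat n" by (auto elim!: nonpos_Ints_cases')
      then have "Re (p + q) = - real n" by simp
      then show False using p q by simp
    qed
    then show ?thesis by (simp add: Gamma_eq_zero_iff)
  qed
  ultimately show ?thesis by (simp add: field_simps)
qed

subsection \<open>The Mellin transform in the left half-plane\<close>

text \<open>In a domain starlike about 0 a triangle with vertex 0 lies inside as soon as the
  opposite side does, so Cauchy's theorem for triangles suffices.\<close>

lemma left_slit_primitive:
  assumes d: "d > 0" and g: "g holomorphic_on left_slit d" and s: "s \<in> left_slit d"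
  shows "((\<lambda>s. contour_integral (linepath 0 s) g) has_field_derivative g s) (at s)"
proof (rule triangle_contour_integrals_starlike_primitive[OF _ _ open_left_slit s])
  show "continuous_on (left_slit d) g" using g by (rule holomorphic_on_imp_continuous_on)
  show "0 \<in> left_slit d" using d by (simp add: left_slit_def)
  show "closed_segment 0 y \<subseteq> left_slit d" if "y \<in> left_slit d" for y
    by (rule closed_segment_0_left_slit[OF d that])
  fix b c assume bc: "closed_segment b c \<subseteq> left_slit d"
  then have "convex hull {0, b, c} \<subseteq> left_slit d"
    by (intro starlike_convex_subset) (use d closed_segment_0_left_slit in \<open>auto simp: left_slit_def\<close>)
  then have "(g has_contour_integral 0) (linepath 0 b +++ linepath b c +++ linepath c 0)"
    by (intro Cauchy_theorem_triangle) (use g in \<open>auto intro: holomorphic_on_subset\<close>)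
  then show "contour_integral (linepath 0 b) g + contour_integral (linepath b c) g + contour_integral (linepath c 0) g = 0"
    by (rule has_chain_integral_chain_integral3)
qed

lemma contour_integral_linepath_0_cnj:
  assumes "\<And>s. g (cnj s) = cnj (g s)"
  shows "contour_integral (linepath 0 (cnj s)) g = cnj (contour_integral (linepath 0 s) g)"
proof -
  have "cnj \<circ> linepath 0 s = linepath 0 (cnj s)" by (auto simp: linepath_def fun_eq_iff)
  moreover have "cnj \<circ> g \<circ> cnj = g" using assms by (auto simp: fun_eq_iff)
  ultimately show ?thesis using contour_integral_cnj[of "linepath 0 s" g] by simp
qed

section \<open>Limits of primitives of exponentially decaying functions\<close>

lemma exp_decay_primitive_horizontal:
  fixes F g :: "complex \<Rightarrow> complex"
  assumes F: "\<And>s. Re s \<le> -R \<Longrightarrow> Im s = y \<Longrightarrow> (F has_field_derivative g s) (at s)"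
    and g: "\<And>s. Re s \<le> -R \<Longrightarrow> Im s = y \<Longrightarrow> norm (g s) \<le> K * exp (\<delta> * Re s)"
    and \<delta>: "\<delta> > 0" and R: "R \<le> R'"
  shows "norm (F (Complex (-R') y) - F (Complex (-R) y)) \<le> K / \<delta> * exp (- \<delta> * R)"
proof -
  have K: "K \<ge> 0"
  proof -
    have "0 \<le> K * exp (\<delta> * Re (Complex (-R) y))"
      using g[of "Complex (-R) y"] norm_ge_zero[of "g (Complex (-R) y)"] by (simp del: norm_ge_zero)
    then show ?thesis by (simp add: zero_le_mult_iff)
  qed
  show ?thesis
  proof (cases "R = R'")
    case True
    then show ?thesis using K \<delta> by simp
  next
    case False
    have d: "((\<lambda>r. F (Complex (-r) y)) has_vector_derivative (- g (Complex (-r) y))) (at r within A)" if "r \<ge> R" for r A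
    proof -
      have "((\<lambda>r. of_real (-r) + \<i> * of_real y) has_vector_derivative -1) (at r within A)"
        by (auto intro!: derivative_eq_intros)
      then have "((\<lambda>r. Complex (-r) y) has_vector_derivative -1) (at r within A)"
        by (simp add: Complex_eq)
      moreover have "(F has_field_derivative g (Complex (-r) y)) (at (Complex (-r) y) within (\<lambda>r. Complex (-r) y) ` A)"
        using F[of "Complex (-r) y"] that by (auto intro: has_field_derivative_at_within)
      ultimately show ?thesis
        using field_vector_diff_chain_within[of "\<lambda>r. Complex (-r) y" "-1" r A F] by (simp add: o_def)
    qed
    have "norm (F (Complex (-R') y) - F (Complex (-R) y)) \<le> - (K / \<delta> * exp (- \<delta> * R')) - - (K / \<delta> * exp (- \<delta> * R))"
    proof (rule differentiable_bound_general[where f' = "\<lambda>r. - g (Complex (-r) y)" and \<phi>' = "\<lambda>r. K * exp (- \<delta> * r)"])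
      show "R < R'" using R False by simp
      show "continuous_on {R..R'} (\<lambda>r. F (Complex (-r) y))"
        by (rule continuous_on_vector_derivative[of _ _ "\<lambda>r. - g (Complex (-r) y)"]) (use d in auto)
      show "continuous_on {R..R'} (\<lambda>r. - (K / \<delta> * exp (- \<delta> * r)))" by (intro continuous_intros)
      show "((\<lambda>r. - (K / \<delta> * exp (- \<delta> * r))) has_vector_derivative K * exp (- \<delta> * r)) (at r)" for r
        using \<delta> by (auto intro!: derivative_eq_intros simp flip: has_real_derivative_iff_has_vector_derivative)
      show "norm (- g (Complex (-r) y)) \<le> K * exp (- \<delta> * r)" if "R < r" for r
        using g[of "Complex (-r) y"] R that by simp
    qed (use d R in auto)
    also have "\<dots> \<le> K / \<delta> * exp (- \<delta> * R)" using K \<delta> by simp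
    finally show ?thesis .
  qed
qed

text \<open>On the ray at height 1 the values of \<open>F\<close> form a Cauchy sequence. Moving
  vertically from \<open>s\<close> to height 1 costs the length |Im s - 1| times an integrand that
  still decays, so the limit is the same at every positive height. With \<eta> \<le> 1 the vertical
  segment stays above \<eta>, where the bound with \<open>K \<eta>\<close> is valid.\<close>

lemma exp_decay_primitive_limit:
  fixes F g :: "complex \<Rightarrow> complex"
  assumes F: "\<And>s. Im s > 0 \<Longrightarrow> (F has_field_derivative g s) (at s)"
    and g: "\<And>s \<eta>. 0 < \<eta> \<Longrightarrow> Re s \<le> -1 \<Longrightarrow> Im s \<ge> \<eta> \<Longrightarrow> norm (g s) \<le> K \<eta> * exp (\<delta> * Re s)"
    and \<delta>: "\<delta> > 0"
  obtains I where "(\<lambda>n. F (Complex (- real (Suc n)) 1)) \<longlonglongrightarrow> I"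
    "\<And>s \<eta>. 0 < \<eta> \<Longrightarrow> \<eta> \<le> 1 \<Longrightarrow> Re s \<le> -1 \<Longrightarrow> Im s \<ge> \<eta> \<Longrightarrow>
      norm (F s - I) \<le> K \<eta> * (1 / \<delta> + \<bar>Im s - 1\<bar>) * exp (\<delta> * Re s)"
proof -
  let ?X = "\<lambda>n. F (Complex (- real (Suc n)) 1)"
  have hor: "norm (F (Complex (-R') 1) - F (Complex (-R) 1)) \<le> K \<eta> / \<delta> * exp (- \<delta> * R)"
    if "0 < \<eta>" "\<eta> \<le> 1" "1 \<le> R" "R \<le> R'" for R R' \<eta>
    by (rule exp_decay_primitive_horizontal[where g = g]) (use that F g \<delta> in auto)
  have lim0: "(\<lambda>n. K 1 / \<delta> * exp (- \<delta> * real (Suc n))) \<longlonglongrightarrow> 0"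
    using \<delta> by real_asymp
  have "Cauchy ?X"
  proof (rule CauchyI')
    fix e :: real assume "e > 0"
    then obtain N where N: "\<And>n. n \<ge> N \<Longrightarrow> K 1 / \<delta> * exp (- \<delta> * real (Suc n)) < e"
      using order_tendstoD(2)[OF lim0] by (auto simp: eventually_sequentially)
    show "\<exists>M. \<forall>m\<ge>M. \<forall>n>m. dist (?X m) (?X n) < e"
    proof (intro exI[of _ N] allI impI)
      fix m n assume mn: "N \<le> m" "m < n"
      have "dist (?X m) (?X n) = norm (?X n - ?X m)" by (simp add: dist_norm norm_minus_commute)
      also have "\<dots> \<le> K 1 / \<delta> * exp (- \<delta> * real (Suc m))"
        using hor[of 1 "real (Suc m)" "real (Suc n)"] mn by simp
      finally show "dist (?X m) (?X n) < e" using N[OF mn(1)] by simp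
    qed
  qed
  then obtain I where I: "?X \<longlonglongrightarrow> I" by (auto simp: Cauchy_convergent_iff convergent_def)
  show ?thesis
  proof (rule that[OF I])
    fix s \<eta> assume s: "0 < \<eta>" "\<eta> \<le> 1" "Re s \<le> -1" "Im s \<ge> \<eta>"
    let ?s1 = "Complex (Re s) 1"
    have "norm (I - F ?s1) \<le> K \<eta> / \<delta> * exp (\<delta> * Re s)"
    proof (rule tendsto_upperbound)
      show "(\<lambda>n. norm (?X n - F ?s1)) \<longlonglongrightarrow> norm (I - F ?s1)" by (intro tendsto_intros I)
      show "\<forall>\<^sub>F n in sequentially. norm (?X n - F ?s1) \<le> K \<eta> / \<delta> * exp (\<delta> * Re s)"
      proof -
        obtain N :: nat where "real N \<ge> - Re s" using real_arch_simple by blast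
        then show ?thesis
          using hor[of \<eta> "- Re s" "real (Suc n)" for n] s
          by (auto simp: eventually_sequentially simp del: of_nat_Suc intro!: exI[of _ N])
      qed
    qed simp
    moreover have "norm (F s - F ?s1) \<le> K \<eta> * exp (\<delta> * Re s) * norm (s - ?s1)"
    proof (rule field_differentiable_bound[of "closed_segment ?s1 s" F g])
      fix z assume "z \<in> closed_segment ?s1 s"
      moreover have "closed_segment ?s1 s \<subseteq> {z. Re z = Re s} \<inter> {z. Im z \<ge> \<eta>}"
      proof (rule closed_segment_subset)
        have "{z. Re z = Re s} = {z. Re z \<le> Re s} \<inter> {z. Re z \<ge> Re s}" by auto
        then show "convex ({z. Re z = Re s} \<inter> {z. Im z \<ge> \<eta>})"
          by (auto intro!: convex_Int convex_halfspace_Re_le convex_halfspace_Re_ge convex_halfspace_Im_ge)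
      qed (use s in auto)
      ultimately have z: "Re z = Re s" "Im z \<ge> \<eta>" by auto
      show "(F has_field_derivative g z) (at z within closed_segment ?s1 s)"
        by (rule has_field_derivative_at_within[OF F]) (use s z in auto)
      show "norm (g z) \<le> K \<eta> * exp (\<delta> * Re s)" using g[of \<eta> z] s z by auto
    qed auto
    moreover have "norm (s - ?s1) = \<bar>Im s - 1\<bar>" by (simp add: cmod_def)
    moreover have "norm (F s - I) \<le> norm (F s - F ?s1) + norm (I - F ?s1)"
      using norm_triangle_ineq4[of "F s - F ?s1" "I - F ?s1"] by simp
    ultimately show "norm (F s - I) \<le> K \<eta> * (1 / \<delta> + \<bar>Im s - 1\<bar>) * exp (\<delta> * Re s)"
      by (simp add: algebra_simps)
  qed
qed

section \<open>Exponential bound for the Mellin transform in the left half-plane\<close>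

lemma norm_sin_le_exp: "norm (sin z) \<le> exp \<bar>Im z\<bar>" for z :: complex
proof -
  have "norm (sin z) = norm (exp (\<i> * z) - exp (- (\<i> * z))) / 2"
    by (simp add: sin_exp_eq norm_divide norm_mult)
  also have "\<dots> \<le> (exp (- Im z) + exp (Im z)) / 2"
    using norm_triangle_ineq4[of "exp (\<i> * z)" "exp (- (\<i> * z))"] by simp
  also have "\<dots> \<le> (exp \<bar>Im z\<bar> + exp \<bar>Im z\<bar>) / 2"
    by (intro divide_right_mono add_mono) auto
  finally show ?thesis by simp
qed

lemma norm_sin_ge_exp: "exp \<bar>Im z\<bar> * (1 - exp (- 2 * \<bar>Im z\<bar>)) / 2 \<le> norm (sin z)" for z :: complex
proof -
  have "norm (sin z) = norm (exp (\<i> * z) - exp (- (\<i> * z))) / 2"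
    by (simp add: sin_exp_eq norm_divide norm_mult)
  moreover have "norm (exp (\<i> * z) - exp (- (\<i> * z))) \<ge> \<bar>exp (- Im z) - exp (Im z)\<bar>"
    using norm_triangle_ineq3[of "exp (\<i> * z)" "exp (- (\<i> * z))"] by simp
  moreover have "\<bar>exp (- Im z) - exp (Im z)\<bar> \<ge> exp \<bar>Im z\<bar> - exp (- \<bar>Im z\<bar>)"
    by (cases "Im z \<ge> 0") auto
  moreover have "exp \<bar>Im z\<bar> * (1 - exp (- 2 * \<bar>Im z\<bar>)) = exp \<bar>Im z\<bar> - exp (- \<bar>Im z\<bar>)"
    by (simp add: right_diff_distrib exp_add[symmetric])
  ultimately show ?thesis by simp
qed

text \<open>|sin z| is of size exp |Im z|. The rates \<alpha> and 1 - \<alpha> of the numerator add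
  up to the rate 1 of the denominator, so at distance at least \<eta> from the real axis the
  quotient is bounded.\<close>

lemma norm_sin_sin_div_sin_le:
  fixes t :: complex
  assumes \<alpha>: "0 < \<alpha>" "\<alpha> < 1" and t: "0 < \<eta>" "\<eta> \<le> \<bar>Im t\<bar>"
  shows "norm (sin (of_real pi * (of_real \<alpha> * t)) * sin (of_real pi * (of_real (1 - \<alpha>) * t)) / sin (of_real pi * t))
    \<le> 2 / (1 - exp (- 2 * pi * \<eta>))"
proof -
  define y where "y = pi * \<bar>Im t\<bar>"
  have y: "y \<ge> pi * \<eta>" "pi * \<eta> > 0" using t by (auto simp: y_def)
  have "\<bar>Im (of_real pi * (of_real \<alpha> * t))\<bar> = \<alpha> * y" "\<bar>Im (of_real pi * (of_real (1 - \<alpha>) * t))\<bar> = (1 - \<alpha>) * y"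
     "\<bar>Im (of_real pi * t)\<bar> = y"
    using \<alpha> by (auto simp: y_def abs_mult)
  then have 1: "norm (sin (of_real pi * (of_real \<alpha> * t))) \<le> exp (\<alpha> * y)"
    and 2: "norm (sin (of_real pi * (of_real (1 - \<alpha>) * t))) \<le> exp ((1 - \<alpha>) * y)"
    and 3: "exp y * (1 - exp (- 2 * y)) / 2 \<le> norm (sin (of_real pi * t))"
    using norm_sin_le_exp norm_sin_ge_exp by metis+
  have e: "exp (- 2 * pi * \<eta>) < 1" "exp (- 2 * y) \<le> exp (- 2 * pi * \<eta>)" using y by auto
  have 4: "exp y * (1 - exp (- 2 * pi * \<eta>)) / 2 \<le> norm (sin (of_real pi * t))"
    using 3 e(2) by (smt (verit) divide_right_mono exp_gt_zero mult_left_mono)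
  have "norm (sin (of_real pi * (of_real \<alpha> * t)) * sin (of_real pi * (of_real (1 - \<alpha>) * t)))
      \<le> exp (\<alpha> * y) * exp ((1 - \<alpha>) * y)"
    unfolding norm_mult by (intro mult_mono 1 2) auto
  also have "\<dots> = exp y" by (simp add: exp_add[symmetric] algebra_simps)
  finally have "norm (sin (of_real pi * (of_real \<alpha> * t)) * sin (of_real pi * (of_real (1 - \<alpha>) * t)) / sin (of_real pi * t))
     \<le> exp y / (exp y * (1 - exp (- 2 * pi * \<eta>)) / 2)"
    unfolding norm_divide using 4 e by (intro frac_le) auto
  also have "\<dots> = 2 / (1 - exp (- 2 * pi * \<eta>))" by simp
  finally show ?thesis .
qed

text \<open>Minus the entropy of the two-point distribution with weights \<alpha> and 1 -
  \<alpha>.\<close>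

definition ln_b0 :: "real \<Rightarrow> real" where
  "ln_b0 \<alpha> = \<alpha> * ln \<alpha> + (1 - \<alpha>) * ln (1 - \<alpha>)"

text \<open>With X = e^x / (1 + e^x) the left side is \<alpha> ln X + (1 - \<alpha>) ln (1 - X), and
  the claim is Gibbs' inequality for (\<alpha>, 1 - \<alpha>) against (X, 1 - X). It follows from ln
  r \<le> r - 1 at r = X / \<alpha> and r = (1 - X) / (1 - \<alpha>).\<close>

lemma linear_minus_softplus_le:
  assumes \<alpha>: "0 < \<alpha>" "\<alpha> < 1"
  shows "\<alpha> * x - ln (1 + exp x) \<le> ln_b0 \<alpha>"
proof -
  define X where "X = exp x / (1 + exp x)"
  have X: "0 < X" "0 < 1 - X" "1 - X = 1 / (1 + exp x)"
  proof -
    have "1 + exp x \<noteq> 0" using exp_gt_zero[of x] by linarith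
    then show "1 - X = 1 / (1 + exp x)" by (simp add: X_def field_simps)
    then show "0 < 1 - X" by (simp add: add_pos_pos)
    show "0 < X" by (simp add: X_def add_pos_pos)
  qed
  have l: "ln X = x - ln (1 + exp x)" "ln (1 - X) = - ln (1 + exp x)"
    unfolding X(3) unfolding X_def using add_pos_pos[OF zero_less_one exp_gt_zero, of x]
    by (simp_all add: ln_div)
  have "ln (X / \<alpha>) \<le> X / \<alpha> - 1" "ln ((1 - X) / (1 - \<alpha>)) \<le> (1 - X) / (1 - \<alpha>) - 1"
    using X(1,2) \<alpha> by (intro ln_le_minus_one; simp)+
  then have "\<alpha> * (ln X - ln \<alpha>) \<le> \<alpha> * (X / \<alpha> - 1)"
      "(1 - \<alpha>) * (ln (1 - X) - ln (1 - \<alpha>)) \<le> (1 - \<alpha>) * ((1 - X) / (1 - \<alpha>) - 1)"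
    using X(1,2) \<alpha> by (auto intro!: mult_left_mono simp: ln_div)
  moreover have "\<alpha> * (X / \<alpha> - 1) + (1 - \<alpha>) * ((1 - X) / (1 - \<alpha>) - 1) = 0"
    using \<alpha> by (simp add: field_simps)
  ultimately show ?thesis by (simp add: l ln_b0_def algebra_simps)
qed

text \<open>Adding 1 to both parameters writes the Beta integrand as that of B(1, 1) = 1 times
  (X^\<alpha> (1 - X)^(1 - \<alpha>))^t. The second factor has norm at most exp
  (\<open>ln_b0 \<alpha>\<close> Re t), and the integral converges even for Re t = 0.\<close>

lemma norm_Beta_le:
  assumes \<alpha>: "0 < \<alpha>" "\<alpha> < 1" and t: "Re t \<ge> 0"
  defines "p \<equiv> 1 + of_real \<alpha> * t" and "q \<equiv> 1 + of_real (1 - \<alpha>) * t"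
  shows "norm (Gamma p * Gamma q / Gamma (p + q)) \<le> exp (ln_b0 \<alpha> * Re t)"
proof -
  have pq: "Re p > 0" "Re q > 0" "Re p = 1 + \<alpha> * Re t" "Re q = 1 + (1 - \<alpha>) * Re t"
    using \<alpha> t by (auto simp: p_def q_def intro!: add_pos_nonneg)
  define f where "f = (\<lambda>x. exp (p * of_real x - (p + q) * of_real (ln (1 + exp x))))"
  have f: "has_bochner_integral lborel f (Gamma p * Gamma q / Gamma (p + q))"
    unfolding f_def by (rule has_bochner_integral_Beta_exp[OF pq(1,2)])
  have "has_bochner_integral lborel (\<lambda>x. complex_of_real (exp (x - 2 * ln (1 + exp x)))) 1"
    using has_bochner_integral_Beta_exp[of 1 1] by (simp add: exp_of_real[symmetric] Gamma_numeral)
  from has_bochner_integral_Re[OF this]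
  have g: "has_bochner_integral lborel (\<lambda>x::real. exp (x - 2 * ln (1 + exp x))) 1" by simp
  have fg: "norm (f x) \<le> exp (ln_b0 \<alpha> * Re t) * exp (x - 2 * ln (1 + exp x))" for x
  proof -
    have "Re p * x - (Re p + Re q) * ln (1 + exp x) = (x - 2 * ln (1 + exp x)) + Re t * (\<alpha> * x - ln (1 + exp x))"
      unfolding pq(3,4) by (simp add: algebra_simps)
    also have "\<dots> \<le> (x - 2 * ln (1 + exp x)) + Re t * ln_b0 \<alpha>"
      using linear_minus_softplus_le[OF \<alpha>] t by (intro add_left_mono mult_left_mono) auto
    finally show ?thesis by (simp add: f_def exp_add[symmetric] algebra_simps)
  qed
  have "norm (\<integral>x. f x \<partial>lborel) \<le> (\<integral>x. exp (ln_b0 \<alpha> * Re t) * exp (x - 2 * ln (1 + exp x)) \<partial>lborel)"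
    by (rule Bochner_Integration.integral_norm_bound_integral) (use f g fg in \<open>auto simp: has_bochner_integral_iff\<close>)
  then show ?thesis using f g by (simp add: has_bochner_integral_iff)
qed

text \<open>\<open>rGamma\<close> is entire, so the poles of \<open>Gamma (1 + s)\<close> are the
  only possible singularities. Its zeros agree with the convention x / 0 = 0 in
  \<open>fox_integrand\<close>.\<close>

definition kanter_mellin :: "real \<Rightarrow> complex \<Rightarrow> complex" where
  "kanter_mellin \<alpha> s = Gamma (1 + s) * rGamma (1 + of_real \<alpha> * s) * rGamma (1 + of_real (1 - \<alpha>) * s)"

lemma holomorphic_kanter_mellin:
  "(\<And>s. s \<in> A \<Longrightarrow> 1 + s \<notin> \<int>\<^sub>\<le>\<^sub>0) \<Longrightarrow> kanter_mellin \<alpha> holomorphic_on A"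
  unfolding kanter_mellin_def by (intro holomorphic_intros) auto

lemma holomorphic_kanter_mellin_left_slit: "kanter_mellin \<alpha> holomorphic_on left_slit 1"
proof (rule holomorphic_kanter_mellin)
  fix s assume "s \<in> left_slit 1"
  then show "1 + s \<notin> \<int>\<^sub>\<le>\<^sub>0"
    by (auto simp: left_slit_def complex_eq_iff elim!: nonpos_Ints_cases)
qed

lemma kanter_mellin_cnj: "kanter_mellin \<alpha> (cnj s) = cnj (kanter_mellin \<alpha> s)"
  by (simp add: kanter_mellin_def cnj_Gamma cnj_rGamma)

text \<open>The last factor bounds the quotient of sines; the first one bounds the rational factor
  left over when the Gamma functions are combined into a Beta function.\<close>

definition kanter_mellin_bound :: "real \<Rightarrow> real \<Rightarrow> real" where
  "kanter_mellin_bound \<alpha> \<eta> = 2 / (\<alpha> * (1 - \<alpha>)) * (2 / (1 - exp (- 2 * pi * \<eta>)))"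

text \<open>With t = -s, a = \<alpha> t and b = (1 - \<alpha>) t, the reflection formula turns f(s)
  into a quotient of sines times Gamma(a) Gamma(b) / (pi Gamma(t)), with arguments in the right
  half-plane. Raising a and b by 1 produces the Beta function already bounded and, up to a constant,
  the factor (t + 1) / t, which is at most 2 in norm because |s| \<ge> 1.\<close>

lemma norm_kanter_mellin_le:
  assumes \<alpha>: "0 < \<alpha>" "\<alpha> < 1" and \<eta>: "0 < \<eta>" "\<eta> \<le> \<bar>Im s\<bar>" and s: "Re s \<le> 0" "norm s \<ge> 1"
  shows "norm (kanter_mellin \<alpha> s) \<le> kanter_mellin_bound \<alpha> \<eta> * exp (- ln_b0 \<alpha> * Re s)"
proof -
  define t where "t = - s"
  define a b where "a = of_real \<alpha> * t" and "b = of_real (1 - \<alpha>) * t"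
  have t: "Re t \<ge> 0" "norm t \<ge> 1" "\<eta> \<le> \<bar>Im t\<bar>" "t \<noteq> 0" "Im t \<noteq> 0" using s \<eta> by (auto simp: t_def)
  have ab: "a + b = t" "a \<noteq> 0" "b \<noteq> 0" "Im a \<noteq> 0" "Im b \<noteq> 0"
    using t \<alpha> by (auto simp: a_def b_def algebra_simps)
  have nI: "z \<notin> \<int>\<^sub>\<le>\<^sub>0" if "Im z \<noteq> 0" for z using that by (auto elim!: nonpos_Ints_cases)
  have sin0: "sin (of_real pi * t) \<noteq> 0"
  proof
    assume "sin (of_real pi * t) = 0"
    then obtain n where "of_real pi * t = of_real (real_of_int n * pi)"
      unfolding Complex_Transcendental.sin_eq_0 by auto
    then have "Im (of_real pi * t) = 0" by (metis Im_complex_of_real)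
    then show False using t by simp
  qed
  have r: "rGamma (1 - z) = sin (of_real pi * z) / of_real pi * Gamma z" if "Im z \<noteq> 0" for z :: complex
  proof -
    have "rGamma z * Gamma z = 1" using nI[OF that] by (simp add: rGamma_inverse_Gamma Gamma_eq_zero_iff)
    then have "rGamma (1 - z) = (rGamma z * rGamma (1 - z)) * Gamma z" by (simp add: mult_ac)
    then show ?thesis by (simp add: rGamma_reflection_complex)
  qed
  have "Gamma (1 - t) = of_real pi / (sin (of_real pi * t) * Gamma t)"
  proof -
    have "Gamma (1 - t) = Gamma t * Gamma (1 - t) / Gamma t" using nI[OF t(5)] by (simp add: Gamma_eq_zero_iff)
    then show ?thesis by (simp add: Gamma_reflection_complex mult.commute)
  qed
  moreover have "kanter_mellin \<alpha> s = Gamma (1 - t) * rGamma (1 - a) * rGamma (1 - b)"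
    by (simp add: kanter_mellin_def t_def a_def b_def)
  ultimately have k: "kanter_mellin \<alpha> s = of_real pi / (sin (of_real pi * t) * Gamma t)
      * (sin (of_real pi * a) / of_real pi * Gamma a) * (sin (of_real pi * b) / of_real pi * Gamma b)"
    using r ab by simp
  have G: "Gamma (1 + a) = a * Gamma a" "Gamma (1 + b) = b * Gamma b"
    using Gamma_plus1[OF nI[OF ab(4)]] Gamma_plus1[OF nI[OF ab(5)]] by (simp_all add: add.commute)
  have "Gamma ((1 + a) + (1 + b)) = Gamma ((t + 1) + 1)" by (simp add: ab(1)[symmetric] algebra_simps)
  also have "\<dots> = (t + 1) * Gamma (t + 1)" by (rule Gamma_plus1[OF nI]) (use t in simp)
  also have "Gamma (t + 1) = t * Gamma t" by (rule Gamma_plus1[OF nI]) (use t in simp)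
  finally have G2: "Gamma ((1 + a) + (1 + b)) = (t + 1) * (t * Gamma t)" .
  have t1: "t + 1 \<noteq> 0" using t by (auto simp: complex_eq_iff)
  have "kanter_mellin \<alpha> s = (sin (of_real pi * a) * sin (of_real pi * b) / sin (of_real pi * t))
      * ((t + 1) / t / of_real (\<alpha> * (1 - \<alpha>) * pi)) * (Gamma (1 + a) * Gamma (1 + b) / Gamma ((1 + a) + (1 + b)))"
    unfolding k G G2 using t1 t sin0 \<alpha> nI[OF t(5)]
    by (simp add: divide_simps Gamma_eq_zero_iff) (simp add: a_def b_def algebra_simps)
  also have "norm \<dots> \<le> 2 / (1 - exp (- 2 * pi * \<eta>)) * (2 / (\<alpha> * (1 - \<alpha>))) * exp (ln_b0 \<alpha> * Re t)"
    unfolding norm_mult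
  proof (intro mult_mono)
    show "norm (sin (of_real pi * a) * sin (of_real pi * b) / sin (of_real pi * t)) \<le> 2 / (1 - exp (- 2 * pi * \<eta>))"
      unfolding a_def b_def by (rule norm_sin_sin_div_sin_le) (use \<alpha> \<eta> t in auto)
    show "norm (Gamma (1 + a) * Gamma (1 + b) / Gamma ((1 + a) + (1 + b))) \<le> exp (ln_b0 \<alpha> * Re t)"
      unfolding a_def b_def by (rule norm_Beta_le[OF \<alpha> t(1)])
    have "norm (t + 1) \<le> 2 * norm t" using norm_triangle_ineq[of t 1] t by simp
    then have 1: "norm ((t + 1) / t) \<le> 2" using t by (simp add: norm_divide field_simps)
    have pi1: "\<alpha> * (1 - \<alpha>) \<le> \<alpha> * (1 - \<alpha>) * pi" using \<alpha> pi_ge_two by (simp add: mult_le_cancel_left1 not_less)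
    have "norm ((t + 1) / t / of_real (\<alpha> * (1 - \<alpha>) * pi)) = norm ((t + 1) / t) / (\<alpha> * (1 - \<alpha>) * pi)"
      using \<alpha> by (subst norm_divide, subst norm_of_real) (simp add: abs_mult)
    also have "\<dots> \<le> 2 / (\<alpha> * (1 - \<alpha>))"
      using 1 \<alpha> pi1 by (intro frac_le) auto
    finally show "norm ((t + 1) / t / of_real (\<alpha> * (1 - \<alpha>) * pi)) \<le> 2 / (\<alpha> * (1 - \<alpha>))" .
  qed (use \<eta> \<alpha> in auto)
  finally show ?thesis by (simp add: kanter_mellin_bound_def t_def mult_ac)
qed

subsection \<open>The Fox function as a limit of primitives\<close>

definition kanter_primitive :: "real \<Rightarrow> real \<Rightarrow> complex \<Rightarrow> complex" where
  "kanter_primitive \<alpha> x s = contour_integral (linepath 0 s) (\<lambda>s. kanter_mellin \<alpha> s * exp (of_real x * s))"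

definition kanter_limit :: "real \<Rightarrow> real \<Rightarrow> complex" where
  "kanter_limit \<alpha> x = lim (\<lambda>n. kanter_primitive \<alpha> x (Complex (- real (Suc n)) 1))"

text \<open>By reflection in the real axis the limit below the slit is the conjugate of the limit
  above it. The loop integral is thus 2 \<i> Im (\<open>kanter_limit \<alpha> x\<close>), and
  division by 2 pi \<i> leaves this real number.\<close>

definition kanter_dens :: "real \<Rightarrow> real \<Rightarrow> real" where
  "kanter_dens \<alpha> x = Im (kanter_limit \<alpha> x) / pi"

lemma kanter_primitive_derivative:
  assumes "s \<in> left_slit 1"
  shows "(kanter_primitive \<alpha> x has_field_derivative kanter_mellin \<alpha> s * exp (of_real x * s)) (at s)"
  unfolding kanter_primitive_def[abs_def]
  by (rule left_slit_primitive[OF _ _ assms])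
     (auto intro!: holomorphic_intros holomorphic_kanter_mellin_left_slit)

lemma kanter_primitive_cnj: "kanter_primitive \<alpha> x (cnj s) = cnj (kanter_primitive \<alpha> x s)"
  unfolding kanter_primitive_def
  by (rule contour_integral_linepath_0_cnj) (simp add: kanter_mellin_cnj exp_cnj)

text \<open>The factor exp (x s) shifts the exponential rate of f to x -
  \<open>ln_b0 \<alpha>\<close>. For x > \<open>ln_b0 \<alpha>\<close> this is decay as Re s tends
  to -infinity.\<close>

lemma norm_kanter_mellin_exp_le:
  assumes \<alpha>: "0 < \<alpha>" "\<alpha> < 1" and \<eta>: "0 < \<eta>" "\<eta> \<le> \<bar>Im s\<bar>" and s: "Re s \<le> 0" "norm s \<ge> 1"
  shows "norm (kanter_mellin \<alpha> s * exp (of_real x * s)) \<le> kanter_mellin_bound \<alpha> \<eta> * exp ((x - ln_b0 \<alpha>) * Re s)"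
proof -
  have "norm (kanter_mellin \<alpha> s) * exp (x * Re s)
      \<le> kanter_mellin_bound \<alpha> \<eta> * exp (- ln_b0 \<alpha> * Re s) * exp (x * Re s)"
    by (intro mult_right_mono norm_kanter_mellin_le assms) auto
  then show ?thesis by (simp add: norm_mult exp_add[symmetric] algebra_simps)
qed

lemma kanter_primitive_limit:
  assumes \<alpha>: "0 < \<alpha>" "\<alpha> < 1" and x: "ln_b0 \<alpha> < x"
    and s: "0 < \<eta>" "\<eta> \<le> 1" "Re s \<le> -1" "Im s \<ge> \<eta>"
  shows "norm (kanter_primitive \<alpha> x s - kanter_limit \<alpha> x)
    \<le> kanter_mellin_bound \<alpha> \<eta> * (1 / (x - ln_b0 \<alpha>) + \<bar>Im s - 1\<bar>) * exp ((x - ln_b0 \<alpha>) * Re s)"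
proof -
  obtain I where I: "(\<lambda>n. kanter_primitive \<alpha> x (Complex (- real (Suc n)) 1)) \<longlonglongrightarrow> I"
    "\<And>s \<eta>. 0 < \<eta> \<Longrightarrow> \<eta> \<le> 1 \<Longrightarrow> Re s \<le> -1 \<Longrightarrow> Im s \<ge> \<eta> \<Longrightarrow>
      norm (kanter_primitive \<alpha> x s - I)
        \<le> kanter_mellin_bound \<alpha> \<eta> * (1 / (x - ln_b0 \<alpha>) + \<bar>Im s - 1\<bar>) * exp ((x - ln_b0 \<alpha>) * Re s)"
  proof (rule exp_decay_primitive_limit[where F = "kanter_primitive \<alpha> x" and \<delta> = "x - ln_b0 \<alpha>" and K = "kanter_mellin_bound \<alpha>"])
    show "(kanter_primitive \<alpha> x has_field_derivative kanter_mellin \<alpha> s * exp (of_real x * s)) (at s)"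
      if "0 < Im s" for s
      by (rule kanter_primitive_derivative) (use that in \<open>simp add: left_slit_def\<close>)
    show "norm (kanter_mellin \<alpha> s * exp (of_real x * s)) \<le> kanter_mellin_bound \<alpha> \<eta> * exp ((x - ln_b0 \<alpha>) * Re s)"
      if "0 < \<eta>" "Re s \<le> -1" "\<eta> \<le> Im s" for s \<eta>
      using that abs_Re_le_cmod[of s] by (intro norm_kanter_mellin_exp_le \<alpha>) auto
  qed (use x in auto)
  have "kanter_limit \<alpha> x = I" unfolding kanter_limit_def by (rule limI[OF I(1)])
  then show ?thesis using I(2)[OF s] by simp
qed

lemma tendsto_kanter_primitive:
  assumes \<alpha>: "0 < \<alpha>" "\<alpha> < 1" and x: "ln_b0 \<alpha> < x"
    and \<eta>: "0 < \<eta>" and s: "filterlim (\<lambda>t. Re (s t)) at_bot F" "((\<lambda>t. Im (s t)) \<longlongrightarrow> \<eta>) F"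
  shows "((\<lambda>t. kanter_primitive \<alpha> x (s t)) \<longlongrightarrow> kanter_limit \<alpha> x) F"
proof -
  \<comment> \<open>Half the limiting height is eventually a lower bound for the height; the cap 1
    is the one in \<open>kanter_primitive_limit\<close>.\<close>
  define \<eta>' where "\<eta>' = min 1 (\<eta> / 2)"
  have \<eta>': "0 < \<eta>'" "\<eta>' \<le> 1" "\<eta>' < \<eta>" using \<eta> by (auto simp: \<eta>'_def)
  have "((\<lambda>t. kanter_primitive \<alpha> x (s t) - kanter_limit \<alpha> x) \<longlongrightarrow> 0) F"
  proof (rule Lim_null_comparison)
    have "\<forall>\<^sub>F t in F. Re (s t) \<le> -1" using s(1) by (auto simp: filterlim_at_bot)
    moreover have "\<forall>\<^sub>F t in F. \<eta>' < Im (s t)" using order_tendstoD(1)[OF s(2) \<eta>'(3)] .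
    ultimately show "\<forall>\<^sub>F t in F. norm (kanter_primitive \<alpha> x (s t) - kanter_limit \<alpha> x)
        \<le> kanter_mellin_bound \<alpha> \<eta>' * (1 / (x - ln_b0 \<alpha>) + \<bar>Im (s t) - 1\<bar>) * exp ((x - ln_b0 \<alpha>) * Re (s t))"
      by eventually_elim (intro kanter_primitive_limit \<alpha> x \<eta>'(1,2), auto)
    have "filterlim (\<lambda>t. (x - ln_b0 \<alpha>) * Re (s t)) at_bot F"
      using s(1) x by (intro filterlim_tendsto_pos_mult_at_bot[OF tendsto_const]) auto
    then have "((\<lambda>t. exp ((x - ln_b0 \<alpha>) * Re (s t))) \<longlongrightarrow> 0) F"
      by (rule filterlim_compose[OF exp_at_bot])
    then have "((\<lambda>t. kanter_mellin_bound \<alpha> \<eta>' * (1 / (x - ln_b0 \<alpha>) + \<bar>Im (s t) - 1\<bar>) * exp ((x - ln_b0 \<alpha>) * Re (s t)))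
       \<longlongrightarrow> kanter_mellin_bound \<alpha> \<eta>' * (1 / (x - ln_b0 \<alpha>) + \<bar>\<eta> - 1\<bar>) * 0) F"
      by (intro tendsto_intros s(2))
    then show "((\<lambda>t. kanter_mellin_bound \<alpha> \<eta>' * (1 / (x - ln_b0 \<alpha>) + \<bar>Im (s t) - 1\<bar>) * exp ((x - ln_b0 \<alpha>) * Re (s t)))
       \<longlongrightarrow> 0) F" by simp
  qed
  then show ?thesis by (simp add: Lim_null[symmetric])
qed

lemma tendsto_kanter_primitive_lower:
  assumes \<alpha>: "0 < \<alpha>" "\<alpha> < 1" and x: "ln_b0 \<alpha> < x"
    and \<eta>: "\<eta> < 0" and s: "filterlim (\<lambda>t. Re (s t)) at_bot F" "((\<lambda>t. Im (s t)) \<longlongrightarrow> \<eta>) F"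
  shows "((\<lambda>t. kanter_primitive \<alpha> x (s t)) \<longlongrightarrow> cnj (kanter_limit \<alpha> x)) F"
proof -
  have "((\<lambda>t. kanter_primitive \<alpha> x (cnj (s t))) \<longlongrightarrow> kanter_limit \<alpha> x) F"
    by (rule tendsto_kanter_primitive[OF \<alpha> x, of "- \<eta>"]) (use \<eta> s in \<open>auto intro: tendsto_minus\<close>)
  then have "((\<lambda>t. cnj (kanter_primitive \<alpha> x (cnj (s t)))) \<longlongrightarrow> cnj (kanter_limit \<alpha> x)) F"
    by (rule tendsto_cnj)
  then show ?thesis by (simp add: kanter_primitive_cnj)
qed

section \<open>Poles of the numerator and the value of the Fox function\<close>

lemma is_pole_Gamma_affine_iff:
  fixes p :: complex
  assumes "\<kappa> > 0"
  shows "is_pole (\<lambda>s. Gamma (of_real 1 + of_real \<kappa> * s)) p \<longleftrightarrow> 1 + of_real \<kappa> * p \<in> \<int>\<^sub>\<le>\<^sub>0"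
proof
  assume pole: "is_pole (\<lambda>s. Gamma (of_real 1 + of_real \<kappa> * s)) p"
  show "1 + of_real \<kappa> * p \<in> \<int>\<^sub>\<le>\<^sub>0"
  proof (rule ccontr)
    assume "1 + of_real \<kappa> * p \<notin> \<int>\<^sub>\<le>\<^sub>0"
    then have "(\<lambda>s. Gamma (of_real 1 + of_real \<kappa> * s)) analytic_on {p}"
      by (intro analytic_intros) auto
    with pole analytic_at_imp_no_pole show False by blast
  qed
next
  assume "1 + of_real \<kappa> * p \<in> \<int>\<^sub>\<le>\<^sub>0"
  then obtain n where n: "1 + of_real \<kappa> * p = - of_nat n" by (auto elim!: nonpos_Ints_cases')
  show "is_pole (\<lambda>s. Gamma (of_real 1 + of_real \<kappa> * s)) p"
  proof (rule is_pole_compose[OF is_pole_Gamma[of n]])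
    have "((\<lambda>s. of_real 1 + of_real \<kappa> * s) \<longlongrightarrow> of_real 1 + of_real \<kappa> * p) (at p)"
      by (intro tendsto_intros)
    then show "((\<lambda>s. of_real 1 + of_real \<kappa> * s) \<longlongrightarrow> - of_nat n) (at p)" using n by simp
    show "\<forall>\<^sub>F z in at p. of_real 1 + of_real \<kappa> * z \<noteq> - of_nat n"
      unfolding n[symmetric] eventually_at using assms by (intro exI[of _ 1]) auto
  qed
qed

lemma closed_vimage_nonpos_Ints: "closed {p. 1 + of_real \<kappa> * p \<in> (\<int>\<^sub>\<le>\<^sub>0 :: complex set)}"
proof -
  have "closed ((\<lambda>p::complex. 1 + of_real \<kappa> * p) -` \<int>\<^sub>\<le>\<^sub>0)"
    by (rule closed_vimage) (auto intro!: continuous_intros)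
  then show ?thesis by (simp add: vimage_def)
qed

lemma fox_integrand_eq_kanter_mellin:
  "fox_integrand 1 (\<kappa> * \<alpha>) 1 (\<kappa> * (1 - \<alpha>)) 1 \<kappa> z s =
    kanter_mellin \<alpha> (of_real \<kappa> * s) * exp (of_real (- ln z) * s)"
  by (simp add: fox_integrand_def kanter_mellin_def rGamma_inverse_Gamma divide_inverse mult_ac)

text \<open>The two Fox functions of the theorem are \<kappa> = 1 / (1 - \<alpha>) and \<kappa> = 2;
  the factor 1 / \<kappa> comes from substituting \<kappa> s for s. For B = \<kappa>, A1 = \<kappa>
  \<alpha>, A2 = \<kappa> (1 - \<alpha>) the constant B^B A1^(-A1) A2^(-A2) equals exp (- \<kappa>
  \<open>ln_b0 \<alpha>\<close>), so for z > 0 the last hypothesis says that z lies below this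
  constant.\<close>

lemma fox_H_eq_kanter_dens:
  assumes \<alpha>: "0 < \<alpha>" "\<alpha> < 1" and \<kappa>: "\<kappa> > 0" and x: "ln_b0 \<alpha> < - ln z / \<kappa>"
  shows "fox_H 1 (\<kappa> * \<alpha>) 1 (\<kappa> * (1 - \<alpha>)) 1 \<kappa> z = of_real (kanter_dens \<alpha> (- ln z / \<kappa>) / \<kappa>)"
proof -
  define x where "x = - ln z / \<kappa>"
  have x': "ln_b0 \<alpha> < x" using x by (simp add: x_def)
  define P :: "complex set" where "P = {p. is_pole (\<lambda>s. Gamma (of_real 1 + of_real \<kappa> * s)) p}"
  have P: "P = {p. 1 + of_real \<kappa> * p \<in> \<int>\<^sub>\<le>\<^sub>0}"
    unfolding P_def is_pole_Gamma_affine_iff[OF \<kappa>] ..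
  have Pim: "Im p = 0 \<and> Re p \<le> - (1 / \<kappa>)" if "p \<in> P" for p
  proof -
    obtain n where "1 + of_real \<kappa> * p = - of_nat n" using \<open>p \<in> P\<close> by (auto simp: P elim!: nonpos_Ints_cases')
    then have "Im (1 + of_real \<kappa> * p) = 0" "Re (1 + of_real \<kappa> * p) = - real n" by simp_all
    then have "\<kappa> * Im p = 0" "1 + \<kappa> * Re p \<le> 0" by simp_all
    then show ?thesis using \<kappa> by (auto simp: field_simps)
  qed
  let ?f = "fox_integrand 1 (\<kappa> * \<alpha>) 1 (\<kappa> * (1 - \<alpha>)) 1 \<kappa> z"
  let ?F = "\<lambda>s. kanter_primitive \<alpha> x (of_real \<kappa> * s) / of_real \<kappa>"
  let ?I = "kanter_limit \<alpha> x / of_real \<kappa>" and ?I' = "cnj (kanter_limit \<alpha> x) / of_real \<kappa>"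
  have f: "?f s = kanter_mellin \<alpha> (of_real \<kappa> * s) * exp (of_real x * (of_real \<kappa> * s))" for s
    unfolding fox_integrand_eq_kanter_mellin using \<kappa> by (simp add: x_def)
  have holf: "?f holomorphic_on - P"
  proof -
    have "(kanter_mellin \<alpha> \<circ> (\<lambda>s. of_real \<kappa> * s)) holomorphic_on - P"
      by (intro holomorphic_on_compose holomorphic_kanter_mellin holomorphic_intros) (auto simp: P)
    then show ?thesis unfolding f[abs_def] o_def by (intro holomorphic_intros)
  qed
  have loop: "has_loop_integral ?f (?I - ?I') L" if L: "left_loop P L" for L
  proof (rule left_loop_has_loop_integral[OF L _ Pim _ holf, where F = ?F])
    show "closed P" unfolding P by (rule closed_vimage_nonpos_Ints)
    show "1 / \<kappa> > 0" using \<kappa> by simp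
    fix s assume "s \<in> left_slit (1 / \<kappa>)"
    then have s: "of_real \<kappa> * s \<in> left_slit 1" using \<kappa> by (auto simp: left_slit_def field_simps)
    have "((\<lambda>s. of_real \<kappa> * s) has_field_derivative of_real \<kappa>) (at s)"
      by (auto intro!: derivative_eq_intros)
    from DERIV_chain'[where g = "kanter_primitive \<alpha> x", OF this kanter_primitive_derivative[OF s]]
    have "((\<lambda>s. kanter_primitive \<alpha> x (of_real \<kappa> * s)) has_field_derivative
       of_real \<kappa> * ?f s) (at s)" unfolding f by (auto intro!: derivative_eq_intros simp: mult_ac)
    then have "(?F has_field_derivative of_real \<kappa> * ?f s / of_real \<kappa>) (at s)"
      by (rule DERIV_cdivide)
    then show "(?F has_field_derivative ?f s) (at s)" using \<kappa> by simp
  next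
    fix s :: "real \<Rightarrow> complex" and \<eta> :: real
    assume s: "filterlim (\<lambda>t. Re (s t)) at_bot at_top" "((\<lambda>t. Im (s t)) \<longlongrightarrow> \<eta>) at_top"
    have s': "filterlim (\<lambda>t. Re (of_real \<kappa> * s t)) at_bot at_top" "((\<lambda>t. Im (of_real \<kappa> * s t)) \<longlongrightarrow> \<kappa> * \<eta>) at_top"
      using s \<kappa> by (auto intro!: tendsto_intros filterlim_tendsto_pos_mult_at_bot[OF tendsto_const])
    show "((\<lambda>t. ?F (s t)) \<longlongrightarrow> ?I) at_top" if "0 < \<eta>"
      by (intro tendsto_divide tendsto_const tendsto_kanter_primitive[OF \<alpha> x' _ s']) (use \<kappa> that in auto)
    show "((\<lambda>t. ?F (s t)) \<longlongrightarrow> ?I') at_top" if "\<eta> < 0"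
      by (intro tendsto_divide tendsto_const tendsto_kanter_primitive_lower[OF \<alpha> x' _ s'])
         (use \<kappa> that in \<open>auto simp: mult_pos_neg\<close>)
  qed
  have eq: "?I - ?I' = 2 * of_real pi * \<i> * of_real (kanter_dens \<alpha> x / \<kappa>)"
    by (simp add: kanter_dens_def complex_eq_iff)
  have "fox_H 1 (\<kappa> * \<alpha>) 1 (\<kappa> * (1 - \<alpha>)) 1 \<kappa> z = of_real (kanter_dens \<alpha> x / \<kappa>)"
    unfolding fox_H_def P_def[symmetric]
  proof (rule the_equality)
    show "\<forall>L. left_loop P L \<longrightarrow> has_loop_integral ?f (2 * of_real pi * \<i> * of_real (kanter_dens \<alpha> x / \<kappa>)) L"
      using loop unfolding eq by blast
    fix w assume w: "\<forall>L. left_loop P L \<longrightarrow> has_loop_integral ?f (2 * of_real pi * \<i> * w) L"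
    obtain L where L: "left_loop P L" using left_loop_exists[of P "1 / \<kappa>"] Pim \<kappa> by auto
    have "2 * of_real pi * \<i> * w = 2 * of_real pi * \<i> * of_real (kanter_dens \<alpha> x / \<kappa>)"
      using w loop[OF L] L unfolding eq has_loop_integral_def
      by (intro tendsto_unique[of "at_top \<times>\<^sub>F at_top"]) (auto simp: prod_filter_eq_bot)
    then show "w = of_real (kanter_dens \<alpha> x / \<kappa>)"
      by (subst (asm) mult_left_cancel) auto
  qed
  then show ?thesis by (simp add: x_def)
qed

subsection \<open>The Beta form in a logarithmic variable\<close>

text \<open>exp z is real and at least 1 only on the half-lines Im z = 2 pi k, Re z \<ge> 0. In this
  strip only k = 0 occurs, and removing that half-line keeps 1 - exp z off the cut of
  \<open>Ln\<close>.\<close>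

definition log_strip :: "complex set" where
  "log_strip = {z. \<bar>Im z\<bar> < 2 * pi \<and> (Im z \<noteq> 0 \<or> Re z < 0)}"

lemma open_log_strip: "open log_strip"
proof -
  have eq: "log_strip = {z. Im z < 2 * pi} \<inter> {z. Im z > - (2 * pi)} \<inter> ({z. Im z < 0} \<union> {z. Im z > 0} \<union> {z. Re z < 0})"
    by (auto simp: log_strip_def)
  show ?thesis
    unfolding eq
    by (intro open_Int open_Un open_halfspace_Im_lt open_halfspace_Im_gt open_halfspace_Re_lt)
qed

text \<open>The centre is -1: a segment from there to a point off the real axis meets the axis only
  at -1, and a segment to a negative real point stays among the negative reals.\<close>

lemma starlike_log_strip: "starlike log_strip"
  unfolding starlike_def
proof (intro bexI[of _ "-1"] ballI subsetI)
  fix z w :: complex assume z: "z \<in> log_strip" and "w \<in> closed_segment (-1) z"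
  then obtain r where r: "0 \<le> r" "r \<le> 1" "w = (1 - r) *\<^sub>R (-1) + r *\<^sub>R z" by (auto simp: closed_segment_def)
  have w: "Im w = r * Im z" "Re w = r * Re z - (1 - r)" by (simp_all add: r(3))
  have "\<bar>r * Im z\<bar> \<le> 1 * \<bar>Im z\<bar>" unfolding abs_mult using r by (intro mult_right_mono) auto
  moreover have "r * Re z - (1 - r) < 0" if "Re z < 0"
  proof (cases "r = 0")
    case False
    then have "r * Re z < 0" using r that by (simp add: mult_pos_neg)
    then show ?thesis using r by linarith
  qed simp
  moreover have "r * Re z - (1 - r) < 0" if "r = 0" using that by simp
  ultimately show "w \<in> log_strip" using z r unfolding log_strip_def by (auto simp: w)
qed (auto simp: log_strip_def)

lemma one_minus_exp_log_strip:
  assumes "z \<in> log_strip"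
  shows "1 - exp z \<notin> \<real>\<^sub>\<le>\<^sub>0"
proof
  assume "1 - exp z \<in> \<real>\<^sub>\<le>\<^sub>0"
  then have 1: "exp (Re z) * cos (Im z) \<ge> 1" "exp (Re z) * sin (Im z) = 0"
    by (auto simp: complex_nonpos_Reals_iff Re_exp Im_exp)
  then have s: "sin (Im z) = 0" by simp
  have c: "cos (Im z) > 0"
    using 1(1) by (smt (verit) exp_gt_zero mult_nonneg_nonpos)
  obtain n :: int where n: "Im z = n * pi" using s by (auto simp: sin_zero_iff_int2)
  have "\<bar>real_of_int n\<bar> * pi < 2 * pi" using assms n by (auto simp: log_strip_def abs_mult)
  then have "\<bar>real_of_int n\<bar> < 2" by simp
  then have "n = 0 \<or> n = 1 \<or> n = -1" by linarith
  then have "Im z = 0" using n c by auto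
  then have "exp (Re z) < 1" using assms by (auto simp: log_strip_def)
  then show False using 1(1) \<open>Im z = 0\<close> by simp
qed

text \<open>With \<open>X = e\<^sup>z\<close>, \<open>p = \<alpha> t\<close> and \<open>q = (1 - \<alpha>) t\<close> the form \<open>beta_form p q z dz\<close> is
  \<open>X\<^sup>p\<^sup>-\<^sup>1 (1 - X)\<^sup>q\<^sup>-\<^sup>1 dX\<close>.  In the logarithmic variable the negative half-line of \<open>X\<close>, seen
  from above and from below, becomes the lines \<open>Im z = \<plusminus>\<pi>\<close> inside the domain.\<close>

definition beta_form :: "complex \<Rightarrow> complex \<Rightarrow> complex \<Rightarrow> complex" where
  "beta_form p q z = exp (p * z + (q - 1) * Ln (1 - exp z))"

lemma beta_form_primitive:
  obtains K where "\<And>z. z \<in> log_strip \<Longrightarrow> (K has_field_derivative beta_form p q z) (at z)"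
proof -
  have hol: "beta_form p q holomorphic_on log_strip"
    unfolding beta_form_def[abs_def] using one_minus_exp_log_strip by (intro holomorphic_intros) auto
  have "\<exists>K. \<forall>z\<in>log_strip. (K has_field_derivative beta_form p q z) (at z)"
  proof (rule holomorphic_starlike_primitive[OF _ starlike_log_strip open_log_strip finite.emptyI])
    show "continuous_on log_strip (beta_form p q)" using hol by (rule holomorphic_on_imp_continuous_on)
    show "beta_form p q field_differentiable at x" if "x \<in> log_strip - {}" for x
      using hol open_log_strip that by (auto intro: holomorphic_on_imp_differentiable_at)
  qed
  then show ?thesis using that by blast
qed

text \<open>The arguments of exp z and 1 - exp z are at most pi in modulus, so the imaginary parts
  of p and q contribute only a constant factor.\<close>

lemma norm_beta_form_le:
  assumes "\<bar>Im z\<bar> \<le> pi" "z \<in> log_strip"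
  shows "norm (beta_form p q z) \<le> exp (pi * (\<bar>Im p\<bar> + \<bar>Im q\<bar>)) * exp (Re p * Re z + (Re q - 1) * ln (norm (1 - exp z)))"
proof -
  define L where "L = Ln (1 - exp z)"
  have nz: "1 - exp z \<noteq> 0" using one_minus_exp_log_strip[OF assms(2)] by auto
  have L: "Re L = ln (norm (1 - exp z))" "\<bar>Im L\<bar> \<le> pi"
    using nz mpi_less_Im_Ln[OF nz] Im_Ln_le_pi[OF nz] by (auto simp: L_def)
  have "\<bar>Im p * Im z\<bar> \<le> \<bar>Im p\<bar> * pi" "\<bar>Im q * Im L\<bar> \<le> \<bar>Im q\<bar> * pi"
    unfolding abs_mult using assms L by (auto intro: mult_left_mono)
  then have "Re (p * z + (q - 1) * L) \<le> pi * (\<bar>Im p\<bar> + \<bar>Im q\<bar>) + (Re p * Re z + (Re q - 1) * Re L)"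
    by (simp add: algebra_simps)
  then show ?thesis by (simp add: beta_form_def L_def[symmetric] L(1) exp_add[symmetric])
qed

section \<open>Decay of the Beta form on vertical segments\<close>

lemma norm_diff_le_on_vertical:
  fixes K g :: "complex \<Rightarrow> complex"
  assumes "\<And>w. Re w = Re a \<Longrightarrow> w \<in> closed_segment a b \<Longrightarrow> (K has_field_derivative g w) (at w) \<and> norm (g w) \<le> B"
    and "Re a = Re b"
  shows "norm (K b - K a) \<le> B * \<bar>Im b - Im a\<bar>"
proof -
  have re: "Re w = Re a" if "w \<in> closed_segment a b" for w
  proof -
    obtain u where "w = (1 - u) *\<^sub>R a + u *\<^sub>R b" using \<open>w \<in> _\<close> by (auto simp: closed_segment_def)
    then have "Re w = (1 - u) * Re a + u * Re a" using assms(2) by simp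
    then show ?thesis by (simp add: algebra_simps)
  qed
  have "norm (K b - K a) \<le> B * norm (b - a)"
  proof (rule field_differentiable_bound[of "closed_segment a b" K g])
    fix w assume w: "w \<in> closed_segment a b"
    show "(K has_field_derivative g w) (at w within closed_segment a b)" "norm (g w) \<le> B"
      using assms(1)[OF re[OF w] w] has_field_derivative_at_within by blast+
  qed auto
  also have "norm (b - a) = \<bar>Im b - Im a\<bar>" using assms(2) by (simp add: cmod_def)
  finally show ?thesis .
qed

lemma Im_closed_segment_bounds:
  assumes "w \<in> closed_segment a b"
  shows "min (Im a) (Im b) \<le> Im w" "Im w \<le> max (Im a) (Im b)"
proof -
  have "closed_segment a b \<subseteq> {w. min (Im a) (Im b) \<le> Im w} \<inter> {w. Im w \<le> max (Im a) (Im b)}"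
    by (intro closed_segment_subset convex_Int) (auto simp: convex_halfspace_Im_ge convex_halfspace_Im_le)
  then show "min (Im a) (Im b) \<le> Im w" "Im w \<le> max (Im a) (Im b)" using assms by auto
qed

text \<open>Here |1 - exp w| is at least e^x / 2, and the form is bounded by a multiple of e^((Re p
  + Re q - 1) x), which decays when Re (p + q) < 1. Equal signs of Im a and Im b keep the vertical
  segment off the removed half-line.\<close>

lemma beta_form_right_decay:
  assumes K: "\<And>z. z \<in> log_strip \<Longrightarrow> (K has_field_derivative beta_form p q z) (at z)"
    and pq: "Re q < 1" and x: "x \<ge> 1" and ab: "Re a = x" "Re b = x" "\<bar>Im a\<bar> \<le> pi" "\<bar>Im b\<bar> \<le> pi" "Im a * Im b > 0"
  shows "norm (K b - K a) \<le> exp (pi * (\<bar>Im p\<bar> + \<bar>Im q\<bar>)) * exp ((Re p + Re q - 1) * x + (1 - Re q) * ln 2) * pi"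
proof -
  have "norm (K b - K a) \<le> exp (pi * (\<bar>Im p\<bar> + \<bar>Im q\<bar>)) * exp ((Re p + Re q - 1) * x + (1 - Re q) * ln 2) * \<bar>Im b - Im a\<bar>"
  proof (rule norm_diff_le_on_vertical)
    fix w assume w: "Re w = Re a" "w \<in> closed_segment a b"
    have im: "Im w \<noteq> 0" "\<bar>Im w\<bar> \<le> pi"
      using Im_closed_segment_bounds[OF w(2)] ab by (auto simp: zero_less_mult_iff min_def max_def split: if_splits)
    then have ws: "w \<in> log_strip" using pi_gt_zero by (auto simp: log_strip_def)
    have "norm (1 - exp w) \<ge> exp x - 1"
      using norm_triangle_ineq2[of "exp w" 1] w ab by (simp add: norm_minus_commute)
    moreover have "exp x \<ge> 2" using exp_ge_add_one_self[of x] x by linarith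
    ultimately have "norm (1 - exp w) \<ge> exp x / 2" by linarith
    then have "ln (exp x / 2) \<le> ln (norm (1 - exp w))"
      by (subst ln_le_cancel_iff) (auto intro: less_le_trans[OF _ \<open>norm (1 - exp w) \<ge> exp x / 2\<close>])
    then have "x - ln 2 \<le> ln (norm (1 - exp w))" by (simp add: ln_div)
    then have "(Re q - 1) * ln (norm (1 - exp w)) \<le> (Re q - 1) * (x - ln 2)"
      using pq by (intro mult_left_mono_neg) auto
    then have "exp (Re p * Re w + (Re q - 1) * ln (norm (1 - exp w))) \<le> exp ((Re p + Re q - 1) * x + (1 - Re q) * ln 2)"
      using w ab by (simp add: algebra_simps)
    then have "norm (beta_form p q w) \<le> exp (pi * (\<bar>Im p\<bar> + \<bar>Im q\<bar>)) * exp ((Re p + Re q - 1) * x + (1 - Re q) * ln 2)"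
      by (intro order_trans[OF norm_beta_form_le[OF im(2) ws]] mult_left_mono) auto
    with K[OF ws] show "(K has_field_derivative beta_form p q w) (at w) \<and> norm (beta_form p q w)
       \<le> exp (pi * (\<bar>Im p\<bar> + \<bar>Im q\<bar>)) * exp ((Re p + Re q - 1) * x + (1 - Re q) * ln 2)" by blast
  qed (use ab in auto)
  also have "\<dots> \<le> exp (pi * (\<bar>Im p\<bar> + \<bar>Im q\<bar>)) * exp ((Re p + Re q - 1) * x + (1 - Re q) * ln 2) * pi"
  proof (rule mult_left_mono)
    show "\<bar>Im b - Im a\<bar> \<le> pi" using ab by (auto simp: zero_less_mult_iff)
  qed simp
  finally show ?thesis .
qed

text \<open>On the left |1 - exp w| lies between 1/2 and 2, so the form is bounded by a multiple of
  e^(- Re p x), which decays when Re p > 0. The segment crosses the real axis at a negative point;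
  in the variable X it is a small circle around 0.\<close>

lemma beta_form_left_decay:
  assumes K: "\<And>z. z \<in> log_strip \<Longrightarrow> (K has_field_derivative beta_form p q z) (at z)"
    and x: "x \<ge> 1"
  shows "norm (K (Complex (-x) pi) - K (Complex (-x) (-pi)))
    \<le> exp (pi * (\<bar>Im p\<bar> + \<bar>Im q\<bar>)) * exp (- (Re p * x) + \<bar>Re q - 1\<bar> * ln 2) * (2 * pi)"
proof -
  have "norm (K (Complex (-x) pi) - K (Complex (-x) (-pi)))
    \<le> exp (pi * (\<bar>Im p\<bar> + \<bar>Im q\<bar>)) * exp (- (Re p * x) + \<bar>Re q - 1\<bar> * ln 2) * \<bar>Im (Complex (-x) pi) - Im (Complex (-x) (-pi))\<bar>"
  proof (rule norm_diff_le_on_vertical)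
    fix w assume w: "Re w = Re (Complex (-x) (-pi))" "w \<in> closed_segment (Complex (-x) (-pi)) (Complex (-x) pi)"
    have im: "\<bar>Im w\<bar> \<le> pi"
      using Im_closed_segment_bounds[OF w(2)] by (auto simp: min_def max_def split: if_splits)
    then have ws: "w \<in> log_strip" using x w im pi_gt_zero unfolding log_strip_def mem_Collect_eq by (intro conjI; simp; linarith)
    have "2 * exp (- x) \<le> 1"
    proof -
      have "exp x \<ge> 2" using exp_ge_add_one_self[of x] x by linarith
      then show ?thesis by (simp add: exp_minus field_simps)
    qed
    moreover have "norm (1 - exp w) \<ge> 1 - exp (-x)" "norm (1 - exp w) \<le> 1 + exp (-x)"
      using norm_triangle_ineq2[of 1 "exp w"] norm_triangle_ineq4[of 1 "exp w"] w by auto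
    ultimately have n: "norm (1 - exp w) \<ge> 1 / 2" "norm (1 - exp w) \<le> 2" by linarith+
    have np: "norm (1 - exp w) > 0" using n by linarith
    have "ln (1 / 2) \<le> ln (norm (1 - exp w))" "ln (norm (1 - exp w)) \<le> ln 2"
      using n np by (subst ln_le_cancel_iff; simp)+
    then have "\<bar>ln (norm (1 - exp w))\<bar> \<le> ln 2" by (auto simp: ln_div)
    then have "\<bar>Re q - 1\<bar> * \<bar>ln (norm (1 - exp w))\<bar> \<le> \<bar>Re q - 1\<bar> * ln 2" by (intro mult_left_mono) auto
    then have "(Re q - 1) * ln (norm (1 - exp w)) \<le> \<bar>Re q - 1\<bar> * ln 2"
      unfolding abs_mult[symmetric] by linarith
    then have "exp (Re p * Re w + (Re q - 1) * ln (norm (1 - exp w))) \<le> exp (- (Re p * x) + \<bar>Re q - 1\<bar> * ln 2)"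
      using w by simp
    then have "norm (beta_form p q w) \<le> exp (pi * (\<bar>Im p\<bar> + \<bar>Im q\<bar>)) * exp (- (Re p * x) + \<bar>Re q - 1\<bar> * ln 2)"
      by (intro order_trans[OF norm_beta_form_le[OF im ws]] mult_left_mono) auto
    with K[OF ws] show "(K has_field_derivative beta_form p q w) (at w) \<and> norm (beta_form p q w)
       \<le> exp (pi * (\<bar>Im p\<bar> + \<bar>Im q\<bar>)) * exp (- (Re p * x) + \<bar>Re q - 1\<bar> * ln 2)" by blast
  qed simp
  then show ?thesis by simp
qed

text \<open>On these lines exp z = - e^x, so 1 - exp z is positive and its logarithm is real; the
  two sides of the negative half-line differ only by the phases exp (\<plusminus>\<i> pi p).\<close>

lemma beta_form_horizontal_lines:
  assumes "\<sigma> = 1 \<or> \<sigma> = -1"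
  shows "beta_form p q (Complex x (\<sigma> * pi)) =
    exp (of_real \<sigma> * \<i> * of_real pi * p) * exp (p * of_real x - (1 - q) * of_real (ln (1 + exp x)))"
proof -
  have "exp (Complex x (\<sigma> * pi)) = - of_real (exp x)"
    using assms by (auto simp: complex_eq_iff Re_exp Im_exp)
  then have "1 - exp (Complex x (\<sigma> * pi)) = of_real (1 + exp x)" by simp
  then have "Ln (1 - exp (Complex x (\<sigma> * pi))) = of_real (ln (1 + exp x))"
    by (simp only: Ln_of_real add_pos_pos zero_less_one exp_gt_zero)
  then show ?thesis
    by (simp add: beta_form_def Complex_eq exp_add[symmetric] algebra_simps)
qed

lemma tendsto_integral_symmetric_interval:
  fixes f :: "real \<Rightarrow> 'a :: {banach, second_countable_topology}"
  assumes f: "integrable lborel f"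
  shows "((\<lambda>R. \<integral>x. indicator {-R..R} x *\<^sub>R f x \<partial>lborel) \<longlongrightarrow> (\<integral>x. f x \<partial>lborel)) at_top"
proof (rule integral_dominated_convergence_at_top[where w = "\<lambda>x. norm (f x)"])
  show "AE x in lborel. ((\<lambda>R. indicator {-R..R} x *\<^sub>R f x) \<longlongrightarrow> f x) at_top"
  proof (intro AE_I2 tendsto_eventually)
    fix x :: real
    show "\<forall>\<^sub>F R in at_top. indicator {-R..R} x *\<^sub>R f x = f x"
      using eventually_ge_at_top[of "\<bar>x\<bar>"] by eventually_elim (auto simp: indicator_def)
  qed
  show "\<forall>\<^sub>F R in at_top. AE x in lborel. norm (indicator {-R..R} x *\<^sub>R f x) \<le> norm (f x)"
    by (auto split: split_indicator)
qed (use f in \<open>auto dest: borel_measurable_integrable\<close>)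

lemma beta_form_line_increment:
  assumes K: "\<And>z. z \<in> log_strip \<Longrightarrow> (K has_field_derivative beta_form p q z) (at z)"
    and \<sigma>: "\<sigma> = 1 \<or> \<sigma> = -1" and R: "R \<ge> 0"
  shows "K (Complex R (\<sigma> * pi)) - K (Complex (-R) (\<sigma> * pi)) = exp (of_real \<sigma> * \<i> * of_real pi * p) *
    (\<integral>x. indicator {-R..R} x *\<^sub>R exp (p * of_real x - (1 - q) * of_real (ln (1 + exp x))) \<partial>lborel)"
proof -
  let ?f = "\<lambda>x. exp (of_real \<sigma> * \<i> * of_real pi * p) * exp (p * of_real x - (1 - q) * of_real (ln (1 + exp x)))"
  have "(\<integral>x. indicator {-R..R} x *\<^sub>R ?f x \<partial>lborel) = K (Complex R (\<sigma> * pi)) - K (Complex (-R) (\<sigma> * pi))"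
  proof (rule integral_FTC_Icc)
    show "-R \<le> R" using R by simp
    show "continuous_on {-R..R} ?f"
      by (intro continuous_intros) (auto intro!: add_pos_pos less_imp_neq[symmetric])
    fix x
    have "((\<lambda>x. of_real x + \<i> * of_real (\<sigma> * pi)) has_vector_derivative 1) (at x within {-R..R})"
      by (auto intro!: derivative_eq_intros)
    then have "((\<lambda>x. Complex x (\<sigma> * pi)) has_vector_derivative 1) (at x within {-R..R})"
      by (simp add: Complex_eq)
    moreover have "Complex x (\<sigma> * pi) \<in> log_strip" using \<sigma> by (auto simp: log_strip_def)
    then have "(K has_field_derivative beta_form p q (Complex x (\<sigma> * pi))) (at (Complex x (\<sigma> * pi)) within (\<lambda>x. Complex x (\<sigma> * pi)) ` {-R..R})"
      by (intro has_field_derivative_at_within[OF K])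
    ultimately have "((K \<circ> (\<lambda>x. Complex x (\<sigma> * pi))) has_vector_derivative 1 * beta_form p q (Complex x (\<sigma> * pi))) (at x within {-R..R})"
      by (rule field_vector_diff_chain_within)
    then show "((\<lambda>x. K (Complex x (\<sigma> * pi))) has_vector_derivative ?f x) (at x within {-R..R})"
      by (simp add: o_def beta_form_horizontal_lines[OF \<sigma>])
  qed
  then show ?thesis by (simp only: mult_scaleR_right[symmetric] integral_mult_right_zero)
qed

subsection \<open>Moments along Kanter's curve\<close>

definition ln_kanter :: "real \<Rightarrow> real \<Rightarrow> real" where
  "ln_kanter \<alpha> u = \<alpha> * ln (sin (\<alpha> * u) / sin u) + (1 - \<alpha>) * ln (sin ((1 - \<alpha>) * u) / sin u)"

lemma measurable_ln_kanter [measurable]: "ln_kanter a \<in> borel_measurable borel"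
  unfolding ln_kanter_def[abs_def] by measurable

text \<open>The logarithm of Kanter's curve, in the coordinate in which \<open>beta_form\<close> is
  written. As u tends to 0 it tends to ln \<alpha>, the saddle point, where it meets its mirror
  image.\<close>

definition kanter_path :: "real \<Rightarrow> real \<Rightarrow> complex" where
  "kanter_path \<alpha> u = Complex (ln (sin (\<alpha> * u) / sin u)) ((1 - \<alpha>) * u)"

lemma kanter_sin_pos:
  fixes \<alpha> u :: real
  assumes "0 < \<alpha>" "\<alpha> < 1" "0 < u" "u < pi"
  shows "sin (\<alpha> * u) > 0" "sin ((1 - \<alpha>) * u) > 0" "sin u > 0" "\<alpha> * u < pi" "(1 - \<alpha>) * u < pi"
proof -
  have "\<alpha> * u < 1 * pi" "(1 - \<alpha>) * u < 1 * pi" using assms by (intro mult_strict_mono; simp)+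
  then show "\<alpha> * u < pi" "(1 - \<alpha>) * u < pi" by auto
  then show "sin (\<alpha> * u) > 0" "sin ((1 - \<alpha>) * u) > 0" "sin u > 0"
    using assms by (auto intro!: sin_gt_zero)
qed

text \<open>The addition theorem for sin (\<alpha> u + (1 - \<alpha>) u) shows that 1 - X(u) is the
  conjugate of Kanter's curve with \<alpha> and 1 - \<alpha> exchanged.\<close>

lemma one_minus_exp_kanter_path:
  assumes "0 < \<alpha>" "\<alpha> < 1" "0 < u" "u < pi"
  shows "1 - exp (kanter_path \<alpha> u) = exp (Complex (ln (sin ((1 - \<alpha>) * u) / sin u)) (- (\<alpha> * u)))"
proof -
  note s = kanter_sin_pos[OF assms]
  have "sin u = sin (\<alpha> * u) * cos ((1 - \<alpha>) * u) + cos (\<alpha> * u) * sin ((1 - \<alpha>) * u)"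
    using sin_add[of "\<alpha> * u" "(1 - \<alpha>) * u"] by (simp add: algebra_simps)
  then show ?thesis
    using s by (simp add: kanter_path_def complex_eq_iff Re_exp Im_exp field_simps)
qed

lemma kanter_path_log_strip:
  assumes "0 < \<alpha>" "\<alpha> < 1" "0 < u" "u < pi"
  shows "kanter_path \<alpha> u \<in> log_strip" "cnj (kanter_path \<alpha> u) \<in> log_strip"
  using kanter_sin_pos(5)[OF assms] assms by (auto simp: kanter_path_def log_strip_def)

text \<open>On the path \<open>X\<^sup>\<alpha> (1 - X)\<^sup>1\<^sup>-\<^sup>\<alpha>\<close> is the positive real number \<open>kanter_b \<alpha> u\<close>: the arguments
  \<open>\<alpha> (1 - \<alpha>) u\<close> and \<open>- (1 - \<alpha>) \<alpha> u\<close> cancel.\<close>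

lemma beta_form_kanter_path:
  assumes "0 < \<alpha>" "\<alpha> < 1" "0 < u" "u < pi"
  shows "beta_form (of_real \<alpha> * t) (of_real (1 - \<alpha>) * t) (kanter_path \<alpha> u)
      = exp (t * of_real (ln_kanter \<alpha> u)) / (1 - exp (kanter_path \<alpha> u))"
    and "beta_form (of_real \<alpha> * t) (of_real (1 - \<alpha>) * t) (cnj (kanter_path \<alpha> u))
      = exp (t * of_real (ln_kanter \<alpha> u)) / cnj (1 - exp (kanter_path \<alpha> u))"
proof -
  note s = kanter_sin_pos[OF assms]
  define L where "L = Complex (ln (sin ((1 - \<alpha>) * u) / sin u)) (- (\<alpha> * u))"
  define Z where "Z = kanter_path \<alpha> u"
  have e1: "1 - exp Z = exp L"
    using one_minus_exp_kanter_path[OF assms] by (simp only: L_def Z_def)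
  have "1 - exp (cnj Z) = cnj (1 - exp Z)" by (simp add: exp_cnj)
  then have e: "1 - exp Z = exp L" "1 - exp (cnj Z) = exp (cnj L)"
    by (simp_all only: e1 exp_cnj)
  have "Im L = - (\<alpha> * u)" "0 < \<alpha> * u" using assms by (auto simp: L_def)
  then have L: "Ln (exp L) = L" "Ln (exp (cnj L)) = cnj L"
    using s by (auto intro!: Ln_exp)
  have 1: "of_real \<alpha> * Z + of_real (1 - \<alpha>) * L = of_real (ln_kanter \<alpha> u)"
    "of_real \<alpha> * cnj Z + of_real (1 - \<alpha>) * cnj L = of_real (ln_kanter \<alpha> u)"
    by (simp_all add: complex_eq_iff Z_def L_def kanter_path_def ln_kanter_def)
  have "of_real \<alpha> * t * Z + (of_real (1 - \<alpha>) * t - 1) * L = t * (of_real \<alpha> * Z + of_real (1 - \<alpha>) * L) - L"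
    "of_real \<alpha> * t * cnj Z + (of_real (1 - \<alpha>) * t - 1) * cnj L
       = t * (of_real \<alpha> * cnj Z + of_real (1 - \<alpha>) * cnj L) - cnj L"
    by (simp_all add: algebra_simps)
  then show "beta_form (of_real \<alpha> * t) (of_real (1 - \<alpha>) * t) (kanter_path \<alpha> u)
      = exp (t * of_real (ln_kanter \<alpha> u)) / (1 - exp (kanter_path \<alpha> u))"
    and "beta_form (of_real \<alpha> * t) (of_real (1 - \<alpha>) * t) (cnj (kanter_path \<alpha> u))
      = exp (t * of_real (ln_kanter \<alpha> u)) / cnj (1 - exp (kanter_path \<alpha> u))"
    unfolding Z_def[symmetric] beta_form_def 1 by (simp_all add: e L exp_diff exp_cnj)
qed

lemma kanter_path_derivative:
  assumes "0 < \<alpha>" "\<alpha> < 1" "0 < u" "u < pi"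
  shows "(kanter_path \<alpha> has_vector_derivative Complex (\<alpha> * cot (\<alpha> * u) - cot u) (1 - \<alpha>)) (at u)"
proof -
  note s = kanter_sin_pos[OF assms]
  have "((\<lambda>u. ln (sin (\<alpha> * u) / sin u)) has_real_derivative (\<alpha> * cot (\<alpha> * u) - cot u)) (at u)"
    using s by (auto intro!: derivative_eq_intros simp: cot_def field_simps)
  moreover have "((\<lambda>u. (1 - \<alpha>) * u) has_real_derivative (1 - \<alpha>)) (at u)"
    by (auto intro!: derivative_eq_intros)
  ultimately show ?thesis
    unfolding kanter_path_def[abs_def]
    by (simp add: has_vector_derivative_complex_iff)
qed

text \<open>dX / (X (1 - X)) is the differential of ln X - ln (1 - X), whose imaginary part on the
  curve is (1 - \<alpha>) u + \<alpha> u = u. So in the parameter u the difference of the Beta form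
  on the curve and on its mirror image is 2 \<i> b(u)^t du.\<close>

lemma kanter_path_derivative_quotient:
  assumes "0 < \<alpha>" "\<alpha> < 1" "0 < u" "u < pi"
  defines "Z' \<equiv> Complex (\<alpha> * cot (\<alpha> * u) - cot u) (1 - \<alpha>)" and "E \<equiv> 1 - exp (kanter_path \<alpha> u)"
  shows "Z' / E - cnj Z' / cnj E = 2 * \<i>"
proof -
  note s = kanter_sin_pos[OF assms(1-4)]
  define r where "r = sin ((1 - \<alpha>) * u) / sin u"
  have r: "r > 0" using s by (simp add: r_def)
  have "E = exp (Complex (ln r) (- (\<alpha> * u)))"
    unfolding E_def r_def by (rule one_minus_exp_kanter_path[OF assms(1-4)])
  then have "inverse E = exp (Complex (- ln r) (\<alpha> * u))"
    by (simp flip: exp_minus add: Complex_eq)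
  then have iE: "Re (inverse E) = inverse r * cos (\<alpha> * u)" "Im (inverse E) = inverse r * sin (\<alpha> * u)"
    using r by (simp_all only: Re_exp Im_exp complex.sel exp_minus exp_ln)
  have "Im (Z' * inverse E) = inverse r * ((\<alpha> * cot (\<alpha> * u) - cot u) * sin (\<alpha> * u) + (1 - \<alpha>) * cos (\<alpha> * u))"
    unfolding times_complex.sel iE by (simp add: Z'_def algebra_simps)
  also have "(\<alpha> * cot (\<alpha> * u) - cot u) * sin (\<alpha> * u) + (1 - \<alpha>) * cos (\<alpha> * u) = cos (\<alpha> * u) - cot u * sin (\<alpha> * u)"
    using s by (simp add: cot_def field_simps)
  also have "\<dots> = (sin u * cos (\<alpha> * u) - cos u * sin (\<alpha> * u)) / sin u"
    using s by (simp add: cot_def field_simps)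
  also have "sin u * cos (\<alpha> * u) - cos u * sin (\<alpha> * u) = sin ((1 - \<alpha>) * u)"
    by (simp add: sin_diff[symmetric] algebra_simps)
  also have "inverse r * (sin ((1 - \<alpha>) * u) / sin u) = 1" using r unfolding r_def[symmetric] by simp
  finally have "Im (Z' / E) = 1" by (simp only: divide_inverse)
  moreover have "Z' / E - cnj Z' / cnj E = of_real (2 * Im (Z' / E)) * \<i>"
    using complex_diff_cnj[of "Z' / E"] by simp
  ultimately show ?thesis by simp
qed

lemma tendsto_sin_ratio_0:
  fixes \<alpha> :: real
  assumes "\<alpha> > 0"
  shows "((\<lambda>u. sin (\<alpha> * u) / sin u) \<longlongrightarrow> \<alpha>) (at_right 0)"
  using assms by real_asymp

lemma filterlim_ln_sin_ratio_pi:
  fixes \<alpha> :: real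
  assumes "0 < \<alpha>" "\<alpha> < 1"
  shows "filterlim (\<lambda>u. ln (sin (\<alpha> * u) / sin u)) at_top (at_left pi)"
proof -
  have pos: "sin (\<alpha> * pi) > 0" using assms by (intro sin_gt_zero) auto
  have "filterlim (\<lambda>u. sin (\<alpha> * u) / sin u) at_top (at_left pi)"
  proof (rule LIM_at_top_divide)
    have "((\<lambda>u. sin (\<alpha> * u)) \<longlongrightarrow> sin (\<alpha> * pi)) (at_left pi)" by (intro tendsto_intros)
    then show "((\<lambda>u. sin (\<alpha> * u)) \<longlongrightarrow> sin (\<alpha> * pi)) (at_left pi)" .
    have "(sin \<longlongrightarrow> sin pi) (at_left (pi::real))" by (intro tendsto_intros)
    then show "(sin \<longlongrightarrow> 0) (at_left (pi::real))" by simp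
    show "\<forall>\<^sub>F u in at_left (pi::real). sin u > 0"
      unfolding eventually_at_left_field by (intro exI[of _ 0]) (auto intro: sin_gt_zero)
  qed (use pos in auto)
  then show ?thesis by (rule filterlim_compose[OF ln_at_top])
qed

text \<open>Once \<open>D\<close> is known to be a primitive on (0, pi), its two limits remain. At 0
  the curve and its mirror image meet, which gives 0. Near pi both are joined to the lines Im z =
  \<plusminus>pi by vertical segments; the error vanishes on the right because Re t < 1 and on the
  left because Re t > 0.\<close>

lemma kanter_moment_primitive:
  assumes \<alpha>: "0 < \<alpha>" "\<alpha> < 1" and t: "0 < Re t" "Re t < 1"
  obtains D where "\<And>u. 0 < u \<Longrightarrow> u < pi \<Longrightarrow> (D has_vector_derivative exp (t * of_real (ln_kanter \<alpha> u))) (at u)"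
    "(D \<longlongrightarrow> 0) (at_right 0)" "(D \<longlongrightarrow> of_real pi * kanter_mellin \<alpha> (- t)) (at_left pi)"
proof -
  define p q where "p = of_real \<alpha> * t" and "q = of_real (1 - \<alpha>) * t"
  have pq: "Re p > 0" "Re (p + q) = Re t" "p + q = t" "Re q < 1" "Re q > 0"
  proof -
    have "(1 - \<alpha>) * Re t < 1 * 1" using \<alpha> t by (intro mult_strict_mono) auto
    then show "Re q < 1" by (simp add: q_def)
  qed (use \<alpha> t in \<open>auto simp: p_def q_def algebra_simps\<close>)
  obtain K where K: "\<And>z. z \<in> log_strip \<Longrightarrow> (K has_field_derivative beta_form p q z) (at z)"
    using beta_form_primitive[of p q] by metis
  define Z where "Z = kanter_path \<alpha>"
  define D where "D = (\<lambda>u. (K (Z u) - K (cnj (Z u))) / (2 * \<i>))"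
  have deriv: "(D has_vector_derivative exp (t * of_real (ln_kanter \<alpha> u))) (at u)" if u: "0 < u" "u < pi" for u
  proof -
    define Z' where "Z' = Complex (\<alpha> * cot (\<alpha> * u) - cot u) (1 - \<alpha>)"
    define E where "E = 1 - exp (Z u)"
    define b where "b = exp (t * of_real (ln_kanter \<alpha> u))"
    have Z': "(Z has_vector_derivative Z') (at u)" unfolding Z_def Z'_def by (rule kanter_path_derivative[OF \<alpha> u])
    have "((K \<circ> Z) has_vector_derivative Z' * beta_form p q (Z u)) (at u)"
      by (rule field_vector_diff_chain_at[OF Z' K]) (use kanter_path_log_strip[OF \<alpha> u] in \<open>simp add: Z_def\<close>)
    moreover have "((K \<circ> (\<lambda>u. cnj (Z u))) has_vector_derivative cnj Z' * beta_form p q (cnj (Z u))) (at u)"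
      by (rule field_vector_diff_chain_at[OF has_vector_derivative_cnj[OF Z'] K])
         (use kanter_path_log_strip[OF \<alpha> u] in \<open>simp add: Z_def\<close>)
    ultimately have "(D has_vector_derivative (Z' * beta_form p q (Z u) - cnj Z' * beta_form p q (cnj (Z u))) / (2 * \<i>)) (at u)"
      unfolding D_def o_def by (intro has_vector_derivative_divide has_vector_derivative_diff)
    also have "Z' * beta_form p q (Z u) - cnj Z' * beta_form p q (cnj (Z u)) = b * (Z' / E - cnj Z' / cnj E)"
      using beta_form_kanter_path[OF \<alpha> u, of t] by (simp add: p_def q_def Z_def E_def b_def algebra_simps)
    also have "Z' / E - cnj Z' / cnj E = 2 * \<i>"
      unfolding Z'_def E_def Z_def by (rule kanter_path_derivative_quotient[OF \<alpha> u])
    also have "b * (2 * \<i>) / (2 * \<i>) = b" by (rule nonzero_mult_div_cancel_right) simp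
    finally show ?thesis by (simp only: b_def)
  qed
  have lim0: "(D \<longlongrightarrow> 0) (at_right 0)"
  proof -
    let ?a = "Complex (ln \<alpha>) 0"
    have "?a \<in> log_strip" using \<alpha> by (simp add: log_strip_def)
    then have cont: "isCont K ?a" using K DERIV_isCont by blast
    have "((\<lambda>u. ln (sin (\<alpha> * u) / sin u)) \<longlongrightarrow> ln \<alpha>) (at_right 0)"
      using \<alpha> by (intro tendsto_ln tendsto_sin_ratio_0) auto
    moreover have "((\<lambda>u. (1 - \<alpha>) * u) \<longlongrightarrow> (1 - \<alpha>) * 0) (at_right 0)" by (intro tendsto_intros)
    ultimately have "(Z \<longlongrightarrow> ?a) (at_right 0)"
      unfolding Z_def kanter_path_def[abs_def] by (intro tendsto_Complex) auto
    moreover from tendsto_cnj[OF this] have "((\<lambda>u. cnj (Z u)) \<longlongrightarrow> ?a) (at_right 0)" by (simp add: complex_cnj)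
    ultimately have "(D \<longlongrightarrow> (K ?a - K ?a) / (2 * \<i>)) (at_right 0)"
      unfolding D_def by (intro tendsto_divide tendsto_diff tendsto_const isCont_tendsto_compose[OF cont]) auto
    then show ?thesis by simp
  qed
  have limpi: "(D \<longlongrightarrow> of_real pi * kanter_mellin \<alpha> (- t)) (at_left pi)"
  proof -
    define \<beta> where "\<beta> = (\<lambda>x. exp (p * of_real x - (1 - q) * of_real (ln (1 + exp x))))"
    define J where "J = (\<lambda>R. \<integral>x. indicator {-R..R} x *\<^sub>R \<beta> x \<partial>lborel)"
    define B where "B = Gamma p * Gamma (1 - t) / Gamma (1 - q)"
    have "has_bochner_integral lborel (\<lambda>x. exp (p * of_real x - (p + (1 - t)) * of_real (ln (1 + exp x))))
        (Gamma p * Gamma (1 - t) / Gamma (p + (1 - t)))"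
      by (rule has_bochner_integral_Beta_exp) (use pq t in auto)
    \<comment> \<open>The exponent 1 - q of 1 + e^x on the lines is the sum of the Beta parameters p
      and 1 - t.\<close>
    moreover have "p + (1 - t) = 1 - q" using pq(3) by (simp add: algebra_simps)
    ultimately have \<beta>: "has_bochner_integral lborel \<beta> B" by (simp add: \<beta>_def B_def)
    then have J: "(J \<longlongrightarrow> B) at_top"
      unfolding J_def using tendsto_integral_symmetric_interval[of \<beta>] by (simp add: has_bochner_integral_iff)
    define ep em where "ep = exp (\<i> * of_real pi * p)" and "em = exp (- (\<i> * of_real pi * p))"
    define \<xi> where "\<xi> = (\<lambda>u. ln (sin (\<alpha> * u) / sin u))"
    have \<xi>: "filterlim \<xi> at_top (at_left pi)" unfolding \<xi>_def by (rule filterlim_ln_sin_ratio_pi[OF \<alpha>])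
    define C1 C2 where "C1 = exp (pi * (\<bar>Im p\<bar> + \<bar>Im q\<bar>))" and "C2 = \<bar>Re q - 1\<bar> * ln 2"
    \<comment> \<open>Two vertical segments on the right, one above and one below the axis, and a
      single one on the left joining the two lines.\<close>
    define r where "r = (\<lambda>x. 2 * (C1 * exp ((Re p + Re q - 1) * x + (1 - Re q) * ln 2) * pi)
       + C1 * exp (- (Re p * x) + C2) * (2 * pi))"
    have "(r \<longlongrightarrow> 2 * (C1 * 0 * pi) + C1 * 0 * (2 * pi)) at_top"
    proof -
      have lin: "filterlim (\<lambda>x. c * x + d) at_bot at_top" if "c < 0" for c d :: real
        using that by real_asymp
      have "filterlim (\<lambda>x. (Re p + Re q - 1) * x + (1 - Re q) * ln 2) at_bot at_top"
        using pq(2) t by (intro lin) simp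
      then have 1: "((\<lambda>x. exp ((Re p + Re q - 1) * x + (1 - Re q) * ln 2)) \<longlongrightarrow> 0) at_top"
        by (rule filterlim_compose[OF exp_at_bot])
      have "filterlim (\<lambda>x. - (Re p * x) + C2) at_bot at_top" using lin[of "- Re p" C2] pq by simp
      then have 2: "((\<lambda>x. exp (- (Re p * x) + C2)) \<longlongrightarrow> 0) at_top"
        by (rule filterlim_compose[OF exp_at_bot])
      show ?thesis unfolding r_def by (intro tendsto_intros 1 2)
    qed
    then have r: "(r \<longlongrightarrow> 0) at_top" by simp
    have bound: "norm ((K (Z u) - K (cnj (Z u))) - (ep - em) * J (\<xi> u)) \<le> r (\<xi> u)"
      if u: "0 < u" "u < pi" "\<xi> u \<ge> 1" for u
    proof -
      let ?x = "\<xi> u"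
      have ReZ: "Re (Z u) = ?x" "Im (Z u) = (1 - \<alpha>) * u" "(1 - \<alpha>) * u > 0" "(1 - \<alpha>) * u < pi"
        using kanter_sin_pos(5)[OF \<alpha> u(1,2)] \<alpha> u by (auto simp: Z_def kanter_path_def \<xi>_def)
      have 1: "norm (K (Z u) - K (Complex ?x pi)) \<le> C1 * exp ((Re p + Re q - 1) * ?x + (1 - Re q) * ln 2) * pi"
        unfolding C1_def by (rule beta_form_right_decay[OF K pq(4) u(3)]) (use ReZ in auto)
      have 2: "norm (K (cnj (Z u)) - K (Complex ?x (-pi))) \<le> C1 * exp ((Re p + Re q - 1) * ?x + (1 - Re q) * ln 2) * pi"
        unfolding C1_def by (rule beta_form_right_decay[OF K pq(4) u(3)]) (use ReZ in auto)
      have 3: "norm (K (Complex (-?x) pi) - K (Complex (-?x) (-pi))) \<le> C1 * exp (- (Re p * ?x) + C2) * (2 * pi)"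
        unfolding C1_def C2_def by (rule beta_form_left_decay[OF K u(3)])
      have 4: "K (Complex ?x pi) - K (Complex (-?x) pi) = ep * J ?x"
        using beta_form_line_increment[OF K, of 1 ?x] u by (simp add: ep_def J_def \<beta>_def)
      have 5: "K (Complex ?x (-pi)) - K (Complex (-?x) (-pi)) = em * J ?x"
        using beta_form_line_increment[OF K, of "-1" ?x] u by (simp add: em_def J_def \<beta>_def)
      have "(K (Z u) - K (cnj (Z u))) - (ep - em) * J ?x
         = (K (Z u) - K (Complex ?x pi)) - (K (cnj (Z u)) - K (Complex ?x (-pi)))
           + (K (Complex (-?x) pi) - K (Complex (-?x) (-pi)))"
        unfolding left_diff_distrib 4[symmetric] 5[symmetric] by simp
      also have "norm \<dots> \<le> norm (K (Z u) - K (Complex ?x pi)) + norm (K (cnj (Z u)) - K (Complex ?x (-pi)))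
           + norm (K (Complex (-?x) pi) - K (Complex (-?x) (-pi)))"
        by (intro order_trans[OF norm_triangle_ineq] add_right_mono norm_triangle_ineq4)
      also have "\<dots> \<le> r ?x" using 1 2 3 unfolding r_def by linarith
      finally show ?thesis .
    qed
    have "((\<lambda>u. (K (Z u) - K (cnj (Z u))) - (ep - em) * J (\<xi> u)) \<longlongrightarrow> 0) (at_left pi)"
    proof (rule Lim_null_comparison)
      have "\<forall>\<^sub>F u in at_left pi. 0 < u \<and> u < pi"
        unfolding eventually_at_left_field by (intro exI[of _ 0]) auto
      moreover have "\<forall>\<^sub>F u in at_left pi. \<xi> u \<ge> 1" using \<xi> by (auto simp: filterlim_at_top)
      ultimately show "\<forall>\<^sub>F u in at_left pi. norm ((K (Z u) - K (cnj (Z u))) - (ep - em) * J (\<xi> u)) \<le> r (\<xi> u)"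
        by eventually_elim (use bound in auto)
      show "((\<lambda>u. r (\<xi> u)) \<longlongrightarrow> 0) (at_left pi)" by (rule filterlim_compose[OF r \<xi>])
    qed
    moreover have "((\<lambda>u. (ep - em) * J (\<xi> u)) \<longlongrightarrow> (ep - em) * B) (at_left pi)"
      by (intro tendsto_intros filterlim_compose[OF J \<xi>])
    ultimately have "((\<lambda>u. ((K (Z u) - K (cnj (Z u))) - (ep - em) * J (\<xi> u)) + (ep - em) * J (\<xi> u)) \<longlongrightarrow> 0 + (ep - em) * B) (at_left pi)"
      by (rule tendsto_add)
    then have "((\<lambda>u. (K (Z u) - K (cnj (Z u)))) \<longlongrightarrow> (ep - em) * B) (at_left pi)" by simp
    then have "(D \<longlongrightarrow> (ep - em) * B / (2 * \<i>)) (at_left pi)"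
      unfolding D_def by (intro tendsto_divide tendsto_const) auto
    also have "(ep - em) * B / (2 * \<i>) = sin (of_real pi * p) * B"
      by (simp add: ep_def em_def sin_exp_eq mult_ac)
    \<comment> \<open>By reflection sin (pi p) Gamma(p) = pi / Gamma(1 - p), and 1 - t, 1 - p, 1 - q
      are the three arguments in f(-t).\<close>
    also have "\<dots> = of_real pi * kanter_mellin \<alpha> (- t)"
    proof -
      have "p \<notin> \<int>\<^sub>\<le>\<^sub>0"
      proof
        assume "p \<in> \<int>\<^sub>\<le>\<^sub>0"
        then obtain n where "p = - of_nat n" by (auto elim!: nonpos_Ints_cases')
        then show False using pq(1) by simp
      qed
      then have "rGamma p * Gamma p = 1" by (simp add: rGamma_inverse_Gamma Gamma_eq_zero_iff)
      then have "sin (of_real pi * p) * Gamma p = of_real pi * rGamma (1 - p)"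
        using rGamma_reflection_complex[of p] by (simp add: field_simps) (metis mult.assoc mult.commute mult_1)
      then show ?thesis
        by (simp add: kanter_mellin_def B_def p_def q_def rGamma_inverse_Gamma divide_inverse mult_ac)
    qed
    finally show ?thesis .
  qed
  show ?thesis by (rule that[OF deriv lim0 limpi])
qed

text \<open>For the real exponent Re t the integrand is positive, and a primitive with finite limits
  at both ends yields integrability. The complex integrand has the same norm.\<close>

lemma kanter_moment_integrable:
  assumes \<alpha>: "0 < \<alpha>" "\<alpha> < 1" and t: "0 < Re t" "Re t < 1"
  shows "set_integrable lborel {0<..<pi} (\<lambda>u. exp (t * of_real (ln_kanter \<alpha> u)))"
proof -
  obtain D where D: "\<And>u. 0 < u \<Longrightarrow> u < pi \<Longrightarrow> (D has_vector_derivative exp (of_real (Re t) * of_real (ln_kanter \<alpha> u))) (at u)"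
    "(D \<longlongrightarrow> 0) (at_right 0)" "(D \<longlongrightarrow> of_real pi * kanter_mellin \<alpha> (- of_real (Re t))) (at_left pi)"
    using kanter_moment_primitive[OF \<alpha>, of "of_real (Re t)"] t by auto
  have cont: "isCont (ln_kanter \<alpha>) u" if "0 < u" "u < pi" for u
    unfolding ln_kanter_def[abs_def] using kanter_sin_pos[OF \<alpha> that]
    by (intro continuous_intros) auto
  have "set_integrable lborel (einterval (ereal 0) (ereal pi)) (\<lambda>u. exp (Re t * ln_kanter \<alpha> u))"
  proof (rule interval_integral_FTC_nonneg)
    show "DERIV (\<lambda>u. Re (D u)) u :> exp (Re t * ln_kanter \<alpha> u)" if "ereal 0 < ereal u" "ereal u < ereal pi" for u
      using D(1)[of u] that unfolding has_vector_derivative_complex_iff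
      by (simp add: Re_exp flip: has_real_derivative_iff_has_vector_derivative)
    show "isCont (\<lambda>u. exp (Re t * ln_kanter \<alpha> u)) u" if "ereal 0 < ereal u" "ereal u < ereal pi" for u
      using cont[of u] that by (intro continuous_intros) auto
    show "(((\<lambda>u. Re (D u)) \<circ> real_of_ereal) \<longlongrightarrow> Re 0) (at_right (ereal 0))"
      unfolding ereal_tendsto_simps by (intro tendsto_intros D)
    show "(((\<lambda>u. Re (D u)) \<circ> real_of_ereal) \<longlongrightarrow> Re (of_real pi * kanter_mellin \<alpha> (- of_real (Re t)))) (at_left (ereal pi))"
      unfolding ereal_tendsto_simps by (intro tendsto_Re D)
  qed auto
  then have int: "set_integrable lborel {0<..<pi} (\<lambda>u. exp (Re t * ln_kanter \<alpha> u))" by simp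
  show ?thesis
  proof (rule set_integrable_bound[OF int])
    show "set_borel_measurable lborel {0<..<pi} (\<lambda>u. exp (t * of_real (ln_kanter \<alpha> u)))"
      unfolding set_borel_measurable_def by measurable
  qed (auto simp: Re_exp)
qed

lemma kanter_moment_strip:
  assumes \<alpha>: "0 < \<alpha>" "\<alpha> < 1" and t: "0 < Re t" "Re t < 1"
  shows "(LBINT u:{0<..<pi}. exp (t * of_real (ln_kanter \<alpha> u))) = of_real pi * kanter_mellin \<alpha> (- t)"
proof -
  obtain D where D: "\<And>u. 0 < u \<Longrightarrow> u < pi \<Longrightarrow> (D has_vector_derivative exp (t * of_real (ln_kanter \<alpha> u))) (at u)"
    "(D \<longlongrightarrow> 0) (at_right 0)" "(D \<longlongrightarrow> of_real pi * kanter_mellin \<alpha> (- t)) (at_left pi)"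
    using kanter_moment_primitive[OF \<alpha> t] by auto
  have cont: "isCont (ln_kanter \<alpha>) u" if "0 < u" "u < pi" for u
    unfolding ln_kanter_def[abs_def] using kanter_sin_pos[OF \<alpha> that]
    by (intro continuous_intros) auto
  have "(LBINT u=ereal 0..ereal pi. exp (t * of_real (ln_kanter \<alpha> u))) = of_real pi * kanter_mellin \<alpha> (- t) - 0"
  proof (rule interval_integral_FTC_integrable)
    show "isCont (\<lambda>u. exp (t * of_real (ln_kanter \<alpha> u))) u" if "ereal 0 < ereal u" "ereal u < ereal pi" for u
      using cont[of u] that by (intro continuous_intros) auto
    show "set_integrable lborel (einterval (ereal 0) (ereal pi)) (\<lambda>u. exp (t * of_real (ln_kanter \<alpha> u)))"
      using kanter_moment_integrable[OF \<alpha> t] by simp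
  qed (use D in \<open>auto simp: ereal_tendsto_simps\<close>)
  then show ?thesis by (simp add: interval_lebesgue_integral_def)
qed

text \<open>On the imaginary axis Re p = 0 and the Beta integral does not converge, so the formula
  is reached from Re t > 0 by dominated convergence and continuity of f.\<close>

lemma kanter_moment_imaginary:
  assumes \<alpha>: "0 < \<alpha>" "\<alpha> < 1"
  shows "(LBINT u:{0<..<pi}. exp (\<i> * of_real \<tau> * of_real (ln_kanter \<alpha> u))) = of_real pi * kanter_mellin \<alpha> (- (\<i> * of_real \<tau>))"
proof (rule LIMSEQ_unique)
  \<comment> \<open>The real parts 1 / (n + 2) stay in (0, 1/2], so that b^(Re t) is at most 1 +
    b^(1/2) for every b > 0.\<close>
  define t where "t = (\<lambda>n. \<i> * of_real \<tau> + of_real (1 / (real n + 2)))"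
  have t01: "0 < Re (t n)" "Re (t n) < 1" for n by (auto simp: t_def)
  have Re_t: "Re (t n) = 1 / (real n + 2)" for n by (simp add: t_def)
  have "(\<lambda>n. complex_of_real (1 / (real n + 2))) \<longlonglongrightarrow> of_real 0"
    by (rule tendsto_of_real) real_asymp
  then have "t \<longlonglongrightarrow> \<i> * of_real \<tau> + of_real 0"
    unfolding t_def by (intro tendsto_add tendsto_const)
  then have t: "t \<longlonglongrightarrow> \<i> * of_real \<tau>" by simp
  have "isCont (kanter_mellin \<alpha>) (- (\<i> * of_real \<tau>))"
    using holomorphic_kanter_mellin_left_slit[of \<alpha>] open_left_slit[of 1]
    by (intro continuous_on_interior[of "left_slit 1"] holomorphic_on_imp_continuous_on)
       (auto simp: interior_open left_slit_def)
  then have "(\<lambda>n. of_real pi * kanter_mellin \<alpha> (- t n)) \<longlonglongrightarrow> of_real pi * kanter_mellin \<alpha> (- (\<i> * of_real \<tau>))"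
    by (intro tendsto_mult tendsto_const isCont_tendsto_compose[of _ "kanter_mellin \<alpha>"] tendsto_minus t)
  then show "(\<lambda>n. (LBINT u:{0<..<pi}. exp (t n * of_real (ln_kanter \<alpha> u)))) \<longlonglongrightarrow> of_real pi * kanter_mellin \<alpha> (- (\<i> * of_real \<tau>))"
    by (simp only: kanter_moment_strip[OF \<alpha> t01])
  have half: "set_integrable lborel {0<..<pi} (\<lambda>u. exp (of_real (1 / 2) * of_real (ln_kanter \<alpha> u) :: complex))"
    by (rule kanter_moment_integrable[OF \<alpha>]) auto
  show "(\<lambda>n. (LBINT u:{0<..<pi}. exp (t n * of_real (ln_kanter \<alpha> u)))) \<longlonglongrightarrow>
     (LBINT u:{0<..<pi}. exp (\<i> * of_real \<tau> * of_real (ln_kanter \<alpha> u)))"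
    unfolding set_lebesgue_integral_def
  proof (rule integral_dominated_convergence[where w = "\<lambda>u. indicator {0<..<pi} u * (1 + exp (1 / 2 * ln_kanter \<alpha> u))"])
    have "set_integrable lborel {0<..<pi} (\<lambda>u. exp (1 / 2 * ln_kanter \<alpha> u))"
      using set_integrable_norm[OF half] by simp
    moreover have "set_integrable lborel {0<..<pi} (\<lambda>u. 1 :: real)"
      by (auto simp: set_integrable_def)
    ultimately have "set_integrable lborel {0<..<pi} (\<lambda>u. 1 + exp (1 / 2 * ln_kanter \<alpha> u))" by (intro set_integral_add)
    then show "integrable lborel (\<lambda>u. indicator {0<..<pi} u * (1 + exp (1 / 2 * ln_kanter \<alpha> u)))"
      by (simp add: set_integrable_def)
    show "AE u in lborel. (\<lambda>n. indicator {0<..<pi} u *\<^sub>R exp (t n * of_real (ln_kanter \<alpha> u))) \<longlonglongrightarrow>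
        indicator {0<..<pi} u *\<^sub>R exp (\<i> * of_real \<tau> * of_real (ln_kanter \<alpha> u))"
      by (intro AE_I2 tendsto_intros t)
    show "AE u in lborel. norm (indicator {0<..<pi} u *\<^sub>R exp (t n * of_real (ln_kanter \<alpha> u)))
        \<le> indicator {0<..<pi} u * (1 + exp (1 / 2 * ln_kanter \<alpha> u))" for n
    proof (intro AE_I2)
      fix u
      have "exp (Re (t n) * ln_kanter \<alpha> u) \<le> 1 + exp (1 / 2 * ln_kanter \<alpha> u)"
      proof (cases "ln_kanter \<alpha> u \<ge> 0")
        case True
        then have "Re (t n) * ln_kanter \<alpha> u \<le> 1 / 2 * ln_kanter \<alpha> u"
          by (intro mult_right_mono) (auto simp: Re_t field_simps)
        then have "exp (Re (t n) * ln_kanter \<alpha> u) \<le> exp (1 / 2 * ln_kanter \<alpha> u)" by (subst exp_le_cancel_iff)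
        then show ?thesis by linarith
      next
        case False
        then have "Re (t n) * ln_kanter \<alpha> u \<le> 0" using t01[of n] by (simp add: mult_le_0_iff)
        then have "exp (Re (t n) * ln_kanter \<alpha> u) \<le> 1" by simp
        then show ?thesis using exp_gt_zero[of "1 / 2 * ln_kanter \<alpha> u"] by linarith
      qed
      then show "norm (indicator {0<..<pi} u *\<^sub>R exp (t n * of_real (ln_kanter \<alpha> u)))
        \<le> indicator {0<..<pi} u * (1 + exp (1 / 2 * ln_kanter \<alpha> u))"
        by (auto simp: indicator_def)
    qed
  qed measurable
qed

section \<open>Monotonicity of Kanter's function and its limit at 0\<close>

lemma x_cot_x_antimono:
  fixes x y :: real
  assumes "0 < x" "x < y" "y < pi"
  shows "y * cot y < x * cot x"
proof (rule DERIV_neg_imp_decreasing[OF assms(2)])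
  fix z assume z: "x \<le> z" "z \<le> y"
  then have s: "sin z > 0" "z > 0" using assms by (auto intro: sin_gt_zero)
  have "((\<lambda>z. z * cot z) has_real_derivative (cot z - z / (sin z)\<^sup>2)) (at z)"
    using DERIV_mult[OF DERIV_ident DERIV_cot, of z] s by (simp add: divide_inverse mult.commute)
  moreover have "cot z - z / (sin z)\<^sup>2 < 0"
  proof -
    have "sin z * cos z < z"
    proof (cases "cos z \<ge> 0")
      case True
      have "cos z \<noteq> 1" using s cos_one_sin_zero[of z] by auto
      then have "cos z < 1" using cos_le_one[of z] by linarith
      then have "sin z * cos z < sin z * 1" using s by (intro mult_strict_left_mono) auto
      also have "\<dots> \<le> z" using s sin_x_le_x[of z] by simp
      finally show ?thesis .
    next
      case False
      then have "sin z * cos z \<le> 0" using s by (simp add: mult_le_0_iff)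
      then show ?thesis using s by linarith
    qed
    then have "sin z * cos z / (sin z)\<^sup>2 < z / (sin z)\<^sup>2" using s by (intro divide_strict_right_mono) auto
    then show ?thesis using s by (simp add: cot_def power2_eq_square)
  qed
  ultimately show "\<exists>y. ((\<lambda>z. z * cot z) has_real_derivative y) (at z) \<and> y < 0" by blast
qed

text \<open>x times the derivative is \<alpha> (\<alpha> x cot (\<alpha> x) - x cot x) plus the same
  term with 1 - \<alpha> for \<alpha>; both are positive because x cot x is decreasing on (0,
  pi).\<close>

lemma ln_kanter_strict_mono:
  assumes \<alpha>: "0 < \<alpha>" "\<alpha> < 1" and uv: "0 < u" "u < v" "v < pi"
  shows "ln_kanter \<alpha> u < ln_kanter \<alpha> v"
proof (rule DERIV_pos_imp_increasing[OF uv(2)])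
  fix x assume x: "u \<le> x" "x \<le> v"
  have x': "0 < x" "x < pi" using x uv by auto
  note s = kanter_sin_pos[OF \<alpha> x']
  define g where "g = \<alpha> * (\<alpha> * cot (\<alpha> * x) - cot x) + (1 - \<alpha>) * ((1 - \<alpha>) * cot ((1 - \<alpha>) * x) - cot x)"
  have 1: "((\<lambda>x. ln (sin (a * x) / sin x)) has_real_derivative (a * cot (a * x) - cot x)) (at x)"
    if "sin (a * x) > 0" for a
    using s that by (auto intro!: derivative_eq_intros simp: cot_def field_simps)
  have "(ln_kanter \<alpha> has_real_derivative g) (at x)"
    unfolding ln_kanter_def[abs_def] g_def by (intro DERIV_add DERIV_cmult 1 s)
  moreover have "g > 0"
  proof -
    have "\<alpha> * x < 1 * x" "(1 - \<alpha>) * x < 1 * x" using \<alpha> x' by (intro mult_strict_right_mono; simp)+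
    then have "x * cot x < \<alpha> * x * cot (\<alpha> * x)" "x * cot x < (1 - \<alpha>) * x * cot ((1 - \<alpha>) * x)"
      using \<alpha> x' by (intro x_cot_x_antimono; simp)+
    then have "\<alpha> * (x * cot x) < \<alpha> * (\<alpha> * x * cot (\<alpha> * x))"
        "(1 - \<alpha>) * (x * cot x) < (1 - \<alpha>) * ((1 - \<alpha>) * x * cot ((1 - \<alpha>) * x))"
      using \<alpha> by (intro mult_strict_left_mono; simp)+
    then have "0 < x * g" by (simp add: g_def algebra_simps)
    then show ?thesis using x' by (simp add: zero_less_mult_iff)
  qed
  ultimately show "\<exists>y. (ln_kanter \<alpha> has_real_derivative y) (at x) \<and> y > 0" by blast
qed

lemma tendsto_ln_kanter_0:
  assumes \<alpha>: "0 < \<alpha>" "\<alpha> < 1"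
  shows "(ln_kanter \<alpha> \<longlongrightarrow> ln_b0 \<alpha>) (at_right 0)"
  unfolding ln_kanter_def[abs_def] ln_b0_def using \<alpha>
  by (intro tendsto_intros tendsto_ln tendsto_sin_ratio_0) auto

text \<open>The limit at 0 yields a weak inequality at u / 2, and monotonicity from u / 2 to u makes
  it strict.\<close>

lemma ln_b0_less_ln_kanter:
  assumes \<alpha>: "0 < \<alpha>" "\<alpha> < 1" and u: "0 < u" "u < pi"
  shows "ln_b0 \<alpha> < ln_kanter \<alpha> u"
proof -
  have "ln_b0 \<alpha> \<le> ln_kanter \<alpha> (u / 2)"
  proof (rule tendsto_upperbound[OF tendsto_ln_kanter_0[OF \<alpha>]])
    show "\<forall>\<^sub>F v in at_right 0. ln_kanter \<alpha> v \<le> ln_kanter \<alpha> (u / 2)"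
      unfolding eventually_at_right_field using u
      by (intro exI[of _ "u / 2"]) (auto intro!: less_imp_le ln_kanter_strict_mono[OF \<alpha>])
  qed simp
  also have "\<dots> < ln_kanter \<alpha> u" by (rule ln_kanter_strict_mono[OF \<alpha>]) (use u in auto)
  finally show ?thesis .
qed

lemma kanter_b_eq_exp:
  assumes \<alpha>: "0 < \<alpha>" "\<alpha> < 1" and u: "0 < u" "u < pi"
  shows "kanter_b \<alpha> u = exp (ln_kanter \<alpha> u)"
  using kanter_sin_pos[OF \<alpha> u]
  by (simp add: kanter_b_def kanter_c_def powr_def ln_kanter_def exp_add)

lemma kanter_a_eq_exp:
  assumes \<alpha>: "0 < \<alpha>" "\<alpha> < 1" and u: "0 < u" "u < pi"
  shows "kanter_a \<alpha> u = exp (ln_kanter \<alpha> u / (1 - \<alpha>))"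
  by (simp add: kanter_a_def kanter_b_eq_exp[OF assms] powr_def)

lemma kanter_a0_eq_exp:
  assumes \<alpha>: "0 < \<alpha>" "\<alpha> < 1"
  shows "(1 - \<alpha>) * \<alpha> powr (\<alpha> / (1 - \<alpha>)) = exp (ln_b0 \<alpha> / (1 - \<alpha>))"
proof -
  have "ln_b0 \<alpha> / (1 - \<alpha>) = ln (1 - \<alpha>) + \<alpha> / (1 - \<alpha>) * ln \<alpha>"
    using \<alpha> by (simp add: ln_b0_def field_simps)
  then show ?thesis using \<alpha> by (simp add: exp_add powr_def)
qed

subsection \<open>Inversion of the Mellin transform\<close>

lemma contour_integral_linepath_kanter:
  assumes "closed_segment s0 s1 \<subseteq> left_slit 1"
  shows "contour_integral (linepath s0 s1) (\<lambda>s. kanter_mellin \<alpha> s * exp (of_real x * s))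
    = kanter_primitive \<alpha> x s1 - kanter_primitive \<alpha> x s0"
proof -
  have "((\<lambda>s. kanter_mellin \<alpha> s * exp (of_real x * s)) has_contour_integral
      (kanter_primitive \<alpha> x (pathfinish (linepath s0 s1)) - kanter_primitive \<alpha> x (pathstart (linepath s0 s1)))) (linepath s0 s1)"
    by (rule contour_integral_primitive[where S = "left_slit 1"])
       (use assms in \<open>auto intro: has_field_derivative_at_within[OF kanter_primitive_derivative]\<close>)
  then show ?thesis by (simp add: contour_integral_unique)
qed

lemma contour_integral_linepath_eq_integral:
  "contour_integral (linepath s0 s1) g = integral {0..1} (\<lambda>r. g (linepath s0 s1 r) * (s1 - s0))"
  by (simp add: contour_integral_integral)

lemma continuous_on_linepath_compose [continuous_intros]:
  "continuous_on A g \<Longrightarrow> continuous_on A (\<lambda>x. linepath a b (g x))"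
  unfolding linepath_def by (intro continuous_intros)

lemma continuous_on_kanter_mellin_linepath:
  assumes "closed_segment s0 s1 \<subseteq> left_slit 1"
  shows "continuous_on {0..1} (\<lambda>r. kanter_mellin \<alpha> (linepath s0 s1 r))"
proof (rule continuous_on_compose2[of "left_slit 1" "kanter_mellin \<alpha>"])
  show "continuous_on (left_slit 1) (kanter_mellin \<alpha>)"
    by (rule holomorphic_on_imp_continuous_on[OF holomorphic_kanter_mellin_left_slit])
  show "linepath s0 s1 ` {0..1} \<subseteq> left_slit 1"
    using assms by (simp add: linepath_image_01)
qed (intro continuous_intros)

lemma continuous_on_kanter_primitive:
  assumes "s \<in> left_slit 1"
  shows "continuous_on A (\<lambda>x. kanter_primitive \<alpha> x s)"
proof -
  have seg: "closed_segment 0 s \<subseteq> left_slit 1" by (rule closed_segment_0_left_slit) (use assms in auto)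
  have "continuous_on UNIV (\<lambda>x. integral (cbox 0 1) (\<lambda>r. kanter_mellin \<alpha> (linepath 0 s r) * exp (of_real x * linepath 0 s r) * (s - 0)))"
  proof (rule integral_continuous_on_param)
    show "continuous_on (UNIV \<times> cbox 0 1) (\<lambda>(x, r). kanter_mellin \<alpha> (linepath 0 s r) * exp (of_real x * linepath 0 s r) * (s - 0))"
      unfolding case_prod_beta
      by (intro continuous_intros continuous_on_compose2[OF continuous_on_kanter_mellin_linepath[OF seg]]) auto
  qed
  then have "continuous_on UNIV (\<lambda>x. kanter_primitive \<alpha> x s)"
    by (simp add: kanter_primitive_def contour_integral_linepath_eq_integral)
  then show ?thesis by (rule continuous_on_subset) auto
qed

text \<open>At s = - \<i> t this is the kernel of Levy's inversion formula. Written as an integral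
  it is continuous at s = 0, where the quotient form has a removable singularity.\<close>

definition exp_integral :: "real \<Rightarrow> real \<Rightarrow> complex \<Rightarrow> complex" where
  "exp_integral a b s = integral {a..b} (\<lambda>x. exp (of_real x * s))"

lemma exp_integral_eq:
  assumes "a \<le> b" "s \<noteq> 0"
  shows "exp_integral a b s = (exp (of_real b * s) - exp (of_real a * s)) / s"
proof -
  have "((\<lambda>x. exp (of_real x * s)) has_integral (exp (of_real b * s) / s - exp (of_real a * s) / s)) {a..b}"
  proof (rule fundamental_theorem_of_calculus[OF assms(1)])
    fix x
    have "((\<lambda>x. exp (x * s) / s) has_field_derivative exp (of_real x * s)) (at (of_real x))"
      using assms(2) by (auto intro!: derivative_eq_intros)
    then show "((\<lambda>x. exp (of_real x * s) / s) has_vector_derivative exp (of_real x * s)) (at x within {a..b})"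
      by (rule has_vector_derivative_at_within[OF has_vector_derivative_real_field])
  qed
  then show ?thesis by (simp add: exp_integral_def integral_unique diff_divide_distrib)
qed

lemma continuous_on_exp_integral: "continuous_on A (exp_integral a b)"
proof -
  have "continuous_on UNIV (\<lambda>s::complex. integral (cbox a b) (\<lambda>x. exp (of_real x * s)))"
    by (rule integral_continuous_on_param) (auto simp: case_prod_beta intro!: continuous_intros)
  then show ?thesis by (auto simp: exp_integral_def[abs_def] intro: continuous_on_subset)
qed

text \<open>Fubini on a compact rectangle; it converts integrals of the primitive over x into
  contour integrals containing Levy's kernel.\<close>

lemma integral_kanter_primitive_increment:
  assumes seg: "closed_segment s0 s1 \<subseteq> left_slit 1"
  shows "integral {a..b} (\<lambda>x. kanter_primitive \<alpha> x s1 - kanter_primitive \<alpha> x s0)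
    = contour_integral (linepath s0 s1) (\<lambda>s. kanter_mellin \<alpha> s * exp_integral a b s)"
proof -
  let ?f = "\<lambda>x r. kanter_mellin \<alpha> (linepath s0 s1 r) * exp (of_real x * linepath s0 s1 r) * (s1 - s0)"
  have "integral {a..b} (\<lambda>x. kanter_primitive \<alpha> x s1 - kanter_primitive \<alpha> x s0)
      = integral (cbox a b) (\<lambda>x. integral (cbox 0 1) (?f x))"
    by (simp add: contour_integral_linepath_kanter[OF seg, symmetric] contour_integral_linepath_eq_integral)
  also have "\<dots> = integral (cbox 0 1) (\<lambda>r. integral (cbox a b) (\<lambda>x. ?f x r))"
    by (rule integral_swap_continuous)
       (auto simp: case_prod_beta intro!: continuous_intros
          continuous_on_compose2[OF continuous_on_kanter_mellin_linepath[OF seg]])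
  also have "\<dots> = integral {0..1} (\<lambda>r. kanter_mellin \<alpha> (linepath s0 s1 r) * exp_integral a b (linepath s0 s1 r) * (s1 - s0))"
    by (simp add: exp_integral_def)
  also have "\<dots> = contour_integral (linepath s0 s1) (\<lambda>s. kanter_mellin \<alpha> s * exp_integral a b s)"
    by (simp add: contour_integral_linepath_eq_integral)
  finally show ?thesis .
qed

lemma kanter_mellin_bound_nonneg:
  assumes "0 < \<alpha>" "\<alpha> < 1" "0 < \<eta>"
  shows "kanter_mellin_bound \<alpha> \<eta> \<ge> 0"
  using assms by (simp add: kanter_mellin_bound_def)

text \<open>Integrating over \<open>x\<close> gains the factor \<open>1 / s\<close> of \<open>exp_integral a b s\<close>; without it the bound
  on the integrand would not tend to \<open>0\<close> with growing height \<open>T\<close>.\<close>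

lemma norm_integral_kanter_primitive_horizontal:
  assumes \<alpha>: "0 < \<alpha>" "\<alpha> < 1" and ab: "ln_b0 \<alpha> < a" "a \<le> b" and T: "T \<ge> 1" and R: "R \<ge> 0"
  shows "norm (integral {a..b} (\<lambda>x. kanter_primitive \<alpha> x (Complex (-R) T) - kanter_primitive \<alpha> x (Complex 0 T)))
    \<le> 2 * kanter_mellin_bound \<alpha> 1 / T / (a - ln_b0 \<alpha>)"
proof -
  let ?g = "\<lambda>s. kanter_mellin \<alpha> s * ((exp (of_real b * s) - exp (of_real a * s)) / s)"
  have "?g holomorphic_on {s. Im s > 0}"
    by (intro holomorphic_intros holomorphic_on_subset[OF holomorphic_kanter_mellin_left_slit])
       (auto simp: left_slit_def)
  then obtain P where P0: "\<And>s. s \<in> {s. Im s > 0} \<Longrightarrow> (P has_field_derivative ?g s) (at s within {s. Im s > 0})"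
    using holomorphic_convex_primitive'[OF convex_halfspace_Im_gt open_halfspace_Im_gt] by blast
  have P: "(P has_field_derivative ?g s) (at s)" if "Im s > 0" for s
    using P0[of s] that at_within_open[OF _ open_halfspace_Im_gt, of s 0] by simp
  have bound: "norm (?g s) \<le> 2 * kanter_mellin_bound \<alpha> 1 / T * exp ((a - ln_b0 \<alpha>) * Re s)"
    if s: "Re s \<le> 0" "Im s = T" for s
  proof -
    have ns: "norm s \<ge> T" using abs_Im_le_cmod[of s] s T by simp
    \<comment> \<open>As Re s \<le> 0, the slowest decay over x \<ge> a occurs at x = a, so one
      bound covers both end points.\<close>
    have 1: "norm (kanter_mellin \<alpha> s * exp (of_real x * s)) \<le> kanter_mellin_bound \<alpha> 1 * exp ((a - ln_b0 \<alpha>) * Re s)"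
      if "a \<le> x" for x
    proof -
      have "norm (kanter_mellin \<alpha> s * exp (of_real x * s)) \<le> kanter_mellin_bound \<alpha> 1 * exp ((x - ln_b0 \<alpha>) * Re s)"
        by (rule norm_kanter_mellin_exp_le) (use \<alpha> s T ns in auto)
      also have "\<dots> \<le> kanter_mellin_bound \<alpha> 1 * exp ((a - ln_b0 \<alpha>) * Re s)"
      proof (rule mult_left_mono)
        show "kanter_mellin_bound \<alpha> 1 \<ge> 0" using \<alpha> by (auto simp: kanter_mellin_bound_def)
        show "exp ((x - ln_b0 \<alpha>) * Re s) \<le> exp ((a - ln_b0 \<alpha>) * Re s)"
          using that s by (simp add: mult_right_mono_neg)
      qed
      finally show ?thesis .
    qed
    have "?g s = (kanter_mellin \<alpha> s * exp (of_real b * s) - kanter_mellin \<alpha> s * exp (of_real a * s)) / s"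
      by (simp add: right_diff_distrib)
    also have "norm \<dots> \<le> (kanter_mellin_bound \<alpha> 1 * exp ((a - ln_b0 \<alpha>) * Re s) + kanter_mellin_bound \<alpha> 1 * exp ((a - ln_b0 \<alpha>) * Re s)) / T"
      unfolding norm_divide using 1[of a] 1[of b] ab T ns kanter_mellin_bound_nonneg[OF \<alpha>, of 1]
      by (intro frac_le order_trans[OF norm_triangle_ineq4] add_mono) auto
    finally show ?thesis by simp
  qed
  have "norm (P (Complex (-R) T) - P (Complex (-0) T)) \<le> 2 * kanter_mellin_bound \<alpha> 1 / T / (a - ln_b0 \<alpha>) * exp (- (a - ln_b0 \<alpha>) * 0)"
    by (rule exp_decay_primitive_horizontal[OF P bound]) (use ab R T in auto)
  moreover have "integral {a..b} (\<lambda>x. kanter_primitive \<alpha> x (Complex (-R) T) - kanter_primitive \<alpha> x (Complex 0 T))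
     = P (Complex (-R) T) - P (Complex 0 T)"
  proof -
    have seg: "closed_segment (Complex 0 T) (Complex (-R) T) \<subseteq> {s. Im s > 0}"
      by (rule closed_segment_subset) (use T in \<open>auto intro: convex_halfspace_Im_gt\<close>)
    have "(?g has_contour_integral (P (pathfinish (linepath (Complex 0 T) (Complex (-R) T))) - P (pathstart (linepath (Complex 0 T) (Complex (-R) T)))))
        (linepath (Complex 0 T) (Complex (-R) T))"
      by (rule contour_integral_primitive[OF P0]) (use seg in auto)
    then have "(?g has_contour_integral (P (Complex (-R) T) - P (Complex 0 T))) (linepath (Complex 0 T) (Complex (-R) T))"
      by simp
    then have "((\<lambda>s. kanter_mellin \<alpha> s * exp_integral a b s) has_contour_integral (P (Complex (-R) T) - P (Complex 0 T))) (linepath (Complex 0 T) (Complex (-R) T))"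
    proof (rule has_contour_integral_eq)
      fix z assume "z \<in> path_image (linepath (Complex 0 T) (Complex (-R) T))"
      then have "z \<noteq> 0" using seg by auto
      then show "?g z = kanter_mellin \<alpha> z * exp_integral a b z"
        using ab by (simp add: exp_integral_eq)
    qed
    moreover have "closed_segment (Complex 0 T) (Complex (-R) T) \<subseteq> left_slit 1"
      using seg by (auto simp: left_slit_def)
    ultimately show ?thesis
      using integral_kanter_primitive_increment contour_integral_unique by metis
  qed
  ultimately show ?thesis by simp
qed

text \<open>The decay rate is at least a - \<open>ln_b0 \<alpha>\<close> > 0 for all x \<ge> a,
  which gives uniformity. From it come the continuity of the limit and the exchange of limit and
  integral.\<close>

lemma uniform_limit_kanter_primitive:
  assumes \<alpha>: "0 < \<alpha>" "\<alpha> < 1" and ab: "ln_b0 \<alpha> < a" and T: "T \<ge> 1"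
  shows "uniform_limit {a..b} (\<lambda>n x. kanter_primitive \<alpha> x (Complex (- real n) T)) (kanter_limit \<alpha>) sequentially"
proof (rule uniform_limitI)
  fix e :: real assume "e > 0"
  let ?K = "kanter_mellin_bound \<alpha> 1" and ?\<delta> = "a - ln_b0 \<alpha>"
  have "(\<lambda>n. ?K * (1 / ?\<delta> + \<bar>T - 1\<bar>) * exp (- ?\<delta> * real n)) \<longlonglongrightarrow> 0"
  proof -
    have "filterlim (\<lambda>n. - ?\<delta> * real n) at_bot sequentially"
      using ab by (intro filterlim_tendsto_neg_mult_at_bot[OF tendsto_const _ filterlim_real_sequentially]) auto
    then have "(\<lambda>n. exp (- ?\<delta> * real n)) \<longlonglongrightarrow> 0" by (rule filterlim_compose[OF exp_at_bot])
    from tendsto_mult_left[OF this, of "?K * (1 / ?\<delta> + \<bar>T - 1\<bar>)"] show ?thesis by simp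
  qed
  then have "\<forall>\<^sub>F n in sequentially. ?K * (1 / ?\<delta> + \<bar>T - 1\<bar>) * exp (- ?\<delta> * real n) < e"
    using \<open>e > 0\<close> by (rule order_tendstoD)
  then show "\<forall>\<^sub>F n in sequentially. \<forall>x\<in>{a..b}. dist (kanter_primitive \<alpha> x (Complex (- real n) T)) (kanter_limit \<alpha> x) < e"
    using eventually_ge_at_top[of 1]
  proof eventually_elim
    case (elim n)
    show ?case
    proof
      fix x assume x: "x \<in> {a..b}"
      have "dist (kanter_primitive \<alpha> x (Complex (- real n) T)) (kanter_limit \<alpha> x)
        \<le> ?K * (1 / (x - ln_b0 \<alpha>) + \<bar>Im (Complex (- real n) T) - 1\<bar>) * exp ((x - ln_b0 \<alpha>) * Re (Complex (- real n) T))"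
        unfolding dist_norm by (rule kanter_primitive_limit) (use \<alpha> ab x T elim in auto)
      also have "\<dots> \<le> ?K * (1 / ?\<delta> + \<bar>T - 1\<bar>) * exp (- ?\<delta> * real n)"
      proof (intro mult_mono)
        show "0 \<le> ?K" using \<alpha> by (auto simp: kanter_mellin_bound_def)
        show "1 / (x - ln_b0 \<alpha>) + \<bar>Im (Complex (- real n) T) - 1\<bar> \<le> 1 / ?\<delta> + \<bar>T - 1\<bar>"
          using ab x by (auto intro!: frac_le)
        show "exp ((x - ln_b0 \<alpha>) * Re (Complex (- real n) T)) \<le> exp (- ?\<delta> * real n)"
          using x by (simp add: mult_right_mono flip: mult_minus_left)
      qed (use ab x \<alpha> in \<open>auto simp: kanter_mellin_bound_def\<close>)
      also have "\<dots> < e" by (rule elim(1))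
      finally show "dist (kanter_primitive \<alpha> x (Complex (- real n) T)) (kanter_limit \<alpha> x) < e" .
    qed
  qed
qed

lemma Complex_in_left_slit: "T \<noteq> 0 \<Longrightarrow> Complex r T \<in> left_slit d"
  by (simp add: left_slit_def)

lemma continuous_on_kanter_limit:
  assumes \<alpha>: "0 < \<alpha>" "\<alpha> < 1" and ab: "ln_b0 \<alpha> < a"
  shows "continuous_on {a..b} (kanter_limit \<alpha>)"
proof (rule uniform_limit_theorem[OF _ uniform_limit_kanter_primitive[OF assms order_refl]])
  show "\<forall>\<^sub>F n in sequentially. continuous_on {a..b} (\<lambda>x. kanter_primitive \<alpha> x (Complex (- real n) 1))"
    by (intro always_eventually allI continuous_on_kanter_primitive Complex_in_left_slit) simp
qed simp

lemma continuous_on_kanter_dens: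
  assumes \<alpha>: "0 < \<alpha>" "\<alpha> < 1" and ab: "ln_b0 \<alpha> < a"
  shows "continuous_on {a..b} (kanter_dens \<alpha>)"
  unfolding kanter_dens_def[abs_def] by (intro continuous_intros continuous_on_kanter_limit assms) auto

text \<open>This is the contour shift at height T: the horizontal ray from \<i> T to the left
  contributes only O(1 / T) after integration over x.\<close>

lemma norm_integral_kanter_limit_diff:
  assumes \<alpha>: "0 < \<alpha>" "\<alpha> < 1" and ab: "ln_b0 \<alpha> < a" "a \<le> b" and T: "T \<ge> 1"
  shows "norm (integral {a..b} (kanter_limit \<alpha>) - integral {a..b} (\<lambda>x. kanter_primitive \<alpha> x (Complex 0 T)))
    \<le> 2 * kanter_mellin_bound \<alpha> 1 / T / (a - ln_b0 \<alpha>)"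
proof (rule tendsto_upperbound)
  let ?F = "\<lambda>s x. kanter_primitive \<alpha> x s"
  have cont: "continuous_on {a..b} (?F (Complex r T))" for r
    by (rule continuous_on_kanter_primitive) (use T in \<open>auto intro: Complex_in_left_slit\<close>)
  obtain I J where IJ: "\<And>n. (?F (Complex (- real n) T) has_integral I n) (cbox a b)"
     "(kanter_limit \<alpha> has_integral J) (cbox a b)" "I \<longlonglongrightarrow> J"
    using uniform_limit_integral_cbox[OF uniform_limit_kanter_primitive[OF \<alpha> ab(1) T, of b, folded cbox_interval] cont[folded cbox_interval] trivial_limit_sequentially]
    by blast
  note IJ = IJ[unfolded cbox_interval]
  have "integral {a..b} (?F (Complex (- real n) T)) = I n" for n by (rule integral_unique[OF IJ(1)])
  with IJ(3) have "(\<lambda>n. integral {a..b} (?F (Complex (- real n) T))) \<longlonglongrightarrow> integral {a..b} (kanter_limit \<alpha>)"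
    unfolding integral_unique[OF IJ(2)] by (simp only:)
  then show "(\<lambda>n. norm (integral {a..b} (?F (Complex (- real n) T)) - integral {a..b} (?F (Complex 0 T))))
      \<longlonglongrightarrow> norm (integral {a..b} (kanter_limit \<alpha>) - integral {a..b} (?F (Complex 0 T)))"
    by (intro tendsto_intros)
  show "\<forall>\<^sub>F n in sequentially. norm (integral {a..b} (?F (Complex (- real n) T)) - integral {a..b} (?F (Complex 0 T)))
      \<le> 2 * kanter_mellin_bound \<alpha> 1 / T / (a - ln_b0 \<alpha>)"
  proof (intro always_eventually allI)
    fix n
    have "integral {a..b} (?F (Complex (- real n) T)) - integral {a..b} (?F (Complex 0 T))
       = integral {a..b} (\<lambda>x. kanter_primitive \<alpha> x (Complex (- real n) T) - kanter_primitive \<alpha> x (Complex 0 T))"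
      by (rule Henstock_Kurzweil_Integration.integral_diff[symmetric]) (use cont in \<open>auto intro: integrable_continuous_interval\<close>)
    then show "norm (integral {a..b} (?F (Complex (- real n) T)) - integral {a..b} (?F (Complex 0 T)))
      \<le> 2 * kanter_mellin_bound \<alpha> 1 / T / (a - ln_b0 \<alpha>)"
      using norm_integral_kanter_primitive_horizontal[OF \<alpha> ab T, of "real n"] by simp
  qed
qed simp

lemma tendsto_integral_kanter_primitive_vertical:
  assumes \<alpha>: "0 < \<alpha>" "\<alpha> < 1" and ab: "ln_b0 \<alpha> < a" "a \<le> b"
  shows "(\<lambda>n. integral {a..b} (\<lambda>x. kanter_primitive \<alpha> x (Complex 0 (real n)) - kanter_primitive \<alpha> x (Complex 0 (- real n))))
    \<longlonglongrightarrow> 2 * of_real pi * \<i> * of_real (integral {a..b} (kanter_dens \<alpha>))"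
proof -
  let ?I = "integral {a..b} (kanter_limit \<alpha>)" and ?J = "\<lambda>n. integral {a..b} (\<lambda>x. kanter_primitive \<alpha> x (Complex 0 (real n)))"
  have "(\<lambda>n. ?J n - ?I) \<longlonglongrightarrow> 0"
  proof (rule Lim_null_comparison)
    show "\<forall>\<^sub>F n in sequentially. norm (?J n - ?I) \<le> 2 * kanter_mellin_bound \<alpha> 1 / real n / (a - ln_b0 \<alpha>)"
      using eventually_ge_at_top[of 1]
      by eventually_elim (use norm_integral_kanter_limit_diff[OF \<alpha> ab] in \<open>auto simp: norm_minus_commute\<close>)
    show "(\<lambda>n. 2 * kanter_mellin_bound \<alpha> 1 / real n / (a - ln_b0 \<alpha>)) \<longlonglongrightarrow> 0"
      by (intro tendsto_divide_zero lim_const_over_n)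
  qed
  then have J: "?J \<longlonglongrightarrow> ?I" by (simp add: Lim_null[symmetric])
  have int: "(\<lambda>x. kanter_primitive \<alpha> x (Complex 0 y)) integrable_on {a..b}" for y
    by (intro integrable_continuous_interval continuous_on_kanter_primitive) (auto simp: left_slit_def)
  have eq: "integral {a..b} (\<lambda>x. kanter_primitive \<alpha> x (Complex 0 (real n)) - kanter_primitive \<alpha> x (Complex 0 (- real n)))
      = ?J n - cnj (?J n)" for n
  proof -
    have "Complex 0 (- real n) = cnj (Complex 0 (real n))" by (simp add: complex_eq_iff)
    then have "kanter_primitive \<alpha> x (Complex 0 (- real n)) = cnj (kanter_primitive \<alpha> x (Complex 0 (real n)))" for x
      by (simp only: kanter_primitive_cnj)
    then show ?thesis
      using int by (simp add: Henstock_Kurzweil_Integration.integral_diff integrable_on_cnj_iff integral_cnj)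
  qed
  have "(\<lambda>n. ?J n - cnj (?J n)) \<longlonglongrightarrow> ?I - cnj ?I" by (intro tendsto_diff tendsto_cnj J)
  also have "?I - cnj ?I = 2 * of_real pi * \<i> * of_real (integral {a..b} (kanter_dens \<alpha>))"
  proof -
    have "kanter_limit \<alpha> integrable_on {a..b}"
      by (intro integrable_continuous_interval continuous_on_kanter_limit \<alpha> ab)
    then have "Im ?I = integral {a..b} (\<lambda>x. Im (kanter_limit \<alpha> x))"
      using integral_linear[OF _ bounded_linear_Im, of "kanter_limit \<alpha>" "{a..b}"] by (simp add: o_def)
    also have "\<dots> = integral {a..b} (\<lambda>x. pi * kanter_dens \<alpha> x)" by (simp add: kanter_dens_def)
    finally have "Im ?I = pi * integral {a..b} (kanter_dens \<alpha>)" by simp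
    then show ?thesis by (simp add: complex_eq_iff)
  qed
  finally show ?thesis unfolding eq .
qed

text \<open>The substitution s = - \<i> t carries [-T, T] to the segment between -\<i> T and \<i> T,
  where the integral is an increment of \<open>kanter_primitive\<close> integrated over x.\<close>

lemma integral_Levy_kernel:
  assumes ab: "a \<le> b" and T: "T > 0"
  shows "(CLBINT t=-T..T. (iexp (-(t * a)) - iexp (-(t * b))) / (\<i> * t) * kanter_mellin \<alpha> (- (\<i> * t)))
    = integral {a..b} (\<lambda>x. kanter_primitive \<alpha> x (Complex 0 T) - kanter_primitive \<alpha> x (Complex 0 (- T))) / \<i>"
proof -
  define G where "G = (\<lambda>t::real. kanter_mellin \<alpha> (- (\<i> * t)) * exp_integral a b (- (\<i> * t)))"
  have contk: "continuous_on UNIV (\<lambda>t::real. kanter_mellin \<alpha> (- (\<i> * t)))"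
  proof (rule continuous_on_compose2[of "left_slit 1" "kanter_mellin \<alpha>"])
    show "continuous_on (left_slit 1) (kanter_mellin \<alpha>)"
      by (rule holomorphic_on_imp_continuous_on[OF holomorphic_kanter_mellin_left_slit])
  qed (auto simp: left_slit_def intro!: continuous_intros)
  have contG: "continuous_on A G" for A
  proof -
    have "continuous_on UNIV G"
      unfolding G_def
      by (intro continuous_intros contk continuous_on_compose2[OF continuous_on_exp_integral[of UNIV]]) auto
    then show ?thesis by (rule continuous_on_subset) auto
  qed
  have [measurable]: "G \<in> borel_measurable borel" "(\<lambda>t::real. kanter_mellin \<alpha> (- (\<i> * t))) \<in> borel_measurable borel"
    using contG contk by (auto intro: borel_measurable_continuous_onI)
  have "(CLBINT t=-T..T. (iexp (-(t * a)) - iexp (-(t * b))) / (\<i> * t) * kanter_mellin \<alpha> (- (\<i> * t))) = (CLBINT t=-T..T. G t)"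
  \<comment> \<open>The integrands may differ at t = 0, where the quotient is 0 by convention and
    \<open>exp_integral\<close> is b - a; a single point is negligible.\<close>
  proof (rule interval_integral_cong_AE)
    have eq: "(iexp (-(t * a)) - iexp (-(t * b))) / (\<i> * t) * kanter_mellin \<alpha> (- (\<i> * t)) = G t" if "t \<noteq> 0" for t
    proof -
      have "(iexp (-(t * a)) - iexp (-(t * b))) / (\<i> * t) = exp_integral a b (- (\<i> * t))"
        using that ab by (subst exp_integral_eq) (auto simp: field_simps)
      then show ?thesis by (simp add: G_def)
    qed
    show "AE t\<in>einterval (min (ereal (-T)) (ereal T)) (max (ereal (-T)) (ereal T)) in lborel.
        (iexp (-(t * a)) - iexp (-(t * b))) / (\<i> * t) * kanter_mellin \<alpha> (- (\<i> * t)) = G t"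
      using AE_lborel_singleton[of 0] by eventually_elim (use eq in blast)
  qed measurable
  also have "\<dots> = integral {-T..T} G"
    using T by (intro interval_integral_eq_integral borel_integrable_atLeastAtMost' contG) auto
  finally have 1: "(CLBINT t=-T..T. (iexp (-(t * a)) - iexp (-(t * b))) / (\<i> * t) * kanter_mellin \<alpha> (- (\<i> * t))) = integral {-T..T} G" .
  have "(G has_integral integral {-T..T} G) (cbox (-T) T)"
    using integrable_continuous_interval[OF contG[of "{-T..T}"]] by (simp add: integrable_integral)
  \<comment> \<open>The parametrisation t = T - 2 T r runs the segment from -\<i> T up to \<i> T as
    r goes from 0 to 1.\<close>
  from has_integral_affinity[OF this, of "- (2 * T)" T]
  have "((\<lambda>r. G (- (2 * T) *\<^sub>R r + T)) has_integral (1 / (2 * T)) *\<^sub>R integral {-T..T} G)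
     ((\<lambda>x. (1 / (- (2 * T))) *\<^sub>R x + - ((1 / (- (2 * T))) *\<^sub>R T)) ` cbox (-T) T)"
    using T by simp
  also have "(\<lambda>x. (1 / (- (2 * T))) *\<^sub>R x + - ((1 / (- (2 * T))) *\<^sub>R T)) ` cbox (-T) T = {0..1}"
    using T unfolding real_scaleR_def cbox_interval by (subst image_affinity_atLeastAtMost) (auto simp: field_simps)
  finally have 2: "integral {0..1} (\<lambda>r. G (- (2 * T) *\<^sub>R r + T)) = (1 / (2 * T)) *\<^sub>R integral {-T..T} G"
    by (rule integral_unique)
  have seg: "closed_segment (Complex 0 (- T)) (Complex 0 T) \<subseteq> left_slit 1"
    by (auto simp: closed_segment_def left_slit_def)
  have lin: "linepath (Complex 0 (- T)) (Complex 0 T) r = - (\<i> * of_real (- (2 * T) *\<^sub>R r + T))" for r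
    by (simp add: linepath_def complex_eq_iff algebra_simps)
  have "integral {a..b} (\<lambda>x. kanter_primitive \<alpha> x (Complex 0 T) - kanter_primitive \<alpha> x (Complex 0 (- T)))
     = integral {0..1} (\<lambda>r. G (- (2 * T) *\<^sub>R r + T) * (Complex 0 T - Complex 0 (- T)))"
    unfolding integral_kanter_primitive_increment[OF seg] contour_integral_linepath_eq_integral lin G_def ..
  also have "\<dots> = integral {0..1} (\<lambda>r. G (- (2 * T) *\<^sub>R r + T)) * (Complex 0 T - Complex 0 (- T))"
    by (rule integral_mult_left)
  also have "\<dots> = \<i> * integral {-T..T} G"
    unfolding 2 using T by (simp add: scaleR_conv_of_real Complex_eq)
  finally have 3: "integral {a..b} (\<lambda>x. kanter_primitive \<alpha> x (Complex 0 T) - kanter_primitive \<alpha> x (Complex 0 (- T)))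
     = \<i> * integral {-T..T} G" .
  show ?thesis
    unfolding uminus_ereal.simps 1[unfolded uminus_ereal.simps] 3
    by (rule nonzero_mult_div_cancel_left[symmetric]) simp
qed

text \<open>Levy's formula truncates symmetrically at \<plusminus>n, which corresponds to the
  difference of primitives at \<i> n and -\<i> n; the contour shift identifies its limit.\<close>

lemma (in real_distribution) kanter_mellin_inversion:
  assumes \<alpha>: "0 < \<alpha>" "\<alpha> < 1" and ab: "ln_b0 \<alpha> < a" "a \<le> b"
    and char: "\<And>t. char M t = kanter_mellin \<alpha> (- (\<i> * of_real t))"
    and atoms: "measure M {a} = 0" "measure M {b} = 0"
  shows "measure M {a<..b} = integral {a..b} (kanter_dens \<alpha>)"
proof -
  let ?I = "\<lambda>n. integral {a..b} (\<lambda>x. kanter_primitive \<alpha> x (Complex 0 (real n)) - kanter_primitive \<alpha> x (Complex 0 (- real n)))"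
  let ?L = "\<lambda>n::nat. 1 / (2 * pi) * (CLBINT t=- real n..real n. (iexp (-(t * a)) - iexp (-(t * b))) / (\<i> * t) * char M t)"
  have 1: "?L \<longlonglongrightarrow> of_real (measure M {a<..b})"
    using Levy_Inversion[OF ab(2) atoms] by simp
  have "\<forall>\<^sub>F n in sequentially. ?L n = ?I n / (2 * of_real pi * \<i>)"
    using eventually_gt_at_top[of 0]
  proof eventually_elim
    case (elim n)
    then have "(CLBINT t=- real n..real n. (iexp (-(t * a)) - iexp (-(t * b))) / (\<i> * t) * char M t) = ?I n / \<i>"
      unfolding char using integral_Levy_kernel[OF ab(2), of "real n" \<alpha>] by (simp only: of_nat_0_less_iff uminus_ereal.simps)
    then show ?case
      by (simp only: times_divide_times_eq mult_1_left of_real_divide of_real_mult of_real_1 of_real_numeral)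
  qed
  with 1 have "(\<lambda>n. ?I n / (2 * of_real pi * \<i>)) \<longlonglongrightarrow> of_real (measure M {a<..b})"
    by (rule Lim_transform_eventually)
  moreover have "(\<lambda>n. ?I n / (2 * of_real pi * \<i>)) \<longlonglongrightarrow> 2 * of_real pi * \<i> * of_real (integral {a..b} (kanter_dens \<alpha>)) / (2 * of_real pi * \<i>)"
    by (intro tendsto_divide tendsto_const tendsto_integral_kanter_primitive_vertical[OF \<alpha> ab]) auto
  ultimately have "complex_of_real (measure M {a<..b}) = 2 * of_real pi * \<i> * of_real (integral {a..b} (kanter_dens \<alpha>)) / (2 * of_real pi * \<i>)"
    by (rule LIMSEQ_unique)
  also have "\<dots> = complex_of_real (integral {a..b} (kanter_dens \<alpha>))"
    by (rule nonzero_mult_div_cancel_left) simp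
  finally show ?thesis unfolding of_real_eq_iff .
qed

subsection \<open>The density\<close>

lemma isCont_kanter_dens:
  assumes \<alpha>: "0 < \<alpha>" "\<alpha> < 1" and x: "ln_b0 \<alpha> < x"
  shows "isCont (kanter_dens \<alpha>) x"
proof (rule continuous_on_interior)
  show "continuous_on {(ln_b0 \<alpha> + x) / 2..x + 1} (kanter_dens \<alpha>)"
    by (rule continuous_on_kanter_dens[OF \<alpha>]) (use x in simp)
  show "x \<in> interior {(ln_b0 \<alpha> + x) / 2..x + 1}"
    using x by (auto simp: field_simps)
qed

lemma has_real_derivative_integral_kanter_dens:
  assumes \<alpha>: "0 < \<alpha>" "\<alpha> < 1" and x: "ln_b0 \<alpha> < e" "e < x"
  shows "((\<lambda>x. integral {e..x} (kanter_dens \<alpha>)) has_real_derivative kanter_dens \<alpha> x) (at x)"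
proof -
  have "((\<lambda>x. integral {e..x} (kanter_dens \<alpha>)) has_real_derivative kanter_dens \<alpha> x) (at x within {e..x + 1})"
    by (rule integral_has_real_derivative[OF continuous_on_kanter_dens[OF \<alpha> x(1)]]) (use x in auto)
  moreover have "at x within {e..x + 1} = at x"
    by (rule at_within_interior) (use x in auto)
  ultimately show ?thesis by simp
qed

text \<open>The density of ln b(U) carried over by x = (1 - \<alpha>) ln y, with dx = (1 - \<alpha>)
  dy / y.\<close>

definition kanter_a_dens :: "real \<Rightarrow> real \<Rightarrow> real" where
  "kanter_a_dens \<alpha> y = (if y > exp (ln_b0 \<alpha> / (1 - \<alpha>)) then (1 - \<alpha>) * kanter_dens \<alpha> ((1 - \<alpha>) * ln y) / y else 0)"

lemma measurable_kanter_a [measurable]: "kanter_a a \<in> borel_measurable borel"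
  unfolding kanter_a_def[abs_def] kanter_b_def kanter_c_def by measurable

lemma ln_b0_less_mult_ln:
  assumes \<alpha>: "0 < \<alpha>" "\<alpha> < 1" and y: "exp (ln_b0 \<alpha> / (1 - \<alpha>)) < y"
  shows "ln_b0 \<alpha> < (1 - \<alpha>) * ln y"
proof -
  have "y > 0" using y exp_gt_zero less_trans by blast
  then have "ln (exp (ln_b0 \<alpha> / (1 - \<alpha>))) < ln y" using y by (subst ln_less_cancel_iff) auto
  then have "ln_b0 \<alpha> / (1 - \<alpha>) < ln y" by simp
  then show ?thesis using \<alpha> by (simp add: field_simps)
qed

section \<open>The law of Kanter's variable\<close>

context
  fixes \<alpha> :: real and M :: "'a measure" and U :: "'a \<Rightarrow> real"
  assumes \<alpha>: "0 < \<alpha>" "\<alpha> < 1"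
    and M: "prob_space M"
    and U [measurable]: "U \<in> borel_measurable M"
    and unif: "distr M lborel U = uniform_measure lborel {0<..<pi}"
begin

interpretation prob_space M by (rule M)

lemma AE_U: "AE \<omega> in M. 0 < U \<omega> \<and> U \<omega> < pi"
proof (rule AE_distrD[of U M lborel])
  show "AE x in distr M lborel U. 0 < x \<and> x < pi"
    unfolding unif by (rule AE_uniform_measureI) auto
qed simp

lemma AE_kanter_a_eq: "AE \<omega> in M. kanter_a \<alpha> (U \<omega>) = exp (ln_kanter \<alpha> (U \<omega>) / (1 - \<alpha>))"
  using AE_U by eventually_elim (use kanter_a_eq_exp[OF \<alpha>] in auto)

lemma AE_kanter_a_gt: "AE \<omega> in M. kanter_a \<alpha> (U \<omega>) > exp (ln_b0 \<alpha> / (1 - \<alpha>))"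
  using AE_U by eventually_elim
    (use kanter_a_eq_exp[OF \<alpha>] ln_b0_less_ln_kanter[OF \<alpha>] \<alpha> in \<open>auto simp: divide_strict_right_mono\<close>)

abbreviation "ln_kanter_law \<equiv> distr M borel (\<lambda>\<omega>. ln_kanter \<alpha> (U \<omega>))"

lemma real_distribution_ln_kanter_law: "real_distribution ln_kanter_law"
  by (rule real_distribution_distr) measurable

lemma char_ln_kanter_law: "char ln_kanter_law t = kanter_mellin \<alpha> (- (\<i> * of_real t))"
proof -
  have "char ln_kanter_law t = (\<integral>\<omega>. iexp (t * ln_kanter \<alpha> (U \<omega>)) \<partial>M)"
    unfolding char_def by (rule integral_distr) measurable
  also have "\<dots> = (\<integral>u. iexp (t * ln_kanter \<alpha> u) \<partial>distr M lborel U)"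
    by (rule integral_distr[symmetric]) measurable
  also have "\<dots> = (\<integral>u. iexp (t * ln_kanter \<alpha> u) \<partial>density lborel (\<lambda>u. ennreal (indicator {0<..<pi} u / pi)))"
  proof -
    have "uniform_measure lborel {0<..<pi} = density lborel (\<lambda>u. ennreal (indicator {0<..<pi} u / pi))"
      unfolding uniform_measure_def
      by (intro density_cong) (auto simp: divide_ennreal[symmetric] ennreal_indicator split: split_indicator)
    then show ?thesis by (simp only: unif)
  qed
  also have "\<dots> = (\<integral>u. (indicator {0<..<pi} u / pi) *\<^sub>R iexp (t * ln_kanter \<alpha> u) \<partial>lborel)"
    by (rule integral_density) auto
  also have "\<dots> = (\<integral>u. (1 / pi) *\<^sub>R (indicator {0<..<pi} u *\<^sub>R exp (\<i> * of_real t * of_real (ln_kanter \<alpha> u))) \<partial>lborel)"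
    by (intro Bochner_Integration.integral_cong) (auto simp: mult_ac)
  also have "\<dots> = (1 / pi) *\<^sub>R (LBINT u:{0<..<pi}. exp (\<i> * of_real t * of_real (ln_kanter \<alpha> u)))"
    unfolding set_lebesgue_integral_def by (rule integral_scaleR_right)
  also have "\<dots> = kanter_mellin \<alpha> (- (\<i> * of_real t))"
    unfolding kanter_moment_imaginary[OF \<alpha>] by (simp add: scaleR_conv_of_real)
  finally show ?thesis .
qed

text \<open>Strict monotonicity allows at most one u in (0, pi) per level, and a single point is a
  null set. Levy's formula asks for end points that are not atoms.\<close>

lemma measure_ln_kanter_law_singleton: "measure ln_kanter_law {x} = 0"
proof -
  let ?A = "{u \<in> space lborel. ln_kanter \<alpha> u = x}"
  have "measure ln_kanter_law {x} = measure M {\<omega> \<in> space M. ln_kanter \<alpha> (U \<omega>) = x}"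
    by (subst measure_distr) (auto intro!: arg_cong[where f = "measure M"])
  also have "\<dots> = measure (distr M lborel U) ?A"
    by (subst measure_distr) (auto intro!: arg_cong[where f = "measure M"])
  also have "\<dots> = measure lborel ({0<..<pi} \<inter> ?A) / measure lborel {0<..<pi}"
    unfolding unif
  proof (rule measure_uniform_measure)
    have "emeasure lborel {0<..<pi} = ennreal pi" by simp
    then show "emeasure lborel {0<..<pi} \<noteq> 0" "emeasure lborel {0<..<pi} \<noteq> \<infinity>"
      using pi_gt_zero by (metis ennreal_eq_0_iff not_le, metis ennreal_neq_top infinity_ennreal_def)
  qed simp
  also have "measure lborel ({0<..<pi} \<inter> ?A) = 0"
  proof (cases "{0<..<pi} \<inter> ?A = {}")
    case False
    then obtain u where u: "u \<in> {0<..<pi} \<inter> ?A" by blast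
    have "{0<..<pi} \<inter> ?A \<subseteq> {u}"
    proof
      fix v assume v: "v \<in> {0<..<pi} \<inter> ?A"
      then show "v \<in> {u}"
        using u ln_kanter_strict_mono[OF \<alpha>, of u v] ln_kanter_strict_mono[OF \<alpha>, of v u]
        by (cases u v rule: linorder_cases) auto
    qed
    then have "{0<..<pi} \<inter> ?A = {u}" using u by blast
    then show ?thesis by simp
  qed simp
  finally show ?thesis by simp
qed

lemma measure_ln_kanter_law_interval:
  assumes "ln_b0 \<alpha> < a" "a \<le> b"
  shows "measure ln_kanter_law {a<..b} = integral {a..b} (kanter_dens \<alpha>)"
  by (rule real_distribution.kanter_mellin_inversion[OF real_distribution_ln_kanter_law \<alpha> assms char_ln_kanter_law])
     (rule measure_ln_kanter_law_singleton)+

text \<open>Nonnegativity is not visible in the imaginary part of a limit. The integral from e to x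
  is the probability of an interval, hence increasing in x, and the density is its
  derivative.\<close>

lemma kanter_dens_nonneg:
  assumes x: "ln_b0 \<alpha> < x"
  shows "kanter_dens \<alpha> x \<ge> 0"
proof -
  interpret law: real_distribution ln_kanter_law by (rule real_distribution_ln_kanter_law)
  obtain e where e: "ln_b0 \<alpha> < e" "e < x" using dense[OF x] by blast
  show ?thesis
  proof (rule mono_on_imp_deriv_nonneg)
    show "((\<lambda>x. integral {e..x} (kanter_dens \<alpha>)) has_real_derivative kanter_dens \<alpha> x) (at x)"
      by (rule has_real_derivative_integral_kanter_dens[OF \<alpha> e])
    show "mono_on {e..x + 1} (\<lambda>x. integral {e..x} (kanter_dens \<alpha>))"
    proof (rule mono_onI)
      fix r s assume "r \<in> {e..x + 1}" "s \<in> {e..x + 1}" "r \<le> s"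
      then show "integral {e..r} (kanter_dens \<alpha>) \<le> integral {e..s} (kanter_dens \<alpha>)"
        using e by (simp only: measure_ln_kanter_law_interval[symmetric] atLeastAtMost_iff) (intro law.finite_measure_mono; auto)
    qed
    show "x \<in> interior {e..x + 1}" using e by auto
  qed
qed

lemma kanter_a_dens_nonneg: "kanter_a_dens \<alpha> y \<ge> 0"
proof (cases "y > exp (ln_b0 \<alpha> / (1 - \<alpha>))")
  case True
  then have "y > 0" using exp_gt_zero less_trans by blast
  then show ?thesis using True kanter_dens_nonneg[OF ln_b0_less_mult_ln[OF \<alpha> True]] \<alpha> by (simp add: kanter_a_dens_def)
qed (simp add: kanter_a_dens_def)

lemma measurable_kanter_a_dens [measurable]: "kanter_a_dens \<alpha> \<in> borel_measurable borel"
proof -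
  let ?S = "{exp (ln_b0 \<alpha> / (1 - \<alpha>))<..}"
  have "continuous_on ?S (\<lambda>y. (1 - \<alpha>) * kanter_dens \<alpha> ((1 - \<alpha>) * ln y) / y)"
  proof (rule continuous_at_imp_continuous_on, rule ballI)
    fix y assume "y \<in> ?S"
    then have y: "ln_b0 \<alpha> < (1 - \<alpha>) * ln y" "y > 0"
      using ln_b0_less_mult_ln[OF \<alpha>] exp_gt_zero less_trans by (auto, blast)
    have "isCont (\<lambda>y. kanter_dens \<alpha> ((1 - \<alpha>) * ln y)) y"
      by (rule isCont_o2[where g = "kanter_dens \<alpha>"]) (use y in \<open>auto intro!: continuous_intros isCont_kanter_dens[OF \<alpha>]\<close>)
    then show "isCont (\<lambda>y. (1 - \<alpha>) * kanter_dens \<alpha> ((1 - \<alpha>) * ln y) / y) y"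
      using y by (intro continuous_intros) auto
  qed
  then have "(\<lambda>y. indicator ?S y *\<^sub>R ((1 - \<alpha>) * kanter_dens \<alpha> ((1 - \<alpha>) * ln y) / y)) \<in> borel_measurable borel"
    by (intro borel_measurable_continuous_on_indicator) auto
  also have "(\<lambda>y. indicator ?S y *\<^sub>R ((1 - \<alpha>) * kanter_dens \<alpha> ((1 - \<alpha>) * ln y) / y)) = kanter_a_dens \<alpha>"
    by (auto simp: fun_eq_iff kanter_a_dens_def)
  finally show ?thesis .
qed

text \<open>The left end c stays strictly above the threshold, on the range where the density is
  known to be continuous; the threshold itself is reached later by exhaustion.\<close>

lemma nn_integral_kanter_a_dens_Icc:
  assumes c: "exp (ln_b0 \<alpha> / (1 - \<alpha>)) < c" and y: "c \<le> y"
  shows "(\<integral>\<^sup>+x. ennreal (kanter_a_dens \<alpha> x) * indicator {c..y} x \<partial>lborel)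
    = ennreal (prob {\<omega> \<in> space M. c < kanter_a \<alpha> (U \<omega>) \<and> kanter_a \<alpha> (U \<omega>) \<le> y})"
proof -
  let ?x = "\<lambda>y. (1 - \<alpha>) * ln y"
  have c0: "c > 0" using c exp_gt_zero less_trans by blast
  \<comment> \<open>The base point e lies strictly below (1 - \<alpha>) ln c, so that the
    antiderivative is differentiable at z = c as well.\<close>
  obtain e where e: "ln_b0 \<alpha> < e" "e < ?x c" using dense[OF ln_b0_less_mult_ln[OF \<alpha> c]] by blast
  have mono: "?x c \<le> ?x z" if "c \<le> z" for z using that c0 \<alpha> by (intro mult_left_mono) auto
  let ?F = "\<lambda>y. integral {e..?x y} (kanter_dens \<alpha>)"
  have "(\<integral>\<^sup>+x. ennreal (kanter_a_dens \<alpha> x) * indicator {c..y} x \<partial>lborel) = ennreal (?F y - ?F c)"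
  proof (rule nn_integral_FTC_Icc)
    fix z assume "z \<in> {c..y}"
    then have z: "z > exp (ln_b0 \<alpha> / (1 - \<alpha>))" "z > 0" "e < ?x z"
      using c c0 e mono[of z] by auto
    have "(?x has_real_derivative (1 - \<alpha>) / z) (at z)" using z by (auto intro!: derivative_eq_intros)
    from DERIV_chain'[OF this has_real_derivative_integral_kanter_dens[OF \<alpha> e(1) z(3)]]
    show "(?F has_real_derivative kanter_a_dens \<alpha> z) (at z)"
      using z by (simp add: kanter_a_dens_def mult_ac)
  qed (use kanter_a_dens_nonneg y in auto)
  also have "?F y - ?F c = integral {?x c..?x y} (kanter_dens \<alpha>)"
  proof -
    have "?F c + integral {?x c..?x y} (kanter_dens \<alpha>) = ?F y"
      by (rule Henstock_Kurzweil_Integration.integral_combine)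
         (use e mono[OF y] continuous_on_kanter_dens[OF \<alpha> e(1)] in \<open>auto intro: integrable_continuous_interval\<close>)
    then show ?thesis by simp
  qed
  also have "\<dots> = measure ln_kanter_law {?x c<..?x y}"
    by (rule measure_ln_kanter_law_interval[symmetric]) (use e mono[OF y] in auto)
  also have "\<dots> = prob {\<omega> \<in> space M. ?x c < ln_kanter \<alpha> (U \<omega>) \<and> ln_kanter \<alpha> (U \<omega>) \<le> ?x y}"
    by (subst measure_distr) (auto intro!: arg_cong[where f = prob])
  also have "\<dots> = prob {\<omega> \<in> space M. c < kanter_a \<alpha> (U \<omega>) \<and> kanter_a \<alpha> (U \<omega>) \<le> y}"
  proof (rule finite_measure_eq_AE)
    show "AE \<omega> in M. \<omega> \<in> {\<omega> \<in> space M. ?x c < ln_kanter \<alpha> (U \<omega>) \<and> ln_kanter \<alpha> (U \<omega>) \<le> ?x y}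
       \<longleftrightarrow> \<omega> \<in> {\<omega> \<in> space M. c < kanter_a \<alpha> (U \<omega>) \<and> kanter_a \<alpha> (U \<omega>) \<le> y}"
      using AE_kanter_a_eq
    proof eventually_elim
      case (elim \<omega>)
      have "c = exp (?x c / (1 - \<alpha>))" "y = exp (?x y / (1 - \<alpha>))" using c0 y \<alpha> by auto
      then have cmp: "c < kanter_a \<alpha> (U \<omega>) \<longleftrightarrow> ?x c / (1 - \<alpha>) < ln_kanter \<alpha> (U \<omega>) / (1 - \<alpha>)"
        "kanter_a \<alpha> (U \<omega>) \<le> y \<longleftrightarrow> ln_kanter \<alpha> (U \<omega>) / (1 - \<alpha>) \<le> ?x y / (1 - \<alpha>)"
        unfolding elim by (metis exp_less_cancel_iff, metis exp_le_cancel_iff)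
      have "a / (1 - \<alpha>) < b / (1 - \<alpha>) \<longleftrightarrow> a < b" "a / (1 - \<alpha>) \<le> b / (1 - \<alpha>) \<longleftrightarrow> a \<le> b" for a b
        using \<alpha> by (simp_all add: divide_less_cancel divide_le_cancel)
      then show ?case using cmp by (simp only: mem_Collect_eq)
    qed
  qed measurable
  finally show ?thesis .
qed

text \<open>A law on the line is determined by its distribution function. For y above the threshold
  both sides are exhausted by intervals whose left ends decrease to the threshold; no mass is lost,
  because the variable almost surely exceeds it.\<close>

lemma distributed_kanter_a: "distributed M lborel (\<lambda>\<omega>. kanter_a \<alpha> (U \<omega>)) (\<lambda>y. ennreal (kanter_a_dens \<alpha> y))"
proof -
  let ?a0 = "exp (ln_b0 \<alpha> / (1 - \<alpha>))" and ?A = "\<lambda>\<omega>. kanter_a \<alpha> (U \<omega>)"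
  have main: "(\<integral>\<^sup>+x. ennreal (kanter_a_dens \<alpha> x) * indicator {..y} x \<partial>lborel) = ennreal (prob {\<omega> \<in> space M. ?A \<omega> \<le> y})" for y
  proof (cases "y \<le> ?a0")
    case True
    have "(\<integral>\<^sup>+x. ennreal (kanter_a_dens \<alpha> x) * indicator {..y} x \<partial>lborel) = (\<integral>\<^sup>+x. 0 \<partial>(lborel :: real measure))"
      using True by (intro nn_integral_cong) (auto simp: kanter_a_dens_def split: split_indicator)
    moreover have "prob {\<omega> \<in> space M. ?A \<omega> \<le> y} = prob {}"
      by (rule finite_measure_eq_AE) (use AE_kanter_a_gt True in \<open>auto elim!: eventually_mono\<close>)
    ultimately show ?thesis by simp
  next
    case False
    then have y: "?a0 < y" by simp
    define c where "c = (\<lambda>n::nat. ?a0 + (y - ?a0) / (real n + 1))"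
    have c: "?a0 < c n" "c n \<le> y" for n
    proof -
      show "?a0 < c n" using y by (auto simp: c_def)
      have "(y - ?a0) / (real n + 1) \<le> (y - ?a0) / 1" using y by (intro divide_left_mono) auto
      then show "c n \<le> y" by (simp add: c_def)
    qed
    have cdec: "c m \<le> c n" if "n \<le> m" for m n
      using that y by (auto simp: c_def intro!: divide_left_mono)
    have clim: "c \<longlonglongrightarrow> ?a0"
    proof -
      have "(\<lambda>n. ?a0 + (y - ?a0) / (real n + 1)) \<longlonglongrightarrow> ?a0 + 0"
        by (intro tendsto_add tendsto_const) real_asymp
      then show ?thesis by (simp add: c_def)
    qed
    have below: "\<exists>n. c n < z" if "?a0 < z" for z
      using order_tendstoD(2)[OF clim that] by (auto simp: eventually_sequentially)
    have "(\<integral>\<^sup>+x. ennreal (kanter_a_dens \<alpha> x) * indicator {..y} x \<partial>lborel)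
       = (\<integral>\<^sup>+x. (SUP n. ennreal (kanter_a_dens \<alpha> x) * indicator {c n..y} x) \<partial>lborel)"
    proof (rule nn_integral_cong)
      fix x
      show "ennreal (kanter_a_dens \<alpha> x) * indicator {..y} x = (SUP n. ennreal (kanter_a_dens \<alpha> x) * indicator {c n..y} x)"
      proof (cases "?a0 < x \<and> x \<le> y")
        case True
        then obtain n where "c n < x" using below by blast
        then show ?thesis using True
          by (intro antisym SUP_upper2[of n] SUP_least) (auto split: split_indicator)
      next
        case False
        then have "ennreal (kanter_a_dens \<alpha> x) * indicator {..y} x = 0"
           "ennreal (kanter_a_dens \<alpha> x) * indicator {c n..y} x = 0" for n
          by (auto simp: kanter_a_dens_def split: split_indicator)
        then show ?thesis by (simp only: SUP_const UNIV_not_empty not_False_eq_True)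
      qed
    qed
    also have "\<dots> = (SUP n. \<integral>\<^sup>+x. ennreal (kanter_a_dens \<alpha> x) * indicator {c n..y} x \<partial>lborel)"
    proof (rule nn_integral_monotone_convergence_SUP)
      show "incseq (\<lambda>n x. ennreal (kanter_a_dens \<alpha> x) * indicator {c n..y} x)"
        using cdec by (fastforce simp: incseq_def le_fun_def split: split_indicator)
    qed measurable
    also have "\<dots> = (SUP n. emeasure M {\<omega> \<in> space M. c n < ?A \<omega> \<and> ?A \<omega> \<le> y})"
      by (simp add: nn_integral_kanter_a_dens_Icc[OF c] emeasure_eq_measure)
    also have "\<dots> = emeasure M (\<Union>n. {\<omega> \<in> space M. c n < ?A \<omega> \<and> ?A \<omega> \<le> y})"
    proof (rule SUP_emeasure_incseq)
      show "incseq (\<lambda>n. {\<omega> \<in> space M. c n < ?A \<omega> \<and> ?A \<omega> \<le> y})"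
        using cdec by (fastforce simp: incseq_def)
    qed auto
    also have "\<dots> = emeasure M {\<omega> \<in> space M. ?A \<omega> \<le> y}"
    proof (rule emeasure_eq_AE)
      show "AE \<omega> in M. \<omega> \<in> (\<Union>n. {\<omega> \<in> space M. c n < ?A \<omega> \<and> ?A \<omega> \<le> y}) \<longleftrightarrow> \<omega> \<in> {\<omega> \<in> space M. ?A \<omega> \<le> y}"
        using AE_kanter_a_gt by eventually_elim (use below in auto)
    qed auto
    finally show ?thesis by (simp add: emeasure_eq_measure)
  qed
  show ?thesis
  proof (rule distributedI_borel_atMost)
    show "emeasure M {\<omega> \<in> space M. ?A \<omega> \<le> y} = ennreal (prob {\<omega> \<in> space M. ?A \<omega> \<le> y})" for y
      by (rule emeasure_eq_measure)
    show "(\<integral>\<^sup>+x. ennreal (kanter_a_dens \<alpha> x * indicator {..y} x) \<partial>lborel) = ennreal (prob {\<omega> \<in> space M. ?A \<omega> \<le> y})" for y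
      unfolding main[symmetric] by (intro nn_integral_cong) (auto split: split_indicator)
  qed (use kanter_a_dens_nonneg in auto)
qed

lemma kanter_a_dens_fox_H:
  assumes y: "exp (ln_b0 \<alpha> / (1 - \<alpha>)) < y"
  shows "complex_of_real (kanter_a_dens \<alpha> y) = of_real (1 / y) * fox_H 1 (\<alpha> / (1 - \<alpha>)) 1 1 1 (1 / (1 - \<alpha>)) (1 / y)"
    and "complex_of_real (kanter_a_dens \<alpha> y) = of_real (2 * (1 - \<alpha>) / y)
      * fox_H 1 (2 * \<alpha>) 1 (2 * (1 - \<alpha>)) 1 2 (1 / y powr (2 * (1 - \<alpha>)))"
proof -
  have y0: "y > 0" using y exp_gt_zero less_trans by blast
  note x = ln_b0_less_mult_ln[OF \<alpha> y]
  \<comment> \<open>Both choices of z and \<kappa> give the same value (1 - \<alpha>) ln y of - ln z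
    / \<kappa>, so the two Fox functions differ only by the factor 1 / \<kappa>.\<close>
  have 1: "- ln (1 / y) / (1 / (1 - \<alpha>)) = (1 - \<alpha>) * ln y" using y0 by (simp add: ln_div)
  have 2: "- ln (1 / y powr (2 * (1 - \<alpha>))) / 2 = (1 - \<alpha>) * ln y" using y0 by (simp add: ln_div ln_powr)
  have "fox_H 1 (1 / (1 - \<alpha>) * \<alpha>) 1 (1 / (1 - \<alpha>) * (1 - \<alpha>)) 1 (1 / (1 - \<alpha>)) (1 / y)
      = of_real (kanter_dens \<alpha> ((1 - \<alpha>) * ln y) / (1 / (1 - \<alpha>)))"
    using fox_H_eq_kanter_dens[OF \<alpha>, of "1 / (1 - \<alpha>)" "1 / y"] x \<alpha> unfolding 1 by simp
  then show "complex_of_real (kanter_a_dens \<alpha> y) = of_real (1 / y) * fox_H 1 (\<alpha> / (1 - \<alpha>)) 1 1 1 (1 / (1 - \<alpha>)) (1 / y)"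
    using \<alpha> y by (simp add: kanter_a_dens_def mult_ac)
  have f2: "fox_H 1 (2 * \<alpha>) 1 (2 * (1 - \<alpha>)) 1 2 (1 / y powr (2 * (1 - \<alpha>)))
      = of_real (kanter_dens \<alpha> ((1 - \<alpha>) * ln y) / 2)"
    using fox_H_eq_kanter_dens[OF \<alpha>, of 2 "1 / y powr (2 * (1 - \<alpha>))"] x unfolding 2 by simp
  show "complex_of_real (kanter_a_dens \<alpha> y) = of_real (2 * (1 - \<alpha>) / y)
      * fox_H 1 (2 * \<alpha>) 1 (2 * (1 - \<alpha>)) 1 2 (1 / y powr (2 * (1 - \<alpha>)))"
    unfolding f2 of_real_mult[symmetric] of_real_eq_iff
  proof -
    have "(1 - \<alpha>) * d / y = 2 * (1 - \<alpha>) / y * (d / 2)" for d using y0 by (simp add: field_simps)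
    then show "kanter_a_dens \<alpha> y = 2 * (1 - \<alpha>) / y * (kanter_dens \<alpha> ((1 - \<alpha>) * ln y) / 2)"
      using y by (simp only: kanter_a_dens_def if_True)
  qed
qed

end

lemma tendsto_kanter_a_0:
  assumes \<alpha>: "0 < \<alpha>" "\<alpha> < 1"
  shows "(kanter_a \<alpha> \<longlongrightarrow> exp (ln_b0 \<alpha> / (1 - \<alpha>))) (at_right 0)"
proof (rule Lim_transform_eventually)
  show "((\<lambda>u. exp (ln_kanter \<alpha> u / (1 - \<alpha>))) \<longlongrightarrow> exp (ln_b0 \<alpha> / (1 - \<alpha>))) (at_right 0)"
    using \<alpha> by (intro tendsto_intros tendsto_ln_kanter_0) auto
  show "\<forall>\<^sub>F u in at_right 0. exp (ln_kanter \<alpha> u / (1 - \<alpha>)) = kanter_a \<alpha> u"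
    unfolding eventually_at_right_field
    by (intro exI[of _ pi]) (use kanter_a_eq_exp[OF \<alpha>] in auto)
qed

theorem proposition1:
  fixes \<alpha> :: real and M :: "'a measure" and U :: "'a \<Rightarrow> real"
  assumes "0 < \<alpha>" and "\<alpha> < 1"
    and "prob_space M"
    and "U \<in> borel_measurable M"
    and "distr M lborel U = uniform_measure lborel {0<..<pi}"
  shows "(kanter_a \<alpha> \<longlongrightarrow> (1 - \<alpha>) * \<alpha> powr (\<alpha> / (1 - \<alpha>))) (at_right 0)
    \<and> (AE \<omega> in M. kanter_a \<alpha> (U \<omega>) > (1 - \<alpha>) * \<alpha> powr (\<alpha> / (1 - \<alpha>)))
    \<and> (\<exists>h :: real \<Rightarrow> real.
          (\<forall>y. 0 \<le> h y)
        \<and> distributed M lborel (\<lambda>\<omega>. kanter_a \<alpha> (U \<omega>)) (\<lambda>y. ennreal (h y))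
        \<and> (\<forall>y \<le> (1 - \<alpha>) * \<alpha> powr (\<alpha> / (1 - \<alpha>)). h y = 0)
        \<and> (\<forall>y > (1 - \<alpha>) * \<alpha> powr (\<alpha> / (1 - \<alpha>)).
              complex_of_real (h y) =
                complex_of_real (1 / y)
                  * fox_H 1 (\<alpha> / (1 - \<alpha>)) 1 1 1 (1 / (1 - \<alpha>)) (1 / y)
            \<and> complex_of_real (h y) =
                complex_of_real (2 * (1 - \<alpha>) / y)
                  * fox_H 1 (2 * \<alpha>) 1 (2 * (1 - \<alpha>)) 1 2 (1 / y powr (2 * (1 - \<alpha>)))))"
  unfolding kanter_a0_eq_exp[OF assms(1,2)]
proof (intro conjI exI[of _ "kanter_a_dens \<alpha>"] allI impI)
  show "(kanter_a \<alpha> \<longlongrightarrow> exp (ln_b0 \<alpha> / (1 - \<alpha>))) (at_right 0)"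
    by (rule tendsto_kanter_a_0[OF assms(1,2)])
  show "AE \<omega> in M. kanter_a \<alpha> (U \<omega>) > exp (ln_b0 \<alpha> / (1 - \<alpha>))"
    by (rule AE_kanter_a_gt[OF assms])
  show "0 \<le> kanter_a_dens \<alpha> y" for y by (rule kanter_a_dens_nonneg[OF assms])
  show "distributed M lborel (\<lambda>\<omega>. kanter_a \<alpha> (U \<omega>)) (\<lambda>y. ennreal (kanter_a_dens \<alpha> y))"
    by (rule distributed_kanter_a[OF assms])
  show "kanter_a_dens \<alpha> y = 0" if "y \<le> exp (ln_b0 \<alpha> / (1 - \<alpha>))" for y
    using that by (simp add: kanter_a_dens_def)
qed (fact kanter_a_dens_fox_H[OF assms])+

end
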